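(* Let $s\in(0,1]$ and $p\in[1,+\infty)$ be such that $sp<N$ and $s\neq p$. Let $\Omega\subset\mathbb{R}^N$ be an open and bounded domain with Lipschitz boundary. Let $\widetilde s\in[0,1]$ and $\widetilde p\in[1,+\infty]$. If $\widetilde s$ and $\widetilde p$ do not satisfy $$0\le\widetilde s<s\qquad\text{and}\qquad 1\le\widetilde p\le\frac{Np}{N-(s-\widetilde s)p},$$ then the space $W^{s,p}(\Omega)$ is not continuously embedded in $W^{\widetilde s,\widetilde p}(\Omega)$. (In this sense, the continuous embedding of $W^{s,p}(\Omega)$ in $W^{\widetilde s,\widetilde p}(\Omega)$, which holds whenever the displayed condition is satisfied, is optimal.)
   Context: $N\ge1$ is an integer and functions are real-valued and measurable. For $s\in[0,1]$ and $p\in[1,+\infty)$ define $[u]_{W^{0,p}(\Omega)}:=\|u\|_{L^p(\Omega)}$, $[u]_{W^{1,p}(\Omega)}:=\|\nabla u\|_{L^p(\Omega)}$ (weak gradient) and, for $s\in(0,1)$, $$[u]_{W^{s,p}(\Omega)}:=\left(c_{N,s,p}\iint_{\Omega\times\Omega}\frac{|u(x)-u(y)|^p}{|x-y|^{N+sp}}\,dx\,dy\right)^{1/p},\qquad c_{N,s,p}:=\frac{s\,2^{2s-1}\,\Gamma\left(\frac{ps+p+N-2}{2}\right)}{\pi^{N/2}\,\Gamma(1-s)}.$$ Set $W^{s,p}(\Omega):=\{u\in L^p(\Omega):[u]_{W^{s,p}(\Omega)}<+\infty\}$, with norm $\|u\|_{W^{0,p}(\Omega)}:=\|u\|_{L^p(\Omega)}$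 if $s=0$ and $\|u\|_{W^{s,p}(\Omega)}:=\big([u]^p_{W^{s,p}(\Omega)}+\|u\|^p_{L^p(\Omega)}\big)^{1/p}$ if $s\in(0,1]$. For $p=+\infty$: $W^{0,\infty}(\Omega):=L^\infty(\Omega)$ and, for $s\in(0,1]$, $W^{s,\infty}(\Omega):=C^{0,s}(\Omega)$ with norm $\|u\|_{L^\infty(\Omega)}+\sup_{x\neq y\in\Omega}\frac{|u(x)-u(y)|}{|x-y|^s}$ (functions being identified up to a.e. equality). A space $X$ is continuously embedded in $Y$ if there is a constant $C>0$ such that $\|u\|_Y\le C\|u\|_X$ for all $u\in X$.
   Formalization: The cases s̃ = s with p̃ = p, and s̃ = s = 1 with p̃ ≤ p, are excluded, since there the embedding holds (identity, or Hölder on the bounded set); the positive embedding recalled in the parenthesis is not part of the formal theorem. *)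

theory Defs
  imports "HOL-Analysis.Analysis" "HOL-Probability.Essential_Supremum"
begin

text \<open>All norms and seminorms below take values in \<^typ>\<open>ennreal\<close>, and equal \<open>\<infinity>\<close> when the
  function does not have the corresponding regularity. Functions are total on \<^typ>\<open>real^'n\<close>, but
  only their values on \<open>\<Omega>\<close> matter. Powers are only used with exponents \<open>a > 0\<close>.\<close>

definition epowr :: "ennreal \<Rightarrow> real \<Rightarrow> ennreal" where
  "epowr x a = (if x = \<infinity> then \<infinity> else ennreal (enn2real x powr a))"

definition Lp_norm :: "'a measure \<Rightarrow> ereal \<Rightarrow> ('a \<Rightarrow> 'b::real_normed_vector) \<Rightarrow> ennreal" where
  "Lp_norm M p f =
     (if p = \<infinity> then esssup M (\<lambda>x. ennreal (norm (f x)))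
      else epowr (\<integral>\<^sup>+x. ennreal (norm (f x) powr real_of_ereal p) \<partial>M) (1 / real_of_ereal p))"


definition partial_deriv :: "'n \<Rightarrow> (real^'n \<Rightarrow> real) \<Rightarrow> real^'n \<Rightarrow> real" where
  "partial_deriv i f x = frechet_derivative f (at x) (axis i 1)"

primrec Ck :: "nat \<Rightarrow> (real^'n \<Rightarrow> real) \<Rightarrow> bool" where
  "Ck 0 f \<longleftrightarrow> continuous_on UNIV f"
| "Ck (Suc k) f \<longleftrightarrow> f differentiable_on UNIV \<and> (\<forall>i. Ck k (partial_deriv i f))"

definition test_function :: "(real^'n) set \<Rightarrow> (real^'n \<Rightarrow> real) \<Rightarrow> bool" where
  "test_function \<Omega> \<phi> \<longleftrightarrow>
     (\<forall>k. Ck k \<phi>) \<and> compact (closure {x. \<phi> x \<noteq> 0}) \<and> closure {x. \<phi> x \<noteq> 0} \<subseteq> \<Omega>"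

definition weak_gradient ::
    "(real^'n) set \<Rightarrow> (real^'n \<Rightarrow> real) \<Rightarrow> (real^'n \<Rightarrow> real^'n) \<Rightarrow> bool" where
  "weak_gradient \<Omega> u g \<longleftrightarrow>
     (\<forall>K. compact K \<and> K \<subseteq> \<Omega> \<longrightarrow> u absolutely_integrable_on K \<and> g absolutely_integrable_on K) \<and>
     (\<forall>\<phi> i. test_function \<Omega> \<phi> \<longrightarrow>
        (LINT x|lebesgue_on \<Omega>. u x * partial_deriv i \<phi> x) =
        - (LINT x|lebesgue_on \<Omega>. g x $ i * \<phi> x))"


definition sobolev_const :: "nat \<Rightarrow> real \<Rightarrow> real \<Rightarrow> real" where
  "sobolev_const N s p =
     s * 2 powr (2 * s - 1) * Gamma ((p * s + p + real N - 2) / 2) /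
     (pi powr (real N / 2) * Gamma (1 - s))"

text \<open>The weak gradient is unique up to null sets, so for \<open>s = 1\<close> the infimum below ranges over
  at most one value. Likewise, for \<open>p = \<infinity>\<close> and \<open>s > 0\<close> it ranges over the representatives \<open>v\<close> of the
  a.e. class of \<open>u\<close>: the supremum is infinite unless \<open>v\<close> is continuous on \<open>\<Omega>\<close>, and an a.e. class
  has at most one continuous representative on an open set.\<close>

definition W_seminorm :: "(real^'n) set \<Rightarrow> real \<Rightarrow> ereal \<Rightarrow> (real^'n \<Rightarrow> real) \<Rightarrow> ennreal" where
  "W_seminorm \<Omega> s p u =
     (if s = 0 then Lp_norm (lebesgue_on \<Omega>) p u
      else if p = \<infinity> then
        (INF v \<in> {v. AE x in lebesgue_on \<Omega>. v x = u x}.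
           SUP (x, y) \<in> {(x, y). x \<in> \<Omega> \<and> y \<in> \<Omega> \<and> x \<noteq> y}.
             ennreal (\<bar>v x - v y\<bar> / norm (x - y) powr s))
      else if s = 1 then
        (INF g \<in> {g. weak_gradient \<Omega> u g}. Lp_norm (lebesgue_on \<Omega>) p g)
      else
        epowr (ennreal (sobolev_const CARD('n) s (real_of_ereal p)) *
          (\<integral>\<^sup>+(x, y). ennreal (\<bar>u x - u y\<bar> powr real_of_ereal p /
                                 norm (x - y) powr (real CARD('n) + s * real_of_ereal p))
             \<partial>(lebesgue_on \<Omega> \<Otimes>\<^sub>M lebesgue_on \<Omega>)))
          (1 / real_of_ereal p))"

definition W :: "(real^'n) set \<Rightarrow> real \<Rightarrow> ereal \<Rightarrow> (real^'n \<Rightarrow> real) set" where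
  "W \<Omega> s p = {u \<in> borel_measurable (lebesgue_on \<Omega>).
                 Lp_norm (lebesgue_on \<Omega>) p u < \<infinity> \<and> W_seminorm \<Omega> s p u < \<infinity>}"

definition W_norm :: "(real^'n) set \<Rightarrow> real \<Rightarrow> ereal \<Rightarrow> (real^'n \<Rightarrow> real) \<Rightarrow> ennreal" where
  "W_norm \<Omega> s p u =
     (if s = 0 then Lp_norm (lebesgue_on \<Omega>) p u
      else if p = \<infinity> then Lp_norm (lebesgue_on \<Omega>) p u + W_seminorm \<Omega> s p u
      else epowr (epowr (W_seminorm \<Omega> s p u) (real_of_ereal p) +
                  epowr (Lp_norm (lebesgue_on \<Omega>) p u) (real_of_ereal p)) (1 / real_of_ereal p))"

text \<open>The inclusion \<^term>\<open>W \<Omega> s p \<subseteq> W \<Omega> s' p'\<close> is part of the norm inequality, whose left-hand side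
  is infinite outside \<^term>\<open>W \<Omega> s' p'\<close>; see \<open>W_embedded_imp_subset\<close>.\<close>

definition W_embedded :: "(real^'n) set \<Rightarrow> real \<Rightarrow> ereal \<Rightarrow> real \<Rightarrow> ereal \<Rightarrow> bool" where
  "W_embedded \<Omega> s p s' p' \<longleftrightarrow>
     (\<exists>C::real. C > 0 \<and> (\<forall>u \<in> W \<Omega> s p. W_norm \<Omega> s' p' u \<le> ennreal C * W_norm \<Omega> s p u))"


text \<open>Near each boundary point \<open>\<Omega>\<close> is, up to a rigid motion, the region above the graph of a Lipschitz
  function. The direction \<open>\<nu>\<close> plays the role of the last coordinate axis and the hyperplane
  orthogonal to \<open>\<nu>\<close> that of the remaining coordinates.\<close>

definition lipschitz_boundary :: "(real^'n) set \<Rightarrow> bool" where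
  "lipschitz_boundary \<Omega> \<longleftrightarrow>
     (\<forall>x \<in> frontier \<Omega>. \<exists>\<nu> r L \<gamma>. norm \<nu> = 1 \<and> r > 0 \<and> L-lipschitz_on {z. z \<bullet> \<nu> = 0} \<gamma> \<and>
        \<Omega> \<inter> ball x r = {y \<in> ball x r. \<gamma> (y - (y \<bullet> \<nu>) *\<^sub>R \<nu>) < y \<bullet> \<nu>})"


lemma epowr_eq_top_iff: "epowr x a = \<infinity> \<longleftrightarrow> x = \<infinity>"
  by (simp add: epowr_def)

lemma W_norm_finite_iff:
  "W_norm \<Omega> s p u < \<infinity> \<longleftrightarrow> Lp_norm (lebesgue_on \<Omega>) p u < \<infinity> \<and> W_seminorm \<Omega> s p u < \<infinity>"
proof -
  have *: "epowr x a < \<infinity> \<longleftrightarrow> x < \<infinity>" for x a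
    using epowr_eq_top_iff[of x a] by (simp add: less_top[symmetric])
  show ?thesis
  proof (cases "s = 0")
    case True
    then show ?thesis by (simp add: W_norm_def W_seminorm_def)
  next
    case False
    have "x + y < (\<infinity>::ennreal) \<longleftrightarrow> x < \<infinity> \<and> y < \<infinity>" for x y
      by simp
    then show ?thesis using False unfolding W_norm_def by (auto simp only: * if_False split: if_splits)
  qed
qed

lemma W_embedded_imp_subset:
  assumes "W_embedded \<Omega> s p s' p'"
  shows "W \<Omega> s p \<subseteq> W \<Omega> s' p'"
proof
  fix u assume u: "u \<in> W \<Omega> s p"
  then have "W_norm \<Omega> s p u < \<infinity>"
    by (simp only: W_norm_finite_iff) (simp add: W_def)
  moreover obtain C :: real where "W_norm \<Omega> s' p' u \<le> ennreal C * W_norm \<Omega> s p u"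
    using assms u unfolding W_embedded_def by blast
  ultimately have "W_norm \<Omega> s' p' u < \<infinity>"
    by (metis ennreal_less_top ennreal_mult_less_top infinity_ennreal_def order_le_less_trans)
  then show "u \<in> W \<Omega> s' p'"
    using u by (simp only: W_norm_finite_iff) (simp add: W_def)
qed

text \<open>The following is why the case \<open>s' = s\<close>, \<open>p' = p\<close> has to be excluded from any optimality statement
  that lists \<open>s' < s\<close> among the conditions for embedding; the case \<open>s' = s = 1\<close>, \<open>p' < p\<close> is excluded
  for the analogous reason that \<open>L\<^sup>p\<close> embeds into \<open>L\<^sup>q\<close> for \<open>q \<le> p\<close> on a bounded set.\<close>

lemma W_embedded_refl: "W_embedded \<Omega> s p s p"
  unfolding W_embedded_def by (rule exI[of _ 1]) simp

end

theory Submission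
  imports Defs "HOL-Computational_Algebra.Polynomial"
begin

text \<open>Two families of functions defeat all the embeddings.

  Rescaled bumps \<open>\<eta>((x - c) / r)\<close> have \<open>W\<^sup>s\<^sup>,\<^sup>p\<close> norm comparable to \<open>r\<close> to the power \<open>N / p - s\<close>, so letting
  \<open>r \<rightarrow> 0\<close> forces \<open>N / p - s \<le> N / p' - s'\<close>. This settles \<open>s' < s\<close>, as well as \<open>s' = s\<close> with \<open>p' > p\<close>;
  \<open>p' = \<infinity>\<close> reduces to \<open>s' = 0\<close> with a large finite exponent.

  For \<open>s < 1\<close>, let \<open>u = \<Sum>\<^sub>k a\<^sub>k\<^sup>-\<^sup>s sin (a\<^sub>k x\<^sub>1 + \<beta>)\<close> with \<open>a\<^sub>k = \<omega> M\<^sup>k\<close> for a large even \<open>M\<close> and \<open>k\<close> ranging over a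
  finite set \<open>I\<close>. Then \<open>\<parallel>u\<parallel>\<^sup>p\<close> in \<open>W\<^sup>s\<^sup>,\<^sup>p\<close> is at most of order \<open>|I|\<close>, because at every distance \<open>|x - y|\<close> the terms are
  dominated by a geometric series around their maximum. Conversely, the annulus \<open>|x - y| \<sim> \<pi> / a\<^sub>k\<close> contributes at
  least \<open>a\<^sub>k\<close> to the power \<open>(\<sigma> - s) q\<close> to the Gagliardo seminorm of order \<open>\<sigma>\<close> and exponent \<open>q\<close>, for every
  \<open>k \<in> I\<close>. A single frequency excludes \<open>\<sigma> > s\<close>; for \<open>\<sigma> = s\<close>, \<open>n\<close> frequencies give \<open>n\<^sup>1\<^sup>/\<^sup>q \<lesssim> n\<^sup>1\<^sup>/\<^sup>p\<close>, which excludes \<open>q < p\<close>.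
  Order \<open>\<sigma> = 1\<close> is excluded by duality with test functions.\<close>

subsection \<open>Power norms and a singular kernel\<close>

text \<open>Concentration only sees the number \<open>N / p - s\<close>, and lowering the target
  exponent can always make up for a fixed target order when \<open>s' = s\<close>. So
  \<open>s' = s\<close>, \<open>p' < p\<close>, and part of the range \<open>s' > s\<close>, call
  for oscillation spread over a fixed ball. The case \<open>s' = s\<close>, \<open>p' < p\<close> is
  the delicate one, since L^p spaces on a bounded set are nested, and so are the first order Sobolev
  spaces. For \<open>s < 1\<close>, however, the Gagliardo integral is in effect a sum over the
  scales of |x - y|, with equal weight for each scale. It therefore behaves like an l^p sum of the
  energies at single scales, and n equal entries have l^p norm \<open>n powr (1 / p)\<close>. A
  lacunary sum realises such a sequence, provided that the scales do not interfere. Its upper and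
  lower constants must be uniform in the number and the size of the frequencies; this dictates the
  weights, the gaps and the disjoint annuli. The assumption \<open>s * p < N\<close> makes
  \<open>N / p - s\<close> positive, which is what lets a large finite exponent contradict scaling
  when \<open>p' = \<infinity>\<close>.\<close>

lemma epowr_ennreal: "0 \<le> t \<Longrightarrow> epowr (ennreal t) a = ennreal (t powr a)"
  by (simp add: epowr_def)

lemma epowr_mono:
  assumes "0 \<le> a" "x \<le> y"
  shows "epowr x a \<le> epowr y a"
proof (cases "y = \<infinity>")
  case False
  then obtain v where v: "y = ennreal v" "0 \<le> v" by (cases y) auto
  with assms(2) obtain w where w: "x = ennreal w" "0 \<le> w" by (cases x) (auto simp: top_unique)
  with v assms show ?thesis by (auto simp: epowr_ennreal intro!: powr_mono2)
qed (simp add: epowr_def)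

lemma epowr_epowr_inverse:
  assumes "0 < a"
  shows "epowr (epowr x (1 / a)) a = x"
proof (cases x)
  case (real r)
  then show ?thesis using assms by (simp add: epowr_ennreal powr_powr)
qed (simp add: epowr_def)

lemma ennreal_le_epowr_iff:
  assumes "0 < a" "0 \<le> t"
  shows "ennreal t \<le> epowr x (1 / a) \<longleftrightarrow> ennreal (t powr a) \<le> x"
proof
  assume "ennreal t \<le> epowr x (1 / a)"
  from epowr_mono[OF _ this, of a] show "ennreal (t powr a) \<le> x"
    using assms by (simp add: epowr_epowr_inverse epowr_ennreal)
next
  assume "ennreal (t powr a) \<le> x"
  from epowr_mono[OF _ this, of "1 / a"] show "ennreal t \<le> epowr x (1 / a)"
    using assms by (simp add: epowr_ennreal powr_powr)
qed

lemma epowr_le_ennreal_iff: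
  assumes "0 < a" "0 \<le> t"
  shows "epowr x (1 / a) \<le> ennreal t \<longleftrightarrow> x \<le> ennreal (t powr a)"
proof
  assume "epowr x (1 / a) \<le> ennreal t"
  from epowr_mono[OF _ this, of a] show "x \<le> ennreal (t powr a)"
    using assms by (simp add: epowr_epowr_inverse epowr_ennreal)
next
  assume "x \<le> ennreal (t powr a)"
  from epowr_mono[OF _ this, of "1 / a"] show "epowr x (1 / a) \<le> ennreal t"
    using assms by (simp add: epowr_ennreal powr_powr)
qed

lemma emeasure_lborel_ball:
  fixes c :: "real^'n"
  shows "0 \<le> r \<Longrightarrow> emeasure lborel (ball c r) = ennreal (unit_ball_vol (real CARD('n)) * r powr real CARD('n))"
  by (cases "r = 0") (auto simp: emeasure_ball powr_realpow intro!: arg_cong[where f=ennreal])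

lemma emeasure_lborel_cball:
  fixes c :: "real^'n"
  shows "0 \<le> r \<Longrightarrow> emeasure lborel (cball c r) = ennreal (unit_ball_vol (real CARD('n)) * r powr real CARD('n))"
  by (cases "r = 0") (auto simp: emeasure_cball powr_realpow intro!: arg_cong[where f=ennreal])

lemma nn_integral_shift:
  fixes f :: "'a::euclidean_space \<Rightarrow> ennreal"
  assumes [measurable]: "f \<in> borel_measurable borel"
  shows "(\<integral>\<^sup>+x. f (c + x) \<partial>lborel) = (\<integral>\<^sup>+x. f x \<partial>lborel)"
proof -
  have "(\<integral>\<^sup>+x. f x \<partial>lborel) = (\<integral>\<^sup>+x. f x \<partial>distr lborel borel ((+) c))"
    by (simp add: lborel_distr_plus)
  also have "\<dots> = (\<integral>\<^sup>+x. f (c + x) \<partial>lborel)"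
    by (subst nn_integral_distr) auto
  finally show ?thesis by simp
qed

lemma nn_integral_reflect:
  fixes f :: "'a::euclidean_space \<Rightarrow> ennreal"
  assumes [measurable]: "f \<in> borel_measurable borel"
  shows "(\<integral>\<^sup>+x. f (c - x) \<partial>lborel) = (\<integral>\<^sup>+x. f x \<partial>lborel)"
proof -
  have "(\<integral>\<^sup>+x. f x \<partial>lborel) = (\<integral>\<^sup>+x. f x \<partial>density (distr lborel borel (\<lambda>x. c + (-1) *\<^sub>R x)) (\<lambda>x. ennreal (\<bar>- 1\<bar> ^ DIM('a))))"
    by (subst lborel_affine[of "-1" c]) auto
  also have "\<dots> = (\<integral>\<^sup>+x. f (c - x) \<partial>lborel)"
    by (simp add: nn_integral_density nn_integral_distr)
  finally show ?thesis by simp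
qed

text \<open>Any simple function for the completion can be made Borel by setting it to 0 on a null
  set, so both integrals have the same supremum for every \<open>f\<close>. This is why
  \<open>Lp_integral_le_indicator\<close> and \<open>Lp_integral_ge_indicator\<close> carry no
  measurability condition on \<open>f\<close>.\<close>

lemma nn_integral_lebesgue_on:
  assumes "\<Omega> \<in> sets borel"
  shows "(\<integral>\<^sup>+x. f x \<partial>lebesgue_on \<Omega>) = (\<integral>\<^sup>+x. f x * indicator \<Omega> x \<partial>lborel)"
  using assms by (simp add: nn_integral_restrict_space nn_integral_completion)

text \<open>Scales up to 1 and scales above 1 get separate natural indices because the kernel is
  summed with a different geometric ratio on each side.\<close>

lemma dyadic_scale:
  fixes t :: real
  assumes "0 < t"
  obtains k :: nat where "2 powr (- real k) / 2 < t" "t \<le> 2 powr (- real k)"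
    | k :: nat where "2 powr (real k + 1) / 2 < t" "t \<le> 2 powr (real k + 1)"
proof -
  define i where "i = \<lceil>log 2 t\<rceil>"
  have 1: "t \<le> 2 powr i"
    using assms by (metis i_def le_of_int_ceiling le_log_iff log_le_iff one_less_numeral_iff powr_gt_zero semiring_norm(76) zero_neq_numeral)
  have "i - 1 < log 2 t" unfolding i_def by linarith
  then have "2 powr (i - 1) < t"
    using assms by (simp add: less_log_iff)
  then have 2: "2 powr i / 2 < t" by (simp add: powr_diff)
  show ?thesis
  proof (cases "i \<le> 0")
    case True
    then have "real_of_int i = - real (nat (- i))" by simp
    with 1 2 that(1) show ?thesis by metis
  next
    case False
    then have "real_of_int i = real (nat (i - 1)) + 1" by (simp add: of_nat_nat)
    with 1 2 that(2) show ?thesis by metis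
  qed
qed

text \<open>Up to a constant, this majorises the Gagliardo density of a function with oscillation at
  most 1 and Lipschitz constant \<open>1 / \<delta>\<close>; the parameter \<open>\<sigma>\<close>
  stands for \<open>s * p\<close>.\<close>

definition kernel :: "real \<Rightarrow> real \<Rightarrow> real \<Rightarrow> real^'n \<Rightarrow> real" where
  "kernel p \<sigma> \<delta> h = min 1 ((norm h / \<delta>) powr p) / norm h powr (real CARD('n) + \<sigma>)"

lemma kernel_measurable [measurable]: "kernel p \<sigma> \<delta> \<in> borel_measurable borel"
  unfolding kernel_def by measurable

lemma kernel_nonneg [simp]: "0 \<le> kernel p \<sigma> \<delta> h"
  by (simp add: kernel_def)

text \<open>The numerator is taken at the outer radius and the denominator at the inner radius
  \<open>r / 2\<close>, which produces the factor \<open>2 powr (N + \<sigma>)\<close>; the volume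
  is that of the full ball.\<close>

lemma kernel_annulus:
  assumes "0 < \<sigma>" "\<sigma> < p" "0 < \<delta>" "0 < r"
  defines "A \<equiv> {h::real^'n. r / 2 < norm h \<and> norm h \<le> r}"
  shows "(\<integral>\<^sup>+h. ennreal (kernel p \<sigma> \<delta> h) * indicator A h \<partial>lborel)
     \<le> ennreal (unit_ball_vol (real CARD('n)) * 2 powr (real CARD('n) + \<sigma>) * min 1 ((r / \<delta>) powr p) * r powr (- \<sigma>))"
proof -
  let ?N = "real CARD('n)"
  let ?B = "min 1 ((r / \<delta>) powr p) / (r / 2) powr (?N + \<sigma>)"
  have le: "kernel p \<sigma> \<delta> h \<le> ?B" if "h \<in> A" for h
  proof -
    from that have h: "r / 2 < norm h" "norm h \<le> r" by (auto simp: A_def)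
    have "(norm h / \<delta>) powr p \<le> (r / \<delta>) powr p"
      using assms h by (intro powr_mono2 divide_right_mono) auto
    moreover have "(r / 2) powr (?N + \<sigma>) \<le> norm h powr (?N + \<sigma>)"
      using assms h by (intro powr_mono2) auto
    moreover have "0 < (r / 2) powr (?N + \<sigma>)" using assms by simp
    ultimately show ?thesis unfolding kernel_def by (intro frac_le) auto
  qed
  have "(\<integral>\<^sup>+h. ennreal (kernel p \<sigma> \<delta> h) * indicator A h \<partial>lborel) \<le> (\<integral>\<^sup>+h. ennreal ?B * indicator (cball (0::real^'n) r) h \<partial>lborel)"
    using le by (intro nn_integral_mono) (auto simp: indicator_def A_def intro!: ennreal_leI)
  also have "\<dots> = ennreal ?B * ennreal (unit_ball_vol ?N * r powr ?N)"
    using assms by (simp add: emeasure_lborel_cball nn_integral_cmult_indicator)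
  also have "\<dots> = ennreal (?B * (unit_ball_vol ?N * r powr ?N))"
    by (rule ennreal_mult[symmetric]) (use assms in auto)
  also have "?B * (unit_ball_vol ?N * r powr ?N) = unit_ball_vol ?N * 2 powr (?N + \<sigma>) * min 1 ((r / \<delta>) powr p) * r powr (- \<sigma>)"
    using assms by (simp add: powr_divide powr_add powr_minus field_simps)
  finally show ?thesis .
qed

text \<open>Near 0 the kernel behaves like |h|^(p - N - \<sigma>), integrable as
  \<open>\<sigma> < p\<close>, and far away like |h|^(- N - \<sigma>), integrable as
  \<open>0 < \<sigma>\<close>. The annuli have radii proportional to \<open>\<delta>\<close>, so
  \<open>J\<close> does not depend on \<open>\<delta>\<close>.\<close>

lemma nn_integral_kernel_le:
  assumes "0 < \<sigma>" "\<sigma> < p"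
  obtains J :: real where "0 < J"
    "\<And>\<delta>. 0 < \<delta> \<Longrightarrow> (\<integral>\<^sup>+h. ennreal (kernel p \<sigma> \<delta> (h::real^'n)) \<partial>lborel) \<le> ennreal (J * \<delta> powr (- \<sigma>))"
proof -
  let ?N = "real CARD('n)"
  define V where "V = unit_ball_vol ?N * 2 powr (?N + \<sigma>)"
  have V: "0 < V" by (simp add: V_def)
  \<comment> \<open>\<open>q1\<close> is the ratio of consecutive annuli inside radius
    \<open>\<delta>\<close>, \<open>q2\<close> the ratio outside.\<close>
  define q1 where "q1 = 2 powr (\<sigma> - p)"
  define q2 where "q2 = 2 powr (- \<sigma>)"
  have q: "0 < q1" "q1 < 1" "0 < q2" "q2 < 1"
    using assms by (auto simp: q1_def q2_def powr_less_one)
  define J where "J = V * (1 / (1 - q1)) + V * (1 / (1 - q2))"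
  show ?thesis
  proof
    show "0 < J" unfolding J_def using V q by (intro add_pos_pos mult_pos_pos) auto
    fix \<delta> :: real assume \<delta>: "0 < \<delta>"
    define A where "A r = {h::real^'n. r / 2 < norm h \<and> norm h \<le> r}" for r
    have [measurable]: "A r \<in> sets borel" for r unfolding A_def by measurable
    let ?f = "\<lambda>h::real^'n. ennreal (kernel p \<sigma> \<delta> h)"
    define r1 where "r1 k = \<delta> * 2 powr (- real k)" for k :: nat
    define r2 where "r2 k = \<delta> * 2 powr (real k + 1)" for k :: nat
    have r: "0 < r1 k" "0 < r2 k" for k using \<delta> by (auto simp: r1_def r2_def)
    \<comment> \<open>The annuli miss only \<open>h = 0\<close>, where the numerator of the kernel
      vanishes.\<close>
    have pt: "?f h \<le> (\<Sum>k. ?f h * indicator (A (r1 k)) h) + (\<Sum>k. ?f h * indicator (A (r2 k)) h)" for h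
    proof (cases "h = 0")
      case False
      then have "0 < norm h / \<delta>" using \<delta> by simp
      then show ?thesis
      proof (cases rule: dyadic_scale)
        case (1 k)
        then have "h \<in> A (r1 k)" using \<delta> by (simp add: A_def r1_def field_simps)
        then have "?f h = (\<Sum>k\<in>{k}. ?f h * indicator (A (r1 k)) h)" by simp
        also have "\<dots> \<le> (\<Sum>k. ?f h * indicator (A (r1 k)) h)"
          by (rule sum_le_suminf) auto
        finally show ?thesis by (simp add: add_increasing2)
      next
        case (2 k)
        then have "h \<in> A (r2 k)" using \<delta> by (simp add: A_def r2_def field_simps)
        then have "?f h = (\<Sum>k\<in>{k}. ?f h * indicator (A (r2 k)) h)" by simp
        also have "\<dots> \<le> (\<Sum>k. ?f h * indicator (A (r2 k)) h)"
          by (rule sum_le_suminf) auto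
        finally show ?thesis by (simp add: add_increasing)
      qed
    qed (simp add: kernel_def)
    have geo: "(\<Sum>k. ennreal (c * x ^ k)) = ennreal (c * (1 / (1 - x)))" if "0 \<le> c" "0 < x" "x < 1" for c x :: real
    proof -
      have "(\<lambda>k. c * x ^ k) sums (c * (1 / (1 - x)))"
        using that by (intro sums_mult geometric_sums) auto
      then show ?thesis using that by (intro suminf_ennreal_eq) auto
    qed
    have "(\<integral>\<^sup>+h. ?f h \<partial>lborel) \<le> (\<integral>\<^sup>+h. (\<Sum>k. ?f h * indicator (A (r1 k)) h) + (\<Sum>k. ?f h * indicator (A (r2 k)) h) \<partial>lborel)"
      by (intro nn_integral_mono pt)
    also have "\<dots> = (\<Sum>k. \<integral>\<^sup>+h. ?f h * indicator (A (r1 k)) h \<partial>lborel) + (\<Sum>k. \<integral>\<^sup>+h. ?f h * indicator (A (r2 k)) h \<partial>lborel)"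
      by (simp add: nn_integral_add nn_integral_suminf del: ennreal_suminf_cmult)
    also have "\<dots> \<le> (\<Sum>k. ennreal (V * \<delta> powr (-\<sigma>) * q1 ^ k)) + (\<Sum>k. ennreal (V * \<delta> powr (-\<sigma>) * q2 ^ k))"
    proof (intro add_mono suminf_le)
      fix k
      have "(\<integral>\<^sup>+h. ?f h * indicator (A (r1 k)) h \<partial>lborel) \<le> ennreal (V * min 1 ((r1 k / \<delta>) powr p) * r1 k powr (- \<sigma>))"
        unfolding V_def A_def by (rule kernel_annulus) (use assms \<delta> r in auto)
      also have "\<dots> \<le> ennreal (V * \<delta> powr (-\<sigma>) * q1 ^ k)"
      proof (rule ennreal_leI)
        have "min 1 ((r1 k / \<delta>) powr p) * r1 k powr (- \<sigma>) \<le> (r1 k / \<delta>) powr p * r1 k powr (- \<sigma>)"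
          by (intro mult_right_mono) auto
        also have "\<dots> = \<delta> powr (-\<sigma>) * q1 ^ k"
          using \<delta> by (simp add: r1_def q1_def powr_mult powr_powr powr_power powr_add[symmetric] algebra_simps)
        finally show "V * min 1 ((r1 k / \<delta>) powr p) * r1 k powr (- \<sigma>) \<le> V * \<delta> powr (-\<sigma>) * q1 ^ k"
          using V by (simp add: mult.assoc)
      qed
      finally show "(\<integral>\<^sup>+h. ?f h * indicator (A (r1 k)) h \<partial>lborel) \<le> ennreal (V * \<delta> powr (-\<sigma>) * q1 ^ k)" .
    next
      fix k
      have "(\<integral>\<^sup>+h. ?f h * indicator (A (r2 k)) h \<partial>lborel) \<le> ennreal (V * min 1 ((r2 k / \<delta>) powr p) * r2 k powr (- \<sigma>))"
        unfolding V_def A_def by (rule kernel_annulus) (use assms \<delta> r in auto)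
      also have "\<dots> \<le> ennreal (V * \<delta> powr (-\<sigma>) * q2 ^ k)"
      proof (rule ennreal_leI)
        have "min 1 ((r2 k / \<delta>) powr p) * r2 k powr (- \<sigma>) \<le> 1 * r2 k powr (- \<sigma>)"
          by (intro mult_right_mono) auto
        \<comment> \<open>The outer radii start at \<open>2 * \<delta>\<close> rather than
          \<open>\<delta>\<close>, hence one more factor \<open>q2\<close>, dropped in the next
          step.\<close>
        also have "\<dots> = \<delta> powr (-\<sigma>) * (q2 ^ k * q2)"
          using \<delta> by (simp add: r2_def q2_def powr_mult powr_powr powr_power powr_add[symmetric] algebra_simps)
        also have "\<dots> \<le> \<delta> powr (-\<sigma>) * (q2 ^ k * 1)"
          using q by (intro mult_left_mono) auto
        finally show "V * min 1 ((r2 k / \<delta>) powr p) * r2 k powr (- \<sigma>) \<le> V * \<delta> powr (-\<sigma>) * q2 ^ k"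
          using V by (simp add: mult.assoc)
      qed
      finally show "(\<integral>\<^sup>+h. ?f h * indicator (A (r2 k)) h \<partial>lborel) \<le> ennreal (V * \<delta> powr (-\<sigma>) * q2 ^ k)" .
    qed auto
    also have "\<dots> = ennreal (V * \<delta> powr (-\<sigma>) * (1 / (1 - q1))) + ennreal (V * \<delta> powr (-\<sigma>) * (1 / (1 - q2)))"
      using V q by (subst (1 2) geo) auto
    also have "\<dots> = ennreal (J * \<delta> powr (-\<sigma>))"
      using V q by (subst ennreal_plus[symmetric]) (auto simp: J_def algebra_simps)
    finally show "(\<integral>\<^sup>+h. ?f h \<partial>lborel) \<le> ennreal (J * \<delta> powr (- \<sigma>))" .
  qed
qed

subsection \<open>Fractional seminorms\<close>

lemma sigma_finite_lebesgue_on_bounded: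
  fixes \<Omega> :: "'a::euclidean_space set"
  assumes "\<Omega> \<in> sets borel" "bounded \<Omega>"
  shows "sigma_finite_measure (lebesgue_on \<Omega>)"
proof -
  have "\<Omega> \<in> lmeasurable"
    using assms by (intro bounded_set_imp_lmeasurable) auto
  then interpret finite_measure "lebesgue_on \<Omega>" by (rule finite_measure_lebesgue_on)
  show ?thesis by unfold_locales
qed

text \<open>Boundedness makes \<open>lebesgue_on \<Omega>\<close> finite, so Tonelli applies to the
  product; for Borel \<open>F\<close> each completed measure can then be traded for
  \<open>lborel\<close>, where translations are available.\<close>

lemma nn_integral_lebesgue_on_pair:
  fixes \<Omega> :: "'a::euclidean_space set"
  assumes \<Omega>: "\<Omega> \<in> sets borel" "bounded \<Omega>"
    and F[measurable]: "F \<in> borel_measurable (borel \<Otimes>\<^sub>M borel)"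
  shows "(\<integral>\<^sup>+z. F z \<partial>(lebesgue_on \<Omega> \<Otimes>\<^sub>M lebesgue_on \<Omega>)) =
    (\<integral>\<^sup>+x. (\<integral>\<^sup>+y. F (x, y) * indicator \<Omega> y \<partial>lborel) * indicator \<Omega> x \<partial>lborel)"
proof -
  let ?M = "lebesgue_on \<Omega>"
  interpret sigma_finite_measure ?M by (rule sigma_finite_lebesgue_on_bounded[OF \<Omega>])
  have id: "(\<lambda>x. x) \<in> measurable ?M borel" by (rule measurable_restrict_space1) (rule measurable_completion, simp)
  have "(\<lambda>z. (fst z, snd z)) \<in> measurable (?M \<Otimes>\<^sub>M ?M) (borel \<Otimes>\<^sub>M borel)"
    by (intro measurable_Pair measurable_compose[OF measurable_fst id] measurable_compose[OF measurable_snd id])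
  then have "F \<in> borel_measurable (?M \<Otimes>\<^sub>M ?M)"
    using measurable_compose[OF _ F] by fastforce
  then show ?thesis
    using \<Omega> by (simp add: nn_integral_fst[symmetric] nn_integral_lebesgue_on)
qed

text \<open>Each of the two indicator terms fixes one variable in \<open>S\<close>. Integrating the
  other variable over the whole space gives the integral of \<open>K\<close>, by translation and
  reflection invariance. Bumps use it with a small ball as \<open>S\<close>, lacunary sums with
  \<open>S = \<Omega>\<close>.\<close>

lemma nn_integral_pair_convolution_le:
  fixes \<Omega> :: "'a::euclidean_space set"
  assumes \<Omega>: "\<Omega> \<in> sets borel" "bounded \<Omega>"
    and F: "F \<in> borel_measurable (borel \<Otimes>\<^sub>M borel)"
    and K[measurable]: "K \<in> borel_measurable borel" and S[measurable]: "S \<in> sets borel"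
    and le: "\<And>x y. x \<in> \<Omega> \<Longrightarrow> y \<in> \<Omega> \<Longrightarrow> F (x, y) \<le> K (x - y) * (indicator S x + indicator S y)"
  shows "(\<integral>\<^sup>+z. F z \<partial>(lebesgue_on \<Omega> \<Otimes>\<^sub>M lebesgue_on \<Omega>)) \<le> 2 * emeasure lborel S * (\<integral>\<^sup>+h. K h \<partial>lborel)"
proof -
  let ?I = "\<integral>\<^sup>+h. K h \<partial>lborel"
  have "(\<integral>\<^sup>+z. F z \<partial>(lebesgue_on \<Omega> \<Otimes>\<^sub>M lebesgue_on \<Omega>)) =
    (\<integral>\<^sup>+x. (\<integral>\<^sup>+y. F (x, y) * indicator \<Omega> y \<partial>lborel) * indicator \<Omega> x \<partial>lborel)"
    by (rule nn_integral_lebesgue_on_pair[OF \<Omega> F])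
  also have "\<dots> \<le> (\<integral>\<^sup>+x. (\<integral>\<^sup>+y. K (x - y) * (indicator S x + indicator S y) * indicator \<Omega> y \<partial>lborel) * indicator \<Omega> x \<partial>lborel)"
  proof (rule nn_integral_mono)
    fix x
    have "(\<integral>\<^sup>+y. F (x, y) * indicator \<Omega> y \<partial>lborel) \<le> (\<integral>\<^sup>+y. K (x - y) * (indicator S x + indicator S y) * indicator \<Omega> y \<partial>lborel)" if "x \<in> \<Omega>"
    proof (rule nn_integral_mono)
      show "F (x, y) * indicator \<Omega> y \<le> K (x - y) * (indicator S x + indicator S y) * indicator \<Omega> y" for y
        using le[OF that, of y] by (cases "y \<in> \<Omega>") simp_all
    qed
    then show "(\<integral>\<^sup>+y. F (x, y) * indicator \<Omega> y \<partial>lborel) * indicator \<Omega> x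
      \<le> (\<integral>\<^sup>+y. K (x - y) * (indicator S x + indicator S y) * indicator \<Omega> y \<partial>lborel) * indicator \<Omega> x"
      by (cases "x \<in> \<Omega>") simp_all
  qed
  also have "\<dots> \<le> (\<integral>\<^sup>+x. (\<integral>\<^sup>+y. K (x - y) * indicator S x + K (x - y) * indicator S y \<partial>lborel) \<partial>lborel)"
    by (intro nn_integral_mono) (auto simp: indicator_def mult_2_right intro!: nn_integral_mono)
  also have "\<dots> = (\<integral>\<^sup>+x. (\<integral>\<^sup>+y. K (x - y) * indicator S x \<partial>lborel) \<partial>lborel) + (\<integral>\<^sup>+x. (\<integral>\<^sup>+y. K (x - y) * indicator S y \<partial>lborel) \<partial>lborel)"
    by (simp add: nn_integral_add)
  also have "(\<integral>\<^sup>+x. (\<integral>\<^sup>+y. K (x - y) * indicator S y \<partial>lborel) \<partial>lborel) = (\<integral>\<^sup>+y. (\<integral>\<^sup>+x. K (x - y) * indicator S y \<partial>lborel) \<partial>lborel)"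
    by (rule lborel_pair.Fubini') measurable
  also have "(\<integral>\<^sup>+x. (\<integral>\<^sup>+y. K (x - y) * indicator S x \<partial>lborel) \<partial>lborel) = (\<integral>\<^sup>+x. ?I * indicator S x \<partial>lborel)"
    by (subst nn_integral_multc) (auto simp: nn_integral_reflect)
  also have "(\<integral>\<^sup>+y. (\<integral>\<^sup>+x. K (x - y) * indicator S y \<partial>lborel) \<partial>lborel) = (\<integral>\<^sup>+y. ?I * indicator S y \<partial>lborel)"
    using nn_integral_shift[of K "- y" for y] by (subst nn_integral_multc) auto
  also have "(\<integral>\<^sup>+x. ?I * indicator S x \<partial>lborel) = ?I * emeasure lborel S"
    by (rule nn_integral_cmult_indicator) simp
  finally show ?thesis by (simp add: mult.commute mult.left_commute distrib_left mult_2)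
qed

definition gagliardo :: "(real^'n) set \<Rightarrow> real \<Rightarrow> real \<Rightarrow> (real^'n \<Rightarrow> real) \<Rightarrow> ennreal" where
  "gagliardo \<Omega> s p u = (\<integral>\<^sup>+(x, y). ennreal (\<bar>u x - u y\<bar> powr p / norm (x - y) powr (real CARD('n) + s * p))
     \<partial>(lebesgue_on \<Omega> \<Otimes>\<^sub>M lebesgue_on \<Omega>))"

definition Lp_integral :: "'a measure \<Rightarrow> real \<Rightarrow> ('a \<Rightarrow> 'b::real_normed_vector) \<Rightarrow> ennreal" where
  "Lp_integral M p f = (\<integral>\<^sup>+x. ennreal (norm (f x) powr p) \<partial>M)"

lemma W_norm_zero: "W_norm \<Omega> 0 (ereal p) u = epowr (Lp_integral (lebesgue_on \<Omega>) p u) (1 / p)"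
  by (simp add: W_norm_def Lp_norm_def Lp_integral_def)

text \<open>As \<open>p\<close> and \<open>N\<close> are at least 1, the numerator in the first
  Gamma argument is at least \<open>p * s\<close>; the other argument is
  \<open>1 - s\<close>.\<close>

lemma sobolev_const_pos:
  assumes "0 < s" "s < 1" "1 \<le> p" "1 \<le> N"
  shows "0 < sobolev_const N s p"
proof -
  have "0 < (p * s + p + real N - 2) / 2"
    using mult_pos_pos[of p s] assms by (simp, linarith)
  then show ?thesis using assms unfolding sobolev_const_def
    by (intro divide_pos_pos mult_pos_pos Gamma_real_pos) auto
qed

lemma W_norm_fractional:
  fixes \<Omega> :: "(real^'n) set"
  assumes "0 < s" "s < 1" "1 \<le> p"
  shows "W_norm \<Omega> s (ereal p) u =
    epowr (ennreal (sobolev_const CARD('n) s p) * gagliardo \<Omega> s p u + Lp_integral (lebesgue_on \<Omega>) p u) (1 / p)"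
  using assms by (simp add: W_norm_def W_seminorm_def Lp_norm_def Lp_integral_def gagliardo_def epowr_epowr_inverse)

lemma W_norm_one:
  assumes "1 \<le> p"
  shows "W_norm \<Omega> 1 (ereal p) u =
    epowr (epowr (INF g \<in> {g. weak_gradient \<Omega> u g}. epowr (Lp_integral (lebesgue_on \<Omega>) p g) (1 / p)) p + Lp_integral (lebesgue_on \<Omega>) p u) (1 / p)"
  using assms by (simp add: W_norm_def W_seminorm_def Lp_norm_def Lp_integral_def epowr_epowr_inverse)

lemma W_norm_le_fractional:
  fixes \<Omega> :: "(real^'n) set"
  assumes "0 < s" "s < 1" "1 \<le> p" "0 \<le> G" "0 \<le> L"
    and "gagliardo \<Omega> s p u \<le> ennreal G" "Lp_integral (lebesgue_on \<Omega>) p u \<le> ennreal L"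
  shows "W_norm \<Omega> s (ereal p) u \<le> ennreal ((sobolev_const CARD('n) s p * G + L) powr (1 / p))"
proof -
  let ?c = "sobolev_const CARD('n) s p"
  have c: "0 < ?c" using assms by (intro sobolev_const_pos) auto
  have "ennreal ?c * gagliardo \<Omega> s p u + Lp_integral (lebesgue_on \<Omega>) p u \<le> ennreal ?c * ennreal G + ennreal L"
    using assms by (intro add_mono mult_left_mono) auto
  also have "\<dots> = ennreal (?c * G + L)"
    using c assms by (simp add: ennreal_mult)
  finally show ?thesis
    using assms c by (simp add: W_norm_fractional epowr_le_ennreal_iff powr_powr)
qed

lemma W_norm_ge_fractional:
  fixes \<Omega> :: "(real^'n) set"
  assumes "0 < s" "s < 1" "1 \<le> p" "0 \<le> G" "ennreal G \<le> gagliardo \<Omega> s p u"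
  shows "ennreal ((sobolev_const CARD('n) s p * G) powr (1 / p)) \<le> W_norm \<Omega> s (ereal p) u"
proof -
  let ?c = "sobolev_const CARD('n) s p"
  have c: "0 < ?c" using assms by (intro sobolev_const_pos) auto
  have "ennreal (?c * G) = ennreal ?c * ennreal G" using c assms by (simp add: ennreal_mult)
  also have "\<dots> \<le> ennreal ?c * gagliardo \<Omega> s p u" using assms by (intro mult_left_mono) auto
  also have "\<dots> \<le> ennreal ?c * gagliardo \<Omega> s p u + Lp_integral (lebesgue_on \<Omega>) p u" by simp
  finally show ?thesis
    using assms c by (simp add: W_norm_fractional ennreal_le_epowr_iff powr_powr)
qed

lemma W_norm_one_le:
  assumes "1 \<le> p" "0 \<le> G" "0 \<le> L" "weak_gradient \<Omega> u g"
    and "Lp_integral (lebesgue_on \<Omega>) p g \<le> ennreal G" "Lp_integral (lebesgue_on \<Omega>) p u \<le> ennreal L"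
  shows "W_norm \<Omega> 1 (ereal p) u \<le> ennreal ((G + L) powr (1 / p))"
proof -
  let ?I = "INF g \<in> {g. weak_gradient \<Omega> u g}. epowr (Lp_integral (lebesgue_on \<Omega>) p g) (1 / p)"
  have "?I \<le> epowr (Lp_integral (lebesgue_on \<Omega>) p g) (1 / p)"
    using assms by (intro INF_lower) auto
  then have "epowr ?I p \<le> epowr (epowr (Lp_integral (lebesgue_on \<Omega>) p g) (1 / p)) p"
    using assms by (intro epowr_mono) auto
  also have "\<dots> = Lp_integral (lebesgue_on \<Omega>) p g" using assms by (intro epowr_epowr_inverse) auto
  finally have "epowr ?I p + Lp_integral (lebesgue_on \<Omega>) p u \<le> ennreal G + ennreal L"
    using assms by (intro add_mono) auto
  then show ?thesis
    using assms by (simp add: W_norm_one epowr_le_ennreal_iff powr_powr ennreal_plus)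
qed

text \<open>A bound uniform over all weak gradients passes to the infimum, also if there is no weak
  gradient and the infimum is \<infinity>.\<close>

lemma W_norm_one_ge:
  assumes "1 \<le> p" "0 \<le> G" "\<And>g. weak_gradient \<Omega> u g \<Longrightarrow> ennreal G \<le> Lp_integral (lebesgue_on \<Omega>) p g"
  shows "ennreal (G powr (1 / p)) \<le> W_norm \<Omega> 1 (ereal p) u"
proof -
  let ?I = "INF g \<in> {g. weak_gradient \<Omega> u g}. epowr (Lp_integral (lebesgue_on \<Omega>) p g) (1 / p)"
  have "ennreal (G powr (1 / p)) \<le> ?I"
    using assms by (intro INF_greatest) (simp add: ennreal_le_epowr_iff powr_powr)
  then have "epowr (ennreal (G powr (1 / p))) p \<le> epowr ?I p"
    using assms by (intro epowr_mono) auto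
  then have "ennreal G \<le> epowr ?I p + Lp_integral (lebesgue_on \<Omega>) p u"
    using assms by (simp add: epowr_ennreal powr_powr add_increasing2)
  then show ?thesis
    using assms by (simp add: W_norm_one ennreal_le_epowr_iff powr_powr)
qed

text \<open>Turns an embedding into an inequality between reals: a finite bound \<open>b\<close> for
  the source norm already yields membership in \<open>W \<Omega> s p\<close>, so only norm estimates
  are needed for each test family.\<close>

lemma W_embeddedE:
  assumes "W_embedded \<Omega> s p s' p'"
  obtains C where "0 < C"
    "\<And>u a b. u \<in> borel_measurable (lebesgue_on \<Omega>) \<Longrightarrow> W_norm \<Omega> s p u \<le> ennreal b \<Longrightarrow> 0 \<le> b
      \<Longrightarrow> ennreal a \<le> W_norm \<Omega> s' p' u \<Longrightarrow> a \<le> C * b"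
proof -
  obtain C where C: "0 < C" "\<And>u. u \<in> W \<Omega> s p \<Longrightarrow> W_norm \<Omega> s' p' u \<le> ennreal C * W_norm \<Omega> s p u"
    using assms unfolding W_embedded_def by blast
  show ?thesis
  proof (rule that[OF C(1)])
    fix u a b assume u: "u \<in> borel_measurable (lebesgue_on \<Omega>)" "W_norm \<Omega> s p u \<le> ennreal b" "0 \<le> b"
      "ennreal a \<le> W_norm \<Omega> s' p' u"
    then have "W_norm \<Omega> s p u < \<infinity>" using order_le_less_trans[OF u(2), of \<infinity>] by simp
    then have "u \<in> W \<Omega> s p" using u(1) by (simp only: W_norm_finite_iff) (simp add: W_def)
    then have "ennreal a \<le> ennreal C * W_norm \<Omega> s p u" using C(2) u(4) order_trans by blast
    also have "\<dots> \<le> ennreal C * ennreal b" using u by (intro mult_left_mono) auto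
    also have "\<dots> = ennreal (C * b)" using C u by (simp add: ennreal_mult)
    finally show "a \<le> C * b" using C u by (simp add: ennreal_le_iff)
  qed
qed

subsection \<open>Smooth functions\<close>

lemma partial_deriv_eq:
  "(f has_derivative f') (at x) \<Longrightarrow> partial_deriv i f x = f' (axis i 1)"
  by (simp add: partial_deriv_def frechet_derivative_at[symmetric])

lemma Ck_SucI:
  assumes "\<And>x. (f has_derivative f' x) (at x)" "\<And>i. Ck k (\<lambda>x. f' x (axis i 1))"
  shows "Ck (Suc k) f"
proof -
  have "partial_deriv i f = (\<lambda>x. f' x (axis i 1))" for i
    using partial_deriv_eq[OF assms(1)] by blast
  moreover have "f differentiable_on UNIV"
    using assms(1) by (auto simp: differentiable_on_def differentiable_def intro: has_derivative_at_withinI)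
  ultimately show ?thesis using assms(2) by simp
qed

lemma Ck_SucD: "Ck (Suc k) f \<Longrightarrow> Ck k f"
proof (induction k arbitrary: f)
  case 0
  then show ?case by (simp add: differentiable_imp_continuous_on)
next
  case (Suc k)
  then have "f differentiable_on UNIV" "Ck (Suc k) (partial_deriv i f)" for i
    unfolding Ck.simps(2)[of "Suc k"] by blast+
  with Suc.IH show ?case by (simp only: Ck.simps(2)) blast
qed

lemma Ck_Suc_has_derivative:
  "Ck (Suc k) f \<Longrightarrow> (f has_derivative frechet_derivative f (at x)) (at x)"
  by (simp add: differentiable_on_def frechet_derivative_works)

lemma Ck_const: "Ck k (\<lambda>_. c)"
proof (induction k arbitrary: c)
  case (Suc k)
  show ?case by (rule Ck_SucI[where f' = "\<lambda>_ _. 0"]) (auto simp: Suc)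
qed simp

lemma Ck_add: "Ck k f \<Longrightarrow> Ck k g \<Longrightarrow> Ck k (\<lambda>x. f x + g x)"
proof (induction k arbitrary: f g)
  case 0
  then show ?case by (simp add: continuous_on_add)
next
  case (Suc k)
  show ?case
  proof (rule Ck_SucI)
    show "((\<lambda>x. f x + g x) has_derivative (\<lambda>h. frechet_derivative f (at x) h + frechet_derivative g (at x) h)) (at x)" for x
      using Suc.prems by (intro has_derivative_add Ck_Suc_has_derivative)
    show "Ck k (\<lambda>x. frechet_derivative f (at x) (axis i 1) + frechet_derivative g (at x) (axis i 1))" for i
      using Suc.IH[of "partial_deriv i f" "partial_deriv i g"] Suc.prems by (simp add: partial_deriv_def[abs_def])
  qed
qed

lemma Ck_mult: "Ck k f \<Longrightarrow> Ck k g \<Longrightarrow> Ck k (\<lambda>x. f x * g x)"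
proof (induction k arbitrary: f g)
  case 0
  then show ?case by (simp add: continuous_on_mult)
next
  case (Suc k)
  show ?case
  proof (rule Ck_SucI)
    show "((\<lambda>x. f x * g x) has_derivative (\<lambda>h. f x * frechet_derivative g (at x) h + frechet_derivative f (at x) h * g x)) (at x)" for x
      using Suc.prems by (intro has_derivative_mult Ck_Suc_has_derivative)
    show "Ck k (\<lambda>x. f x * frechet_derivative g (at x) (axis i 1) + frechet_derivative f (at x) (axis i 1) * g x)" for i
      using Suc.IH[OF Ck_SucD[OF Suc.prems(1)], of "partial_deriv i g"] Suc.IH[OF _ Ck_SucD[OF Suc.prems(2)], of "partial_deriv i f"] Suc.prems
      by (intro Ck_add) (simp_all add: partial_deriv_def[abs_def])
  qed
qed

lemma Ck_nth: "Ck k (\<lambda>x. x $ i)"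
proof (cases k)
  case (Suc m)
  then show ?thesis
    using Ck_SucI[of "\<lambda>x. x $ i" "\<lambda>_ h. h $ i" m] by (auto intro: Ck_const bounded_linear_imp_has_derivative bounded_linear_vec_nth)
qed (simp add: continuous_on_component)

lemma has_derivative_sin_nth:
  fixes x :: "real^'n"
  shows "((\<lambda>x. sin (a * x $ i + b)) has_derivative (\<lambda>h. cos (a * x $ i + b) * (a * h $ i))) (at x)"
  by (auto intro!: derivative_eq_intros bounded_linear_imp_has_derivative bounded_linear_vec_nth simp: algebra_simps)

text \<open>Differentiation shifts the phase by \<open>pi / 2\<close>, so the induction runs over
  all phases at once.\<close>

lemma Ck_sin_nth: "Ck k (\<lambda>x. sin (a * x $ i + b))"
proof (induction k arbitrary: b)
  case 0
  show ?case by (auto intro!: continuous_intros)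
next
  case (Suc k)
  show ?case
  proof (rule Ck_SucI[OF has_derivative_sin_nth])
    have "cos t = sin (t + pi / 2)" for t :: real by (simp add: sin_add)
    then show "Ck k (\<lambda>x. cos (a * x $ i + b) * (a * axis j 1 $ i))" for j
      using Ck_mult[OF Suc[of "b + pi / 2"] Ck_const[of _ "a * axis j 1 $ i"]] by (simp add: add.assoc)
  qed
qed

subsection \<open>Smooth bumps\<close>

text \<open>Polynomials in 1/t times exp (- 1/t), extended by 0: the smallest convenient family that
  contains the standard flat function \<open>flat 1\<close> and is closed under
  differentiation.\<close>

definition flat :: "real poly \<Rightarrow> real \<Rightarrow> real" where
  "flat P t = (if t \<le> 0 then 0 else poly P (1 / t) * exp (- (1 / t)))"

text \<open>The power \<open>z ^ k\<close> absorbs the variable that each \<open>pCons\<close>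
  splits off; later \<open>k = 1\<close> serves as the factor 1/h of a difference quotient at
  0.\<close>

lemma poly_times_exp_neg_tendsto_0: "((\<lambda>z. z ^ k * poly P z * exp (- z)) \<longlongrightarrow> (0::real)) at_top"
proof (induction P arbitrary: k)
  case (pCons a P)
  have "((\<lambda>z. a * (z ^ k / exp z) + z ^ Suc k * poly P z * exp (- z)) \<longlongrightarrow> a * 0 + 0) at_top"
    by (intro tendsto_intros tendsto_power_div_exp_0 pCons.IH)
  then show ?case by (simp add: algebra_simps exp_minus divide_inverse)
qed simp

text \<open>For \<open>z = 1 / t\<close> one has dz/dt = - z^2, so P(z) exp(- z) has derivative z^2
  (P - P')(z) exp(- z). At 0 the exponential beats every power in the difference quotient.\<close>

lemma flat_has_derivative:
  "(flat P has_real_derivative flat (monom 1 2 * (P - pderiv P)) t) (at t)"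
proof -
  consider "t < 0" | "t = 0" | "0 < t" by linarith
  then show ?thesis
  proof cases
    case 1
    have "((\<lambda>_. 0) has_real_derivative 0) (at t)" by simp
    then have "(flat P has_real_derivative 0) (at t)"
      by (rule has_field_derivative_transform_within_open[where S="{..<0}"]) (use 1 in \<open>auto simp: flat_def\<close>)
    then show ?thesis using 1 by (simp add: flat_def)
  next
    case 3
    have "((\<lambda>t. poly P (1 / t) * exp (- (1 / t))) has_real_derivative
      poly P (1 / t) * (exp (- (1 / t)) * (1 / t^2)) + poly (pderiv P) (1 / t) * (- 1 / t^2) * exp (- (1 / t))) (at t)"
      using 3 by (auto intro!: derivative_eq_intros DERIV_chain2[OF poly_DERIV] simp: power2_eq_square)
    then have "(flat P has_real_derivative
      poly P (1 / t) * (exp (- (1 / t)) * (1 / t^2)) + poly (pderiv P) (1 / t) * (- 1 / t^2) * exp (- (1 / t))) (at t)"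
      by (rule has_field_derivative_transform_within_open[where S="{0<..}"]) (use 3 in \<open>auto simp: flat_def\<close>)
    moreover have "poly P (1 / t) * (exp (- (1 / t)) * (1 / t^2)) + poly (pderiv P) (1 / t) * (- 1 / t^2) * exp (- (1 / t))
      = flat (monom 1 2 * (P - pderiv P)) t"
      using 3 by (simp add: flat_def poly_monom field_simps)
    ultimately show ?thesis by simp
  next
    case 2
    have L: "((\<lambda>h. flat P h / h) \<longlongrightarrow> 0) (at_left 0)"
      by (rule tendsto_eventually) (auto simp: eventually_at_filter flat_def)
    have "((\<lambda>h. (1 / h) ^ 1 * poly P (1 / h) * exp (- (1 / h))) \<longlongrightarrow> 0) (at_right 0)"
      by (rule filterlim_compose[OF poly_times_exp_neg_tendsto_0])
        (use filterlim_inverse_at_top_right in \<open>simp add: inverse_eq_divide\<close>)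
    then have R: "((\<lambda>h. flat P h / h) \<longlongrightarrow> 0) (at_right 0)"
      by (rule Lim_transform_eventually) (auto simp: eventually_at_filter flat_def)
    have "((\<lambda>h. flat P h / h) \<longlongrightarrow> 0) (at 0)"
      using L R by (rule filterlim_split_at)
    then show ?thesis using 2 by (simp add: DERIV_def flat_def)
  qed
qed

text \<open>The chain rule yields another member of the \<open>flat\<close> family times a partial
  derivative of \<open>q\<close>; hence the induction keeps \<open>P\<close> arbitrary.\<close>

lemma Ck_flat_compose:
  assumes "\<And>k. Ck k q"
  shows "Ck k (\<lambda>x. flat P (q x))"
proof (induction k arbitrary: P)
  case 0
  have "continuous_on UNIV (flat P)"
    using flat_has_derivative[of P] by (intro continuous_at_imp_continuous_on ballI DERIV_isCont) blast
  moreover have "continuous_on UNIV q" using assms[of 0] by simp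
  ultimately show ?case
    by (simp add: continuous_on_compose2[of UNIV "flat P" UNIV q])
next
  case (Suc k)
  let ?Q = "monom 1 2 * (P - pderiv P)"
  show ?case
  proof (rule Ck_SucI)
    show "((\<lambda>x. flat P (q x)) has_derivative (\<lambda>h. flat ?Q (q x) * frechet_derivative q (at x) h)) (at x)" for x
      using has_derivative_compose[OF Ck_Suc_has_derivative[OF assms[of "Suc 0"]] has_field_derivative_imp_has_derivative[OF flat_has_derivative]]
      by simp
    show "Ck k (\<lambda>x. flat ?Q (q x) * frechet_derivative q (at x) (axis i 1))" for i
      using Ck_mult[OF Suc[of ?Q], of "partial_deriv i q"] assms[of "Suc k"] by (simp add: partial_deriv_def[abs_def])
  qed
qed

text \<open>The usual mollifier profile exp (- 1 / (1 - |x - c|^2 / r^2)), with the squared norm so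
  that the inner function is a polynomial.\<close>

definition bump :: "real^'n \<Rightarrow> real \<Rightarrow> real^'n \<Rightarrow> real" where
  "bump c r x = flat 1 (1 - (x - c) \<bullet> (x - c) / r\<^sup>2)"

definition bump_deriv :: "real^'n \<Rightarrow> real \<Rightarrow> real^'n \<Rightarrow> real^'n" where
  "bump_deriv c r x = (- (2 / r\<^sup>2) * flat (monom 1 2) (1 - (x - c) \<bullet> (x - c) / r\<^sup>2)) *\<^sub>R (x - c)"

lemma has_derivative_ball_defect:
  fixes c :: "real^'n"
  shows "((\<lambda>x. 1 - (x - c) \<bullet> (x - c) / r\<^sup>2) has_derivative (\<lambda>h. - (2 / r\<^sup>2) * ((x - c) \<bullet> h))) (at x)"
proof -
  have "((\<lambda>x. 1 - inverse (r\<^sup>2) * ((x - c) \<bullet> (x - c))) has_derivative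
      (\<lambda>h. 0 - inverse (r\<^sup>2) * ((x - c) \<bullet> (h - 0) + (h - 0) \<bullet> (x - c)))) (at x)"
    by (intro derivative_intros)
  moreover have "(\<lambda>h. 0 - inverse (r\<^sup>2) * ((x - c) \<bullet> (h - 0) + (h - 0) \<bullet> (x - c))) = (\<lambda>h. - (2 / r\<^sup>2) * ((x - c) \<bullet> h))"
    by (simp add: inner_commute divide_inverse mult_ac)
  ultimately show ?thesis by (simp add: divide_inverse mult.commute)
qed

lemma bump_has_derivative: "(bump c r has_derivative (\<lambda>h. bump_deriv c r x \<bullet> h)) (at x)"
  using has_derivative_compose[OF has_derivative_ball_defect has_field_derivative_imp_has_derivative[OF flat_has_derivative[of 1]]]
  by (simp add: bump_def[abs_def] bump_deriv_def mult_ac)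

lemma partial_deriv_bump: "partial_deriv i (bump c r) x = bump_deriv c r x $ i"
  by (simp add: partial_deriv_eq[OF bump_has_derivative] inner_axis)

lemma Ck_bump: "Ck k (bump c r)"
proof -
  have "Ck k (\<lambda>x. 1 - (x - c) \<bullet> (x - c) / r\<^sup>2)" for k
  proof -
    have "Ck (Suc k) (\<lambda>x. 1 - (x - c) \<bullet> (x - c) / r\<^sup>2)"
    proof (rule Ck_SucI[OF has_derivative_ball_defect])
      fix i
      have "Ck k (\<lambda>x. - (2 / r\<^sup>2) * (x $ i + - (c $ i)))" by (intro Ck_mult Ck_add Ck_const Ck_nth)
      then show "Ck k (\<lambda>x. - (2 / r\<^sup>2) * ((x - c) \<bullet> axis i 1))" by (simp add: inner_axis)
    qed
    then show ?thesis by (rule Ck_SucD)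
  qed
  then show ?thesis unfolding bump_def[abs_def] by (rule Ck_flat_compose)
qed

lemma bump_defect_pos_iff:
  assumes "0 < r"
  shows "0 < 1 - (x - c) \<bullet> (x - c) / r\<^sup>2 \<longleftrightarrow> x \<in> ball c r"
proof -
  have "0 < 1 - (x - c) \<bullet> (x - c) / r\<^sup>2 \<longleftrightarrow> (norm (x - c))\<^sup>2 < r\<^sup>2"
    using assms by (simp add: dot_square_norm)
  also have "\<dots> \<longleftrightarrow> norm (x - c) < r"
    using assms by (metis less_eq_real_def norm_ge_zero power2_less_imp_less power_strict_mono pos2)
  finally show ?thesis by (simp add: dist_norm norm_minus_commute)
qed

lemma bump_nonneg: "0 \<le> bump c r x"
  by (simp add: bump_def flat_def)

lemma bump_le_1: "bump c r x \<le> 1"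
  by (simp add: bump_def flat_def)

lemma bump_eq_0: "0 < r \<Longrightarrow> x \<notin> ball c r \<Longrightarrow> bump c r x = 0"
  using bump_defect_pos_iff[of r x c] by (auto simp: bump_def flat_def)

lemma bump_deriv_eq_0: "0 < r \<Longrightarrow> x \<notin> ball c r \<Longrightarrow> bump_deriv c r x = 0"
  using bump_defect_pos_iff[of r x c] by (auto simp: bump_deriv_def flat_def)

text \<open>On the half ball the argument of \<open>flat\<close> is at least 1 - 1/4, the reciprocal
  of 4/3.\<close>

lemma bump_ge:
  assumes "0 < r" "x \<in> ball c (r / 2)"
  shows "exp (- (4 / 3)) \<le> bump c r x"
proof -
  have "norm (x - c) \<le> r / 2" using assms by (simp add: dist_norm norm_minus_commute)
  then have "(norm (x - c))\<^sup>2 \<le> (r / 2)\<^sup>2" by (intro power_mono) auto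
  then have "(x - c) \<bullet> (x - c) / r\<^sup>2 \<le> 1 / 4"
    using assms by (simp add: dot_square_norm power_divide field_simps)
  moreover define t where "t = 1 - (x - c) \<bullet> (x - c) / r\<^sup>2"
  ultimately have t: "3 / 4 \<le> t" by simp
  then have "1 / t \<le> 1 / (3 / 4)" by (intro divide_left_mono) auto
  then have "- (4 / 3) \<le> - (1 / t)" by simp
  then show ?thesis using t by (simp add: bump_def flat_def t_def[symmetric])
qed

lemma flat_square_nonneg: "0 \<le> flat (monom 1 2) t"
  by (simp add: flat_def poly_monom)

text \<open>With \<open>z = 1 / t\<close> this is z^2 \<le> 2 exp z, read off the quadratic Taylor
  term.\<close>

lemma flat_square_le: "flat (monom 1 2) t \<le> 2"
proof (cases "0 < t")
  case True
  then have "1 + 1 / t + (1 / t)\<^sup>2 / 2 \<le> exp (1 / t)" by (intro exp_lower_Taylor_quadratic) auto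
  then have "(1 / t)\<^sup>2 \<le> 2 * exp (1 / t)" using True by (smt (verit) divide_pos_pos field_sum_of_halves)
  then show ?thesis using True by (simp add: flat_def poly_monom exp_minus field_simps)
qed (simp add: flat_def)

lemma norm_bump_deriv_le:
  assumes "0 < r"
  shows "norm (bump_deriv c r x) \<le> 4 / r * indicator (ball c r) x"
proof (cases "x \<in> ball c r")
  case True
  then have n: "norm (x - c) \<le> r" by (simp add: dist_norm norm_minus_commute)
  have "norm (bump_deriv c r x) = 2 / r\<^sup>2 * flat (monom 1 2) (1 - (x - c) \<bullet> (x - c) / r\<^sup>2) * norm (x - c)"
    using flat_square_nonneg by (simp add: bump_deriv_def abs_mult)
  also have "\<dots> \<le> 2 / r\<^sup>2 * 2 * r"
    using n assms flat_square_le flat_square_nonneg by (intro mult_mono mult_nonneg_nonneg) auto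
  also have "2 / r\<^sup>2 * 2 * r = 4 / r" using assms by (simp add: power2_eq_square)
  finally show ?thesis using True by simp
qed (use assms bump_deriv_eq_0 in auto)

lemma bump_lipschitz:
  assumes "0 < r"
  shows "\<bar>bump c r x - bump c r y\<bar> \<le> 4 / r * norm (x - y)"
proof -
  have "norm (bump c r x - bump c r y) \<le> 4 / r * norm (x - y)"
  proof (rule differentiable_bound[where S=UNIV])
    show "(bump c r has_derivative (\<lambda>h. bump_deriv c r x \<bullet> h)) (at x within UNIV)" for x
      by (simp add: bump_has_derivative)
    show "onorm (\<lambda>h. bump_deriv c r x \<bullet> h) \<le> 4 / r" for x
    proof (rule onorm_le)
      have "norm (bump_deriv c r x) \<le> 4 / r"
        using norm_bump_deriv_le[OF assms, of c x] assms by (cases "x \<in> ball c r") (auto intro: order_trans[OF _ divide_nonneg_pos])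
      then show "norm (bump_deriv c r x \<bullet> h) \<le> 4 / r * norm h" for h
        using order_trans[OF Cauchy_Schwarz_ineq2 mult_right_mono[OF _ norm_ge_zero]]
        unfolding real_norm_def by blast
    qed
  qed auto
  then show ?thesis by simp
qed

lemma test_function_bump_mult:
  assumes "\<And>k. Ck k f" "0 < r" "cball c r \<subseteq> \<Omega>"
  shows "test_function \<Omega> (\<lambda>x. bump c r x * f x)"
proof -
  have "{x. bump c r x * f x \<noteq> 0} \<subseteq> cball c r"
    using bump_eq_0[OF assms(2), of _ c] by force
  then have cl: "closure {x. bump c r x * f x \<noteq> 0} \<subseteq> cball c r"
    by (rule closure_minimal) simp
  then have "compact (closure {x. bump c r x * f x \<noteq> 0})"
    using bounded_subset[OF bounded_cball cl] by (simp add: compact_eq_bounded_closed)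
  moreover have "Ck k (\<lambda>x. bump c r x * f x)" for k
    by (intro Ck_mult Ck_bump assms)
  ultimately show ?thesis unfolding test_function_def using order_trans[OF cl assms(3)] by blast
qed

lemma test_function_bump:
  "0 < r \<Longrightarrow> cball c r \<subseteq> \<Omega> \<Longrightarrow> test_function \<Omega> (bump c r)"
  using test_function_bump_mult[of "\<lambda>_. 1" r c \<Omega>] by (simp add: Ck_const)

subsection \<open>Integration by parts and weak gradients\<close>

lemma test_function_support:
  assumes "test_function \<Omega> w"
  obtains K where "compact K" "K \<subseteq> \<Omega>" "\<And>x. x \<notin> K \<Longrightarrow> w x = 0" "\<And>i x. x \<notin> K \<Longrightarrow> partial_deriv i w x = 0"
proof -
  define K where "K = closure {x. w x \<noteq> 0}"
  have K: "compact K" "K \<subseteq> \<Omega>" using assms unfolding test_function_def K_def by blast+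
  have 0: "w x = 0" if "x \<notin> K" for x
    using that closure_subset[of "{x. w x \<noteq> 0}"] unfolding K_def by blast
  have "partial_deriv i w x = 0" if "x \<notin> K" for i x
  proof -
    have "(w has_derivative (\<lambda>_. 0)) (at x)"
    proof (rule has_derivative_transform_within_open)
      show "((\<lambda>_. 0) has_derivative (\<lambda>_. 0)) (at x)" by simp
      show "open (- K)" unfolding K_def by (rule open_Compl) simp
      show "x \<in> - K" using that by simp
      show "0 = w y" if "y \<in> - K" for y using 0 that by simp
    qed
    then show ?thesis by (rule partial_deriv_eq)
  qed
  with K 0 that show ?thesis by blast
qed

lemma test_function_Ck: "test_function \<Omega> w \<Longrightarrow> Ck k w"
  by (simp add: test_function_def)

lemma test_function_continuous: "test_function \<Omega> w \<Longrightarrow> continuous_on UNIV w"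
  using test_function_Ck[of \<Omega> w 0] by simp

lemma test_function_partial_continuous: "test_function \<Omega> w \<Longrightarrow> continuous_on UNIV (partial_deriv i w)"
  using test_function_Ck[of \<Omega> w "Suc 0"] by simp

lemma test_function_borel [measurable_dest]:
  "test_function \<Omega> w \<Longrightarrow> w \<in> borel_measurable borel"
  "test_function \<Omega> w \<Longrightarrow> partial_deriv i w \<in> borel_measurable borel"
  by (simp_all add: borel_measurable_continuous_onI test_function_continuous test_function_partial_continuous)

lemma test_function_has_derivative:
  "test_function \<Omega> w \<Longrightarrow> (w has_derivative frechet_derivative w (at x)) (at x)"
  using test_function_Ck by (rule Ck_Suc_has_derivative)

lemma partial_deriv_mult:
  assumes "test_function \<Omega> u" "test_function \<Omega>' v"
  shows "partial_deriv i (\<lambda>x. u x * v x) x = u x * partial_deriv i v x + partial_deriv i u x * v x"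
  unfolding partial_deriv_def[of i u] partial_deriv_def[of i v]
  by (rule partial_deriv_eq[OF has_derivative_mult[OF test_function_has_derivative[OF assms(1)]
      test_function_has_derivative[OF assms(2)]]])

lemma test_function_mult:
  assumes "test_function \<Omega> u" "test_function \<Omega> v"
  shows "test_function \<Omega> (\<lambda>x. u x * v x)"
proof -
  have "{x. u x * v x \<noteq> 0} \<subseteq> {x. u x \<noteq> 0}" by auto
  then have "closure {x. u x * v x \<noteq> 0} \<subseteq> closure {x. u x \<noteq> 0}" by (rule closure_mono)
  moreover from this have "compact (closure {x. u x * v x \<noteq> 0})"
    using assms closed_Int_compact[of "closure {x. u x * v x \<noteq> 0}" "closure {x. u x \<noteq> 0}"]
    by (simp add: test_function_def inf.absorb1)
  moreover have "Ck k (\<lambda>x. u x * v x)" for k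
    using assms by (intro Ck_mult) (auto simp: test_function_def)
  ultimately show ?thesis using assms unfolding test_function_def by blast
qed

lemma integrable_test_function:
  assumes "test_function \<Omega> w" "continuous_on UNIV f"
  shows "integrable lborel (\<lambda>x. f x * w x)" "integrable lborel (\<lambda>x. f x * partial_deriv i w x)"
proof -
  obtain K where K: "compact K" "\<And>x. x \<notin> K \<Longrightarrow> w x = 0" "\<And>i x. x \<notin> K \<Longrightarrow> partial_deriv i w x = 0"
    using test_function_support[OF assms(1)] by metis
  have 1: "integrable lborel (\<lambda>x. indicator K x *\<^sub>R (f x * w x))"
    using assms test_function_continuous
    by (intro borel_integrable_compact K continuous_intros) (auto intro: continuous_on_subset)
  have 2: "integrable lborel (\<lambda>x. indicator K x *\<^sub>R (f x * partial_deriv i w x))"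
    using assms test_function_partial_continuous
    by (intro borel_integrable_compact K continuous_intros) (auto intro: continuous_on_subset)
  have "(\<lambda>x. indicator K x *\<^sub>R (f x * w x)) = (\<lambda>x. f x * w x)"
    "(\<lambda>x. indicator K x *\<^sub>R (f x * partial_deriv i w x)) = (\<lambda>x. f x * partial_deriv i w x)"
    using K by (auto simp: indicator_def fun_eq_iff)
  with 1 2 show "integrable lborel (\<lambda>x. f x * w x)" "integrable lborel (\<lambda>x. f x * partial_deriv i w x)" by auto
qed

lemma has_real_derivative_along_axis:
  assumes "test_function \<Omega> w"
  shows "((\<lambda>t. w (x + t *\<^sub>R axis i 1)) has_real_derivative partial_deriv i w (x + t *\<^sub>R axis i 1)) (at t)"
proof -
  let ?D = "frechet_derivative w (at (x + t *\<^sub>R axis i 1))"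
  have D: "(w has_derivative ?D) (at (x + t *\<^sub>R axis i 1))"
    by (rule test_function_has_derivative[OF assms])
  then interpret linear ?D by (rule has_derivative_linear)
  have "((\<lambda>t. x + t *\<^sub>R axis i 1) has_derivative (\<lambda>h. 0 + h *\<^sub>R axis i 1)) (at t)"
    by (intro derivative_intros)
  from has_derivative_compose[OF this D] show ?thesis
    by (simp add: has_field_derivative_def partial_deriv_def scale mult_commute_abs)
qed

text \<open>The difference quotients in direction \<open>i\<close> have integral \<open>0\<close> by translation invariance, and
  converge boundedly to the partial derivative.\<close>

lemma integral_partial_deriv_eq_0:
  assumes w: "test_function \<Omega> w"
  shows "(\<integral>x. partial_deriv i w x \<partial>lborel) = 0"
proof -
  obtain K where K: "compact K" "\<And>x. x \<notin> K \<Longrightarrow> w x = 0" "\<And>i x. x \<notin> K \<Longrightarrow> partial_deriv i w x = 0"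
    using test_function_support[OF w] by metis
  obtain R where R: "\<And>x. x \<in> K \<Longrightarrow> norm x \<le> R"
    using compact_imp_bounded[OF K(1)] unfolding bounded_iff by blast
  have "bounded (partial_deriv i w ` K)"
    using continuous_on_subset[OF test_function_partial_continuous[OF w]] K(1)
    by (intro compact_imp_bounded compact_continuous_image) auto
  then obtain B0 where B0: "\<And>x. x \<in> K \<Longrightarrow> \<bar>partial_deriv i w x\<bar> \<le> B0"
    unfolding bounded_iff by auto
  define B where "B = max B0 0"
  have B: "\<bar>partial_deriv i w x\<bar> \<le> B" for x
    using B0[of x] K(3)[of x i] by (cases "x \<in> K") (auto simp: B_def)
  let ?e = "axis i 1 :: real^'a"
  \<comment> \<open>Step lengths of at most 1 keep the supports of all difference quotients inside
    the ball of radius \<open>R + 1\<close>, as the dominating function requires.\<close>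
  define t where "t n = 1 / (real n + 1)" for n :: nat
  have t: "0 < t n" "t n \<le> 1" for n by (auto simp: t_def)
  have [measurable]: "w \<in> borel_measurable borel" using w by (rule test_function_borel)
  define q where "q n x = (w (x + t n *\<^sub>R ?e) - w x) / t n" for n x
  have int: "integrable lborel w" using integrable_test_function(1)[OF w, of "\<lambda>_. 1"] by simp
  have int': "integrable lborel (\<lambda>x. w (c + x))" and shift: "(\<integral>x. w (c + x) \<partial>lborel) = (\<integral>x. w x \<partial>lborel)" for c
  proof -
    have "integrable (distr lborel borel ((+) c)) w" using int by (simp add: lborel_distr_plus)
    then show "integrable lborel (\<lambda>x. w (c + x))" by (subst (asm) integrable_distr_eq) auto
    have "(\<integral>x. w x \<partial>lborel) = (\<integral>x. w x \<partial>distr lborel borel ((+) c))" by (simp add: lborel_distr_plus)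
    also have "\<dots> = (\<integral>x. w (c + x) \<partial>lborel)" by (subst integral_distr) auto
    finally show "(\<integral>x. w (c + x) \<partial>lborel) = (\<integral>x. w x \<partial>lborel)" by simp
  qed
  have q0: "(\<integral>x. q n x \<partial>lborel) = 0" for n
    using int int'[of "t n *\<^sub>R ?e"] shift[of "t n *\<^sub>R ?e"] by (simp add: q_def add.commute)
  have "(\<lambda>n. \<integral>x. q n x \<partial>lborel) \<longlonglongrightarrow> (\<integral>x. partial_deriv i w x \<partial>lborel)"
  proof (rule integral_dominated_convergence[where w="\<lambda>x. B * indicator (cball 0 (R + 1)) x"])
    show "partial_deriv i w \<in> borel_measurable lborel" using test_function_borel(2)[OF w] by simp
    show "q n \<in> borel_measurable lborel" for n unfolding q_def by measurable
    show "integrable lborel (\<lambda>x. B * indicator (cball (0::real^'a) (R + 1)) x)"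
      using emeasure_bounded_finite[of "cball (0::real^'a) (R + 1)"]
      by (intro integrable_mult_right integrable_real_indicator) auto
    show "AE x in lborel. (\<lambda>n. q n x) \<longlonglongrightarrow> partial_deriv i w x"
    proof (rule AE_I2)
      fix x
      have "((\<lambda>h. (w (x + h *\<^sub>R ?e) - w x) / h) \<longlongrightarrow> partial_deriv i w x) (at 0)"
        using has_real_derivative_along_axis[OF w, of x i 0] by (simp add: DERIV_def)
      moreover have "filterlim t (at 0) sequentially"
        using t(1) LIMSEQ_inverse_real_of_nat
        by (auto simp: filterlim_at t_def[abs_def] inverse_eq_divide add.commute less_imp_neq[symmetric])
      ultimately show "(\<lambda>n. q n x) \<longlonglongrightarrow> partial_deriv i w x"
        unfolding q_def by (rule filterlim_compose)
    qed
    show "AE x in lborel. norm (q n x) \<le> B * indicator (cball 0 (R + 1)) x" for n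
    proof (rule AE_I2)
      fix x
      show "norm (q n x) \<le> B * indicator (cball 0 (R + 1)) x"
      proof (cases "x \<in> cball 0 (R + 1)")
        case True
        obtain z where z: "w (x + t n *\<^sub>R ?e) - w (x + 0 *\<^sub>R ?e) = (t n - 0) * partial_deriv i w (x + z *\<^sub>R ?e)"
          using MVT2[OF t(1)[of n] has_real_derivative_along_axis[OF w]] by blast
        then have "q n x = partial_deriv i w (x + z *\<^sub>R ?e)" using t[of n] by (simp add: q_def)
        then show ?thesis using B True by simp
      next
        case False
        then have "R + 1 < norm x" by simp
        moreover have "norm x \<le> norm (x + t n *\<^sub>R ?e) + norm (t n *\<^sub>R ?e)"
          by (metis add_diff_cancel_right' norm_triangle_ineq4)
        moreover have "norm (t n *\<^sub>R ?e) \<le> 1" using t[of n] by simp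
        ultimately have "x \<notin> K" "x + t n *\<^sub>R ?e \<notin> K" using R by fastforce+
        then show ?thesis using K(2) False by (simp add: q_def)
      qed
    qed
  qed
  then show ?thesis by (simp add: q0 LIMSEQ_const_iff)
qed

lemma integral_by_parts:
  assumes "test_function \<Omega> u" "test_function \<Omega> v"
  shows "(\<integral>x. u x * partial_deriv i v x \<partial>lborel) = - (\<integral>x. partial_deriv i u x * v x \<partial>lborel)"
proof -
  have "(\<integral>x. u x * partial_deriv i v x + partial_deriv i u x * v x \<partial>lborel) = 0"
    using integral_partial_deriv_eq_0[OF test_function_mult[OF assms], of i]
    by (simp add: partial_deriv_mult[OF assms])
  moreover have "integrable lborel (\<lambda>x. u x * partial_deriv i v x)"
    by (rule integrable_test_function(2)[OF assms(2) test_function_continuous[OF assms(1)]])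
  moreover have "integrable lborel (\<lambda>x. partial_deriv i u x * v x)"
    by (rule integrable_test_function(1)[OF assms(2) test_function_partial_continuous[OF assms(1)]])
  ultimately show ?thesis by simp
qed

section \<open>Weak gradients: classical gradients and lower bounds by duality\<close>

lemma integral_lebesgue_on_eq_lborel:
  fixes f :: "real^'n \<Rightarrow> real"
  assumes "\<Omega> \<in> sets borel" "f \<in> borel_measurable borel" "\<And>x. x \<notin> \<Omega> \<Longrightarrow> f x = 0"
  shows "(LINT x|lebesgue_on \<Omega>. f x) = (\<integral>x. f x \<partial>lborel)"
proof -
  have "(LINT x|lebesgue_on \<Omega>. f x) = (LINT x|lebesgue. indicator \<Omega> x *\<^sub>R f x)"
    using assms by (intro integral_restrict_space) simp
  also have "(\<lambda>x. indicator \<Omega> x *\<^sub>R f x) = f"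
    using assms by (auto simp: indicator_def fun_eq_iff)
  also have "(LINT x|lebesgue. f x) = (\<integral>x. f x \<partial>lborel)"
    using assms by (intro integral_completion) simp
  finally show ?thesis .
qed

lemma absolutely_integrable_on_compact_continuous:
  fixes f :: "'a::euclidean_space \<Rightarrow> 'b::euclidean_space"
  assumes "compact K" "continuous_on UNIV f"
  shows "f absolutely_integrable_on K"
proof -
  have "integrable lborel (\<lambda>x. indicator K x *\<^sub>R f x)"
    using assms continuous_on_subset by (intro borel_integrable_compact) auto
  moreover have "(\<lambda>x. indicator K x *\<^sub>R f x) \<in> borel_measurable borel"
    using assms by (intro borel_measurable_scaleR borel_measurable_indicator borel_compact borel_measurable_continuous_onI)
  ultimately show ?thesis unfolding set_integrable_def by (simp add: integrable_completion)
qed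

lemma weak_gradient_test_function:
  fixes u :: "real^'n \<Rightarrow> real"
  assumes "open \<Omega>" "test_function \<Omega> u"
  shows "weak_gradient \<Omega> u (\<lambda>x. \<chi> i. partial_deriv i u x)"
  unfolding weak_gradient_def
proof (intro conjI allI impI)
  fix K :: "(real^'n) set" assume "compact K \<and> K \<subseteq> \<Omega>"
  then show "u absolutely_integrable_on K" "(\<lambda>x. \<chi> i. partial_deriv i u x) absolutely_integrable_on K"
    using test_function_continuous[OF assms(2)] test_function_partial_continuous[OF assms(2)]
    by (auto intro!: absolutely_integrable_on_compact_continuous continuous_on_vec_lambda)
next
  fix \<phi> i assume \<phi>: "test_function \<Omega> \<phi>"
  note [measurable] = test_function_borel[OF assms(2)] test_function_borel[OF \<phi>]
  obtain K where K: "K \<subseteq> \<Omega>" "\<And>x. x \<notin> K \<Longrightarrow> u x = 0" "\<And>i x. x \<notin> K \<Longrightarrow> partial_deriv i u x = 0"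
    using test_function_support[OF assms(2)] by metis
  have "(LINT x|lebesgue_on \<Omega>. u x * partial_deriv i \<phi> x) = (\<integral>x. u x * partial_deriv i \<phi> x \<partial>lborel)"
    using K assms by (intro integral_lebesgue_on_eq_lborel) auto
  also have "\<dots> = - (\<integral>x. partial_deriv i u x * \<phi> x \<partial>lborel)"
    by (rule integral_by_parts[OF assms(2) \<phi>])
  also have "(\<integral>x. partial_deriv i u x * \<phi> x \<partial>lborel) = (LINT x|lebesgue_on \<Omega>. partial_deriv i u x * \<phi> x)"
    using K assms by (intro integral_lebesgue_on_eq_lborel[symmetric]) auto
  finally show "(LINT x|lebesgue_on \<Omega>. u x * partial_deriv i \<phi> x) =
      - (LINT x|lebesgue_on \<Omega>. (\<chi> i. partial_deriv i u x) $ i * \<phi> x)" by simp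
qed

text \<open>Moving the derivative onto \<open>\<phi>\<close> bounds \<open>A\<close> by the integral
  of |g| over \<open>S\<close>. Splitting |g| at the threshold \<open>m\<close> then replaces
  Hoelder's inequality: the part below \<open>m\<close> costs at most \<open>m * \<mu>\<close>, the
  part above is controlled by |g|^q. The caller picks \<open>m\<close> so that
  \<open>m * \<mu>\<close> does not swallow \<open>A\<close>.\<close>

lemma weak_gradient_lower_bound:
  fixes u :: "real^'n \<Rightarrow> real"
  assumes g: "weak_gradient \<Omega> u g" and \<phi>: "test_function \<Omega> \<phi>"
    and S: "S \<in> sets borel" "emeasure lborel S = ennreal \<mu>" "0 \<le> \<mu>" "\<Omega> \<in> sets borel"
    and le: "\<And>x. \<bar>\<phi> x\<bar> \<le> indicator S x" and q: "1 \<le> q" and m: "0 < m"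
    and A: "A \<le> \<bar>LINT x|lebesgue_on \<Omega>. u x * partial_deriv i \<phi> x\<bar>"
  shows "ennreal (m powr (q - 1) * (A - m * \<mu>)) \<le> Lp_integral (lebesgue_on \<Omega>) q g"
proof (cases "Lp_integral (lebesgue_on \<Omega>) q g")
  case top then show ?thesis by simp
next
  case (real G)
  let ?M = "lebesgue_on \<Omega>"
  show ?thesis
  proof (cases "integrable ?M (\<lambda>x. g x $ i * \<phi> x)")
    case True
    \<comment> \<open>Above the threshold t/m exceeds 1, so t = m (t/m) \<le> m (t/m)^q; this covers
      \<open>q = 1\<close> as well.\<close>
    have young: "t \<le> m + m powr (1 - q) * t powr q" if "0 \<le> t" for t :: real
    proof (cases "t \<le> m")
      case False
      then have "t = t powr (1 - q) * t powr q" using m by (simp add: powr_add[symmetric])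
      also have "\<dots> \<le> m powr (1 - q) * t powr q"
        using False q m by (intro mult_right_mono powr_mono2') auto
      finally show ?thesis using m by linarith
    qed (use m in \<open>simp add: add_increasing2\<close>)
    obtain K where K: "compact K" "K \<subseteq> \<Omega>" "\<And>x. x \<notin> K \<Longrightarrow> \<phi> x = 0"
      using test_function_support[OF \<phi>] by metis
    \<comment> \<open>A weak gradient is only known to be integrable on compact sets. Cutting it off
      to a compact set outside which \<open>\<phi>\<close> vanishes gives measurability on \<Omega>
      and leaves the product with \<open>\<phi>\<close> unchanged.\<close>
    define h where "h x = indicator K x *\<^sub>R g x" for x
    have "g absolutely_integrable_on K" using g K unfolding weak_gradient_def by blast
    then have "h \<in> borel_measurable lebesgue"
      unfolding set_integrable_def h_def[abs_def] by (rule borel_measurable_integrable)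
    then have [measurable]: "h \<in> borel_measurable ?M" by (rule measurable_restrict_space1)
    have [measurable]: "indicator S \<in> borel_measurable ?M"
      using S by (intro measurable_restrict_space1 measurable_completion) simp
    have "ennreal A \<le> ennreal \<bar>LINT x|?M. g x $ i * \<phi> x\<bar>"
      using A g \<phi> unfolding weak_gradient_def by (intro ennreal_leI) simp
    also have "\<dots> \<le> (\<integral>\<^sup>+x. ennreal \<bar>g x $ i * \<phi> x\<bar> \<partial>?M)"
      using integral_norm_bound_ennreal[OF True] by simp
    also have "\<dots> \<le> (\<integral>\<^sup>+x. ennreal m * indicator S x + ennreal (m powr (1 - q)) * ennreal (norm (h x) powr q) \<partial>?M)"
    proof (rule nn_integral_mono)
      fix x
      have "\<bar>g x $ i * \<phi> x\<bar> = \<bar>h x $ i\<bar> * \<bar>\<phi> x\<bar>"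
        using K(3)[of x] by (cases "x \<in> K") (simp_all add: h_def abs_mult)
      also have "\<dots> \<le> norm (h x) * indicator S x"
        by (intro mult_mono le component_le_norm_cart) auto
      also have "\<dots> \<le> m * indicator S x + m powr (1 - q) * norm (h x) powr q"
        using young[of "norm (h x)"] by (cases "x \<in> S") simp_all
      finally have "ennreal \<bar>g x $ i * \<phi> x\<bar> \<le> ennreal (m * indicator S x + m powr (1 - q) * norm (h x) powr q)"
        by (rule ennreal_leI)
      also have "\<dots> = ennreal m * indicator S x + ennreal (m powr (1 - q)) * ennreal (norm (h x) powr q)"
        using m by (simp add: ennreal_mult ennreal_indicator)
      finally show "ennreal \<bar>g x $ i * \<phi> x\<bar> \<le> \<dots>" .
    qed
    also have "\<dots> = ennreal m * (\<integral>\<^sup>+x. indicator S x \<partial>?M) + ennreal (m powr (1 - q)) * Lp_integral ?M q h"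
      by (simp add: nn_integral_add nn_integral_cmult Lp_integral_def)
    also have "\<dots> \<le> ennreal m * ennreal \<mu> + ennreal (m powr (1 - q)) * ennreal G"
    proof (intro add_mono mult_left_mono)
      have "(\<integral>\<^sup>+x. indicator S x \<partial>?M) = (\<integral>\<^sup>+x. indicator S x * indicator \<Omega> x \<partial>lborel)"
        using S by (intro nn_integral_lebesgue_on)
      also have "\<dots> \<le> (\<integral>\<^sup>+x. indicator S x \<partial>lborel)"
        by (intro nn_integral_mono) (auto simp: indicator_def)
      finally show "(\<integral>\<^sup>+x. indicator S x \<partial>?M) \<le> ennreal \<mu>" using S by simp
      have "norm (h x) powr q \<le> norm (g x) powr q" for x
        using q by (cases "x \<in> K") (simp_all add: h_def)
      then show "Lp_integral ?M q h \<le> ennreal G"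
        unfolding real(2)[symmetric] Lp_integral_def by (intro nn_integral_mono ennreal_leI)
    qed auto
    also have "\<dots> = ennreal (m * \<mu> + m powr (1 - q) * G)"
      using m S real by (simp add: ennreal_mult)
    finally have "A \<le> m * \<mu> + m powr (1 - q) * G"
      using m S real by (subst (asm) ennreal_le_iff) auto
    then have "m powr (q - 1) * (A - m * \<mu>) \<le> m powr (q - 1) * (m powr (1 - q) * G)"
      by (intro mult_left_mono) auto
    also have "\<dots> = G" using m by (simp add: mult.assoc[symmetric] powr_add[symmetric])
    finally show ?thesis using real by (simp add: ennreal_leI)
  next
    \<comment> \<open>The Bochner integral of a non-integrable function is 0, which forces
      \<open>A \<le> 0\<close> and makes the claimed lower bound nonpositive.\<close>
    case False
    then have "(LINT x|?M. g x $ i * \<phi> x) = 0" by (rule not_integrable_integral_eq)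
    then have "A \<le> 0" using A g \<phi> unfolding weak_gradient_def by simp
    then have "m powr (q - 1) * (A - m * \<mu>) \<le> 0"
      using m S by (intro mult_nonneg_nonpos) (auto simp: add_nonneg_nonneg intro: order_trans)
    then show ?thesis by (simp add: ennreal_neg)
  qed
qed

subsection \<open>Scaling of bumps\<close>

definition gagliardo_density :: "real \<Rightarrow> real \<Rightarrow> (real^'n \<Rightarrow> real) \<Rightarrow> real^'n \<Rightarrow> real^'n \<Rightarrow> real" where
  "gagliardo_density s p u x y = \<bar>u x - u y\<bar> powr p / norm (x - y) powr (real CARD('n) + s * p)"

lemma gagliardo_density_measurable:
  assumes [measurable]: "u \<in> borel_measurable borel"
  shows "(\<lambda>(x, y). ennreal (gagliardo_density s p u x y)) \<in> borel_measurable (borel \<Otimes>\<^sub>M borel)"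
  unfolding gagliardo_density_def by measurable

lemma gagliardo_le_convolution:
  fixes \<Omega> :: "(real^'n) set"
  assumes \<Omega>: "\<Omega> \<in> sets borel" "bounded \<Omega>" and u: "u \<in> borel_measurable borel"
    and K: "K \<in> borel_measurable borel" and S: "S \<in> sets borel"
    and le: "\<And>x y. x \<in> \<Omega> \<Longrightarrow> y \<in> \<Omega> \<Longrightarrow> ennreal (gagliardo_density s p u x y) \<le> K (x - y) * (indicator S x + indicator S y)"
  shows "gagliardo \<Omega> s p u \<le> 2 * emeasure lborel S * (\<integral>\<^sup>+h. K h \<partial>lborel)"
  unfolding gagliardo_def gagliardo_density_def[symmetric]
  by (rule nn_integral_pair_convolution_le[OF \<Omega> gagliardo_density_measurable[OF u] K S]) (use le in auto)

lemma gagliardo_eq_lborel: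
  fixes \<Omega> :: "(real^'n) set"
  assumes \<Omega>: "\<Omega> \<in> sets borel" "bounded \<Omega>" and u: "u \<in> borel_measurable borel"
  shows "gagliardo \<Omega> s p u =
    (\<integral>\<^sup>+x. (\<integral>\<^sup>+y. ennreal (gagliardo_density s p u x y) * indicator \<Omega> y \<partial>lborel) * indicator \<Omega> x \<partial>lborel)"
  unfolding gagliardo_def gagliardo_density_def[symmetric]
  using nn_integral_lebesgue_on_pair[OF \<Omega> gagliardo_density_measurable[OF u]] by simp

lemma gagliardo_ge_product:
  fixes \<Omega> :: "(real^'n) set"
  assumes \<Omega>: "\<Omega> \<in> sets borel" "bounded \<Omega>" and u: "u \<in> borel_measurable borel"
    and A: "A \<in> sets borel" "A \<subseteq> \<Omega>" and B: "B \<in> sets borel" "B \<subseteq> \<Omega>"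
    and le: "\<And>x y. x \<in> A \<Longrightarrow> y \<in> B \<Longrightarrow> c \<le> gagliardo_density s p u x y"
  shows "ennreal c * emeasure lborel A * emeasure lborel B \<le> gagliardo \<Omega> s p u"
proof -
  have "ennreal c * emeasure lborel A * emeasure lborel B =
    (\<integral>\<^sup>+x. (\<integral>\<^sup>+y. ennreal c * indicator B y \<partial>lborel) * indicator A x \<partial>lborel)"
    using A B by (simp add: nn_integral_cmult_indicator) (simp only: mult_ac)
  also have "\<dots> \<le> gagliardo \<Omega> s p u"
    unfolding gagliardo_eq_lborel[OF \<Omega> u]
  proof (rule nn_integral_mono)
    fix x
    show "(\<integral>\<^sup>+y. ennreal c * indicator B y \<partial>lborel) * indicator A x \<le>
      (\<integral>\<^sup>+y. ennreal (gagliardo_density s p u x y) * indicator \<Omega> y \<partial>lborel) * indicator \<Omega> x"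
    proof (cases "x \<in> A")
      case True
      then have "(\<integral>\<^sup>+y. ennreal c * indicator B y \<partial>lborel) \<le>
        (\<integral>\<^sup>+y. ennreal (gagliardo_density s p u x y) * indicator \<Omega> y \<partial>lborel)"
        using le B by (intro nn_integral_mono) (auto simp: indicator_def intro!: ennreal_leI)
      with True A show ?thesis by auto
    qed simp
  qed
  finally show ?thesis .
qed

lemma bump_borel [measurable]: "bump c r \<in> borel_measurable borel"
  using Ck_bump[of 0 c r] by (auto intro: borel_measurable_continuous_onI)

lemma borel_measurable_lebesgue_on:
  "f \<in> borel_measurable borel \<Longrightarrow> f \<in> borel_measurable (lebesgue_on \<Omega>)"
  by (intro measurable_restrict_space1 measurable_completion) simp

lemma Lp_integral_le_indicator:
  assumes "\<Omega> \<in> sets borel" "S \<in> sets borel" "\<And>x. x \<in> \<Omega> \<Longrightarrow> norm (f x) \<le> b * indicator S x" "0 \<le> b" "1 \<le> p"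
  shows "Lp_integral (lebesgue_on \<Omega>) p f \<le> ennreal (b powr p) * emeasure lborel S"
proof -
  have "Lp_integral (lebesgue_on \<Omega>) p f = (\<integral>\<^sup>+x. ennreal (norm (f x) powr p) * indicator \<Omega> x \<partial>lborel)"
    unfolding Lp_integral_def using assms by (intro nn_integral_lebesgue_on)
  also have "\<dots> \<le> (\<integral>\<^sup>+x. ennreal (b powr p) * indicator S x \<partial>lborel)"
  proof (rule nn_integral_mono)
    fix x
    show "ennreal (norm (f x) powr p) * indicator \<Omega> x \<le> ennreal (b powr p) * indicator S x"
    proof (cases "x \<in> \<Omega>")
      case True
      have "norm (f x) powr p \<le> b powr p * indicator S x"
      proof (cases "x \<in> S")
        case True2: True
        then have "norm (f x) powr p \<le> b powr p" using assms(3)[OF True] assms(5) by (intro powr_mono2) auto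
        then show ?thesis using True2 by simp
      next
        case False
        then have "norm (f x) = 0" using assms(3)[OF True] by simp
        then show ?thesis by simp
      qed
      then have "ennreal (norm (f x) powr p) \<le> ennreal (b powr p * indicator S x)" by (rule ennreal_leI)
      then show ?thesis using True by (simp add: ennreal_mult ennreal_indicator)
    qed simp
  qed
  also have "\<dots> = ennreal (b powr p) * emeasure lborel S"
    using assms by (intro nn_integral_cmult_indicator) simp
  finally show ?thesis .
qed

text \<open>A bump has height at most 1, Lipschitz constant \<open>4 / r\<close> and support of
  volume of order r^N. For \<open>s < 1\<close> its density is thus at most \<open>4 powr p\<close>
  times the kernel at scale \<open>r\<close>, whose integral is of order r^(- s p); for
  \<open>s = 1\<close> the gradient bound replaces this.\<close>

lemma bump_norm_upper:
  fixes \<Omega> :: "(real^'n) set"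
  assumes s: "0 < s" "s \<le> 1" "1 \<le> p" and \<Omega>: "open \<Omega>" "bounded \<Omega>"
  obtains C where "0 < C"
    "\<And>r c. 0 < r \<Longrightarrow> r \<le> 1 \<Longrightarrow> cball c r \<subseteq> \<Omega> \<Longrightarrow>
      W_norm \<Omega> s (ereal p) (bump c r) \<le> ennreal (C * r powr (real CARD('n) / p - s))"
proof -
  let ?N = "real CARD('n)"
  define V where "V = unit_ball_vol ?N"
  have V: "0 < V" by (simp add: V_def)
  have sets: "\<Omega> \<in> sets borel" using \<Omega> by simp
  have em: "emeasure lborel (ball c r :: (real^'n) set) = ennreal (V * r powr ?N)" if "0 < r" for c r
    using that by (simp add: emeasure_lborel_ball V_def)
  have L: "Lp_integral (lebesgue_on \<Omega>) p (bump c r) \<le> ennreal (V * r powr (?N - s * p))"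
    if r: "0 < r" "r \<le> 1" for c and r :: real
  proof -
    have "Lp_integral (lebesgue_on \<Omega>) p (bump c r) \<le> ennreal (1 powr p) * emeasure lborel (ball c r)"
    proof (rule Lp_integral_le_indicator[OF sets])
      show "norm (bump c r x) \<le> 1 * indicator (ball c r) x" for x
        using bump_le_1[of c r x] bump_nonneg[of c r x] bump_eq_0[OF r(1), of x c]
        by (cases "x \<in> ball c r") auto
    qed (use s in auto)
    also have "\<dots> = ennreal (V * r powr ?N)" using em[OF r(1)] by simp
    \<comment> \<open>As \<open>r \<le> 1\<close>, the L^p part is of lower order than the
      seminorm.\<close>
    also have "\<dots> \<le> ennreal (V * r powr (?N - s * p))"
      using r s V by (intro ennreal_leI mult_left_mono powr_mono') auto
    finally show ?thesis .
  qed
  show ?thesis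
  proof (cases "s = 1")
    case True
    define C where "C = (4 powr p * V + V) powr (1 / p)"
    show ?thesis
    proof (rule that)
      have "0 < 4 powr p * V + V" using V by (intro add_pos_pos) auto
      then show "0 < C" by (simp add: C_def)
      fix r c assume r: "0 < r" "r \<le> 1" and c: "cball c r \<subseteq> \<Omega>"
      let ?g = "\<lambda>x. \<chi> i. partial_deriv i (bump c r) x"
      have g: "?g = bump_deriv c r" by (simp add: partial_deriv_bump fun_eq_iff)
      have "Lp_integral (lebesgue_on \<Omega>) p ?g \<le> ennreal ((4 / r) powr p) * emeasure lborel (ball c r)"
        unfolding g using r s by (intro Lp_integral_le_indicator[OF sets] norm_bump_deriv_le) auto
      also have "\<dots> = ennreal ((4 / r) powr p * (V * r powr ?N))"
        using V unfolding em[OF r(1)] by (intro ennreal_mult[symmetric]) auto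
      also have "(4 / r) powr p * (V * r powr ?N) = 4 powr p * V * r powr (?N - s * p)"
        using r True by (simp add: powr_divide powr_diff)
      finally have "W_norm \<Omega> 1 (ereal p) (bump c r) \<le>
          ennreal ((4 powr p * V * r powr (?N - s * p) + V * r powr (?N - s * p)) powr (1 / p))"
        using V s r L[OF r] c test_function_bump
        by (intro W_norm_one_le[OF _ _ _ weak_gradient_test_function[OF \<Omega>(1)]]) auto
      also have "4 powr p * V * r powr (?N - s * p) + V * r powr (?N - s * p) = (4 powr p * V + V) * r powr (?N - s * p)"
        by (simp add: algebra_simps)
      also have "\<dots> powr (1 / p) = C * r powr (?N / p - s)"
        using V r s by (simp add: C_def powr_mult powr_powr diff_divide_distrib)
      finally show "W_norm \<Omega> s (ereal p) (bump c r) \<le> ennreal (C * r powr (?N / p - s))"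
        using True by simp
    qed
  next
    case False
    with s have s1: "s < 1" by simp
    define k where "k = sobolev_const CARD('n) s p"
    have k: "0 < k" unfolding k_def using s s1 by (intro sobolev_const_pos) auto
    have sp: "0 < s * p" "s * p < p" using s s1 by auto
    obtain J where J: "0 < J" "\<And>l. 0 < l \<Longrightarrow> (\<integral>\<^sup>+h. ennreal (kernel p (s * p) l (h::real^'n)) \<partial>lborel) \<le> ennreal (J * l powr (- (s * p)))"
      using nn_integral_kernel_le[OF sp] by metis
    define G where "G = 2 * V * (4 powr p * J)"
    have G: "0 < G" using V J by (simp add: G_def)
    define C where "C = (k * G + V) powr (1 / p)"
    show ?thesis
    proof (rule that)
      have "0 < k * G + V" using V k G by (intro add_pos_pos) auto
      then show "0 < C" by (simp add: C_def)
      fix r c assume r: "0 < r" "r \<le> 1" and c: "cball c r \<subseteq> \<Omega>"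
      have "gagliardo \<Omega> s p (bump c r) \<le>
        2 * emeasure lborel (ball c r) * (\<integral>\<^sup>+h. ennreal (4 powr p * kernel p (s * p) r (h::real^'n)) \<partial>lborel)"
      proof (rule gagliardo_le_convolution[OF sets \<Omega>(2)])
        fix x y
        show "ennreal (gagliardo_density s p (bump c r) x y) \<le>
          ennreal (4 powr p * kernel p (s * p) r (x - y)) * (indicator (ball c r) x + indicator (ball c r) y)"
        proof (cases "x \<in> ball c r \<or> y \<in> ball c r")
          case True
          let ?d = "\<bar>bump c r x - bump c r y\<bar>"
          have "?d \<le> 1"
            using bump_le_1[of c r x] bump_nonneg[of c r x] bump_le_1[of c r y] bump_nonneg[of c r y] by linarith
          \<comment> \<open>The bound 1 is weakened to 4 to share the constant of the Lipschitz
            bound.\<close>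
          then have "?d \<le> 4 * min 1 (norm (x - y) / r)"
            using bump_lipschitz[OF r(1), of c x y] by (simp add: min_def)
          then have "?d powr p \<le> (4 * min 1 (norm (x - y) / r)) powr p"
            using s by (intro powr_mono2) auto
          also have "\<dots> = 4 powr p * (min 1 (norm (x - y) / r)) powr p"
            using r by (simp add: powr_mult)
          also have "(min 1 (norm (x - y) / r)) powr p \<le> min 1 ((norm (x - y) / r) powr p)"
            using r s by (auto simp: min_def powr_le1 ge_one_powr_ge_zero)
          finally have "?d powr p \<le> 4 powr p * min 1 ((norm (x - y) / r) powr p)" by simp
          then have "gagliardo_density s p (bump c r) x y \<le> 4 powr p * kernel p (s * p) r (x - y)"
            unfolding gagliardo_density_def kernel_def times_divide_eq_right by (intro divide_right_mono) auto
          then have "ennreal (gagliardo_density s p (bump c r) x y) \<le> ennreal (4 powr p * kernel p (s * p) r (x - y)) * 1"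
            by (simp add: ennreal_leI)
          also have "\<dots> \<le> ennreal (4 powr p * kernel p (s * p) r (x - y)) * (indicator (ball c r) x + indicator (ball c r) y)"
            using True by (intro mult_left_mono) (auto simp: indicator_def)
          finally show ?thesis .
        next
          case False
          then show ?thesis using bump_eq_0[OF r(1), of x c] bump_eq_0[OF r(1), of y c] by (simp add: gagliardo_density_def)
        qed
      qed auto
      also have "(\<integral>\<^sup>+h. ennreal (4 powr p * kernel p (s * p) r (h::real^'n)) \<partial>lborel) =
          ennreal (4 powr p) * (\<integral>\<^sup>+h. ennreal (kernel p (s * p) r (h::real^'n)) \<partial>lborel)"
        by (simp add: ennreal_mult nn_integral_cmult)
      also have "2 * emeasure lborel (ball c r) * \<dots> \<le> 2 * ennreal (V * r powr ?N) * (ennreal (4 powr p) * ennreal (J * r powr (- (s * p))))"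
        using J(2)[OF r(1)] unfolding em[OF r(1)] by (intro mult_left_mono) auto
      also have "\<dots> = ennreal (2 * (V * r powr ?N) * (4 powr p * (J * r powr (- (s * p)))))"
        using V J by (simp add: ennreal_mult)
      also have "2 * (V * r powr ?N) * (4 powr p * (J * r powr (- (s * p)))) = G * r powr (?N - s * p)"
        by (simp add: G_def powr_diff powr_minus divide_inverse mult_ac)
      finally have "W_norm \<Omega> s (ereal p) (bump c r) \<le>
          ennreal ((k * (G * r powr (?N - s * p)) + V * r powr (?N - s * p)) powr (1 / p))"
        using V G s s1 L[OF r] unfolding k_def by (intro W_norm_le_fractional) auto
      also have "k * (G * r powr (?N - s * p)) + V * r powr (?N - s * p) = (k * G + V) * r powr (?N - s * p)"
        by (simp add: algebra_simps)
      also have "\<dots> powr (1 / p) = C * r powr (?N / p - s)"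
        using V k G r s by (simp add: C_def powr_mult powr_powr diff_divide_distrib)
      finally show "W_norm \<Omega> s (ereal p) (bump c r) \<le> ennreal (C * r powr (?N / p - s))" .
    qed
  qed
qed

lemma Lp_integral_ge_indicator:
  fixes \<Omega> :: "'a::euclidean_space set"
  assumes "\<Omega> \<in> sets borel" "S \<in> sets borel" "S \<subseteq> \<Omega>" "\<And>x. x \<in> S \<Longrightarrow> b \<le> norm (f x)" "0 \<le> b" "0 \<le> p"
  shows "ennreal (b powr p) * emeasure lborel S \<le> Lp_integral (lebesgue_on \<Omega>) p f"
proof -
  have "ennreal (b powr p) * emeasure lborel S = (\<integral>\<^sup>+x. ennreal (b powr p) * indicator S x \<partial>lborel)"
    using assms by (intro nn_integral_cmult_indicator[symmetric]) simp
  also have "\<dots> \<le> (\<integral>\<^sup>+x. ennreal (norm (f x) powr p) * indicator \<Omega> x \<partial>lborel)"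
    using assms by (intro nn_integral_mono) (auto simp: indicator_def intro!: ennreal_leI powr_mono2)
  also have "\<dots> = Lp_integral (lebesgue_on \<Omega>) p f"
    unfolding Lp_integral_def using assms by (intro nn_integral_lebesgue_on[symmetric])
  finally show ?thesis .
qed

text \<open>Centring the test bump at distance \<open>2 * r\<close> in direction \<open>i\<close>
  makes its \<open>i\<close>-th derivative positive throughout the ball of radius \<open>r\<close>
  around \<open>c\<close>. There the distance to the new centre is at most \<open>3 * r\<close> and
  the radius is \<open>4 * r\<close>, so the argument of \<open>flat\<close> is at least 1 - 9/16 =
  7/16, and 16/7 < 3.\<close>

lemma bump_deriv_component_ge:
  fixes z :: "real^'n"
  assumes r: "0 < r" and z: "norm z < r"
  shows "exp (- 3) / (8 * r) \<le> bump_deriv (c + (2 * r) *\<^sub>R axis i 1) (4 * r) (c + z) $ i"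
proof -
  define w where "w = z - (2 * r) *\<^sub>R (axis i 1 :: real^'n)"
  define t where "t = 1 - w \<bullet> w / (4 * r)\<^sup>2"
  have "\<bar>z $ i\<bar> < r" using component_le_norm_cart[of z i] z by linarith
  then have wi: "r \<le> - (w $ i)" by (simp add: w_def)
  have "norm w \<le> norm z + norm ((2 * r) *\<^sub>R (axis i 1 :: real^'n))"
    unfolding w_def by (rule norm_triangle_ineq4)
  also have "\<dots> \<le> 3 * r" using r z by simp
  finally have "(norm w)\<^sup>2 \<le> (3 * r)\<^sup>2" by (intro power_mono) auto
  then have "w \<bullet> w / (4 * r)\<^sup>2 \<le> (3 * r)\<^sup>2 / (4 * r)\<^sup>2"
    by (intro divide_right_mono) (auto simp: dot_square_norm)
  also have "\<dots> = 9 / 16" using r by (simp add: power2_eq_square)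
  finally have t: "7 / 16 \<le> t" by (simp add: t_def)
  have t1: "t \<le> 1" by (simp add: t_def)
  have "1 / t \<le> 1 / (7 / 16)" using t by (intro divide_left_mono) auto
  then have "exp (- 3) \<le> exp (- (1 / t))" by simp
  moreover have "1 \<le> (1 / t)\<^sup>2" using t t1 by (intro one_le_power) simp
  ultimately have "1 * exp (- 3) \<le> (1 / t)\<^sup>2 * exp (- (1 / t))" by (intro mult_mono) auto
  also have "\<dots> = flat (monom 1 2) t" using t by (simp add: flat_def poly_monom)
  finally have F: "exp (- 3) \<le> flat (monom 1 2) t" by simp
  have "exp (- 3) / (8 * r) \<le> 2 / (4 * r)\<^sup>2 * exp (- 3) * r"
    using r by (simp add: power2_eq_square field_simps)
  also have "\<dots> \<le> 2 / (4 * r)\<^sup>2 * flat (monom 1 2) t * (- (w $ i))"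
    using F wi r flat_square_nonneg by (intro mult_mono mult_nonneg_nonneg) auto
  also have "\<dots> = bump_deriv (c + (2 * r) *\<^sub>R axis i 1) (4 * r) (c + z) $ i"
  proof -
    have "c + z - (c + (2 * r) *\<^sub>R axis i 1) = w" by (simp add: w_def)
    then show ?thesis unfolding bump_deriv_def by (simp add: t_def)
  qed
  finally show ?thesis .
qed

lemma ennreal_mult3: "0 \<le> y \<Longrightarrow> 0 \<le> z \<Longrightarrow> ennreal x * ennreal y * ennreal z = ennreal (x * y * z)"
  by (simp add: ennreal_mult'')

text \<open>For \<open>s = 0\<close> the values on the half ball suffice. For
  \<open>0 < s < 1\<close> the half ball is paired with a nearby ball on which the bump vanishes.
  For \<open>s = 1\<close> the gradient is tested with a shifted bump of radius \<open>4 * r\<close>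
  centred \<open>2 * r\<close> away, which fits into the ball of radius
  \<open>6 * r\<close>.\<close>

lemma bump_norm_lower:
  fixes \<Omega> :: "(real^'n) set"
  assumes s: "0 \<le> s" "s \<le> 1" "1 \<le> p" and \<Omega>: "open \<Omega>" "bounded \<Omega>"
  obtains C where "0 < C"
    "\<And>r c. 0 < r \<Longrightarrow> cball c (6 * r) \<subseteq> \<Omega> \<Longrightarrow>
      ennreal (C * r powr (real CARD('n) / p - s)) \<le> W_norm \<Omega> s (ereal p) (bump c r)"
proof -
  let ?N = "real CARD('n)"
  define V where "V = unit_ball_vol ?N"
  have V: "0 < V" by (simp add: V_def)
  define b where "b = exp (- (4 / 3) :: real)"
  have b: "0 < b" by (simp add: b_def)
  have sets: "\<Omega> \<in> sets borel" using \<Omega> by simp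
  have em: "emeasure lborel (ball c r :: (real^'n) set) = ennreal (V * r powr ?N)" if "0 < r" for c r
    using that by (simp add: emeasure_lborel_ball V_def)
  have sub: "ball d l \<subseteq> \<Omega>" if "cball c (6 * r) \<subseteq> \<Omega>" "dist c d + l \<le> 6 * r" for c d :: "real^'n" and r l
  proof
    fix x assume "x \<in> ball d l"
    then have "dist c x \<le> 6 * r" using that(2) dist_triangle[of c x d] by simp
    then show "x \<in> \<Omega>" using that(1) by auto
  qed
  consider "s = 0" | "0 < s" "s < 1" | "s = 1" using s by linarith
  then show ?thesis
  proof cases
    case 1
    define C where "C = (b powr p * (V * (1 / 2) powr ?N)) powr (1 / p)"
    show ?thesis
    proof (rule that)
      show "0 < C" using V b by (simp add: C_def)
      fix r c assume r: "0 < r" and c: "cball c (6 * r) \<subseteq> \<Omega>"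
      have "ennreal (b powr p) * emeasure lborel (ball c (r / 2)) \<le> Lp_integral (lebesgue_on \<Omega>) p (bump c r)"
      proof (rule Lp_integral_ge_indicator[OF sets])
        show "b \<le> norm (bump c r x)" if "x \<in> ball c (r / 2)" for x
          using bump_ge[OF r that] bump_nonneg[of c r x] by (simp add: b_def)
      qed (use sub[OF c, of c "r / 2"] b s r in auto)
      also have "ennreal (b powr p) * emeasure lborel (ball c (r / 2)) = ennreal (b powr p * (V * (r / 2) powr ?N))"
        using V r by (simp add: em ennreal_mult)
      also have "b powr p * (V * (r / 2) powr ?N) = (C * r powr (?N / p)) powr p"
        using r V b s by (simp add: C_def powr_mult powr_powr powr_divide)
      finally show "ennreal (C * r powr (?N / p - s)) \<le> W_norm \<Omega> s (ereal p) (bump c r)"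
        using 1 s r by (simp add: W_norm_zero ennreal_le_epowr_iff C_def)
    qed
  next
    case 2
    define k where "k = sobolev_const CARD('n) s p"
    have k: "0 < k" unfolding k_def using s 2 by (intro sobolev_const_pos) auto
    define G where "G = b powr p / 4 powr (?N + s * p) * (V * (1 / 2) powr ?N) * V"
    have G: "0 < G" using V b by (simp add: G_def)
    define C where "C = (k * G) powr (1 / p)"
    show ?thesis
    proof (rule that)
      show "0 < C" using k G by (simp add: C_def)
      fix r c assume r: "0 < r" and c: "cball c (6 * r) \<subseteq> \<Omega>"
      \<comment> \<open>The ball of radius \<open>r\<close> around \<open>d\<close> avoids the
        support, and its points are at distance at most r/2 + 2 r + r \<le> 4 r from those of the
        half ball.\<close>
      define d where "d = c + (2 * r) *\<^sub>R (axis undefined 1 :: real^'n)"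
      have cd: "dist c d = 2 * r" using r by (simp add: d_def dist_norm)
      let ?A = "ball c (r / 2)" and ?B = "ball d r"
      let ?a = "b powr p / (4 * r) powr (?N + s * p)"
      have "ennreal ?a * emeasure lborel ?A * emeasure lborel ?B \<le> gagliardo \<Omega> s p (bump c r)"
      proof (rule gagliardo_ge_product[OF sets \<Omega>(2) bump_borel])
        fix x y assume x: "x \<in> ?A" and y: "y \<in> ?B"
        have "y \<notin> ball c r" using y cd dist_triangle[of c d y] by (auto simp: dist_commute)
        then have "\<bar>bump c r x - bump c r y\<bar> = bump c r x"
          using bump_eq_0[OF r, of y c] bump_nonneg[of c r x] by simp
        moreover have "b \<le> bump c r x" unfolding b_def using bump_ge[OF r x] .
        ultimately have "b powr p \<le> \<bar>bump c r x - bump c r y\<bar> powr p"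
          using b s by (intro powr_mono2) auto
        moreover have "norm (x - y) powr (?N + s * p) \<le> (4 * r) powr (?N + s * p)"
        proof (rule powr_mono2)
          have "dist x y \<le> dist x c + dist c d + dist d y" by metric
          then show "norm (x - y) \<le> 4 * r" using x y cd r by (auto simp: dist_norm norm_minus_commute)
        qed (use s 2 in auto)
        moreover have "0 < norm (x - y) powr (?N + s * p)"
          using \<open>y \<notin> ball c r\<close> x r by auto
        ultimately show "?a \<le> gagliardo_density s p (bump c r) x y"
          unfolding gagliardo_density_def by (intro frac_le) auto
      qed (use sub[OF c] cd r in auto)
      also have "ennreal ?a * emeasure lborel ?A * emeasure lborel ?B = ennreal (?a * (V * (r / 2) powr ?N) * (V * r powr ?N))"
      proof -
        have "emeasure lborel ?A = ennreal (V * (r / 2) powr ?N)" "emeasure lborel ?B = ennreal (V * r powr ?N)"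
          using r by (auto intro: em)
        then show ?thesis using V by (simp only:) (intro ennreal_mult3; simp)
      qed
      also have "?a * (V * (r / 2) powr ?N) * (V * r powr ?N) = G * r powr (?N - s * p)"
        using r by (simp add: G_def powr_divide powr_mult powr_add powr_diff field_simps)
      finally have "ennreal ((k * (G * r powr (?N - s * p))) powr (1 / p)) \<le> W_norm \<Omega> s (ereal p) (bump c r)"
        using G s 2 unfolding k_def by (intro W_norm_ge_fractional) auto
      also have "(k * (G * r powr (?N - s * p))) powr (1 / p) = C * r powr (?N / p - s)"
        using k G r s by (simp add: C_def powr_mult powr_powr diff_divide_distrib)
      finally show "ennreal (C * r powr (?N / p - s)) \<le> W_norm \<Omega> s (ereal p) (bump c r)" .
    qed
  next
    case 3
    define i :: 'n where "i = undefined"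
    define a where "a = b * (exp (- 3) / 8) * (V * (1 / 2) powr ?N)"
    have a: "0 < a" using V b by (simp add: a_def)
    \<comment> \<open>For \<open>m = e / r\<close> and the test ball of radius \<open>4 * r\<close>,
      the loss \<open>m * \<mu>\<close> equals exactly half of the main term
      \<open>a * r powr (N - 1)\<close>.\<close>
    define e where "e = a / (2 * (V * 4 powr ?N))"
    have e: "0 < e" using a V by (simp add: e_def)
    define G where "G = e powr (p - 1) * (a / 2)"
    have G: "0 < G" using a e by (simp add: G_def)
    define C where "C = G powr (1 / p)"
    show ?thesis
    proof (rule that)
      show "0 < C" using G by (simp add: C_def)
      fix r c assume r: "0 < r" and c: "cball c (6 * r) \<subseteq> \<Omega>"
      define d where "d = c + (2 * r) *\<^sub>R (axis i 1 :: real^'n)"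
      have cd: "dist c d = 2 * r" using r by (simp add: d_def dist_norm)
      have test: "test_function \<Omega> (bump d (4 * r))"
      proof (rule test_function_bump)
        show "cball d (4 * r) \<subseteq> \<Omega>"
        proof
          fix x assume "x \<in> cball d (4 * r)"
          then have "dist c x \<le> 6 * r" using cd dist_triangle[of c x d] by simp
          then show "x \<in> \<Omega>" using c by auto
        qed
      qed (use r in simp)
      have testu: "test_function \<Omega> (bump c r)"
        using c r by (intro test_function_bump) (auto intro: subset_trans[OF subset_cball])
      let ?I = "\<lambda>x. bump c r x * partial_deriv i (bump d (4 * r)) x"
      have intI: "integrable lborel ?I"
        by (rule integrable_test_function(2)[OF test test_function_continuous[OF testu]])
      have low: "exp (- 3) / (8 * r) \<le> partial_deriv i (bump d (4 * r)) x" if "x \<in> ball c r" for x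
        using bump_deriv_component_ge[OF r, of "x - c" c i] that
        by (simp add: partial_deriv_bump d_def dist_norm norm_minus_commute)
      have "measure lborel (ball c (r / 2)) = V * (r / 2) powr ?N"
        using V r by (simp add: measure_def em)
      then have "a * r powr (?N - 1) = b * (exp (- 3) / (8 * r)) * measure lborel (ball c (r / 2))"
        using r by (simp add: a_def powr_divide powr_diff field_simps)
      also have "\<dots> = (\<integral>x. b * (exp (- 3) / (8 * r)) * indicator (ball c (r / 2)) x \<partial>lborel)"
        by simp
      also have "\<dots> \<le> (\<integral>x. ?I x \<partial>lborel)"
      proof (rule integral_mono)
        show "integrable lborel (\<lambda>x. b * (exp (- 3) / (8 * r)) * indicator (ball c (r / 2)) x)"
          using emeasure_bounded_finite[of "ball c (r / 2)"]
          by (intro integrable_mult_right integrable_real_indicator) auto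
        fix x
        show "b * (exp (- 3) / (8 * r)) * indicator (ball c (r / 2)) x \<le> ?I x"
        proof (cases "x \<in> ball c r")
          case True
          \<comment> \<open>With this sign the integrand is nonnegative on the support of the inner
            bump, so discarding all but the half ball only decreases the integral.\<close>
          then have pos: "0 \<le> partial_deriv i (bump d (4 * r)) x"
            using low[OF True] r by (intro order_trans[OF _ low[OF True]]) auto
          show ?thesis
          proof (cases "x \<in> ball c (r / 2)")
            case True2: True
            have "b * (exp (- 3) / (8 * r)) \<le> ?I x"
              using bump_ge[OF r True2] low[OF True] r b bump_nonneg by (intro mult_mono) (auto simp: b_def)
            then show ?thesis using True2 by simp
          qed (use pos bump_nonneg[of c r x] in simp)
        next
          case False
          then have "x \<notin> ball c (r / 2)" using r by auto
          then show ?thesis using False bump_eq_0[OF r False] by simp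
        qed
      qed (rule intI)
      also have "\<dots> = (LINT x|lebesgue_on \<Omega>. ?I x)"
      proof (rule integral_lebesgue_on_eq_lborel[OF sets, symmetric])
        show "?I \<in> borel_measurable borel" using test_function_borel[OF test] by measurable
        have "ball c r \<subseteq> \<Omega>" using sub[OF c, of c r] r by simp
        then show "?I x = 0" if "x \<notin> \<Omega>" for x using that bump_eq_0[OF r, of x c] \<open>ball c r \<subseteq> \<Omega>\<close> by (cases "x \<in> ball c r") auto
      qed
      also have "\<dots> \<le> \<bar>\<dots>\<bar>" by simp
      finally have A: "a * r powr (?N - 1) \<le> \<bar>LINT x|lebesgue_on \<Omega>. ?I x\<bar>" .
      have "ennreal (G * r powr (?N - p)) \<le> Lp_integral (lebesgue_on \<Omega>) p g" if g: "weak_gradient \<Omega> (bump c r) g" for g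
      proof -
        let ?m = "e / r"
        have "ennreal (?m powr (p - 1) * (a * r powr (?N - 1) - ?m * (V * (4 * r) powr ?N))) \<le> Lp_integral (lebesgue_on \<Omega>) p g"
        proof (rule weak_gradient_lower_bound[OF g test _ _ _ sets _ s(3) _ A])
          show "emeasure lborel (ball d (4 * r)) = ennreal (V * (4 * r) powr ?N)" using r by (intro em) simp
          show "\<bar>bump d (4 * r) x\<bar> \<le> indicator (ball d (4 * r)) x" for x
            using bump_le_1[of d "4 * r" x] bump_nonneg[of d "4 * r" x] bump_eq_0[of "4 * r" x d] r
            by (cases "x \<in> ball d (4 * r)") auto
        qed (use V e r in auto)
        also have "?m * (V * (4 * r) powr ?N) = a / 2 * r powr (?N - 1)"
          using V r by (simp add: e_def powr_mult powr_diff field_simps)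
        also have "?m powr (p - 1) * (a * r powr (?N - 1) - a / 2 * r powr (?N - 1)) = G * (r powr (?N - 1) / r powr (p - 1))"
          using e r by (simp add: G_def powr_divide field_simps)
        also have "r powr (?N - 1) / r powr (p - 1) = r powr (?N - p)"
          using r by (simp add: powr_diff[symmetric])
        finally show ?thesis .
      qed
      then have "ennreal ((G * r powr (?N - p)) powr (1 / p)) \<le> W_norm \<Omega> 1 (ereal p) (bump c r)"
        using G s by (intro W_norm_one_ge) auto
      also have "(G * r powr (?N - p)) powr (1 / p) = C * r powr (?N / p - s)"
        using G r s 3 by (simp add: C_def powr_mult powr_powr diff_divide_distrib)
      finally show "ennreal (C * r powr (?N / p - s)) \<le> W_norm \<Omega> s (ereal p) (bump c r)" using 3 by simp
    qed
  qed
qed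

section \<open>Comparison of scaling exponents at small radii\<close>

lemma powr_le_near_0_imp_le:
  fixes a b :: real
  assumes "0 < C" "0 < c" "0 < r0" "\<And>r. 0 < r \<Longrightarrow> r \<le> r0 \<Longrightarrow> c * r powr a \<le> C * r powr b"
  shows "b \<le> a"
proof (rule ccontr)
  assume "\<not> b \<le> a"
  then have ab: "0 < b - a" by simp
  \<comment> \<open>Small enough for \<open>C * r powr (b - a)\<close> to be at most
    \<open>c / 2\<close>.\<close>
  define r where "r = min r0 ((c / (2 * C)) powr (1 / (b - a)))"
  have r: "0 < r" "r \<le> r0" using assms by (auto simp: r_def)
  have "r powr (b - a) \<le> ((c / (2 * C)) powr (1 / (b - a))) powr (b - a)"
    using ab r by (intro powr_mono2) (auto simp: r_def)
  also have "\<dots> = c / (2 * C)" using ab assms by (simp add: powr_powr)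
  finally have "C * (r powr a * r powr (b - a)) \<le> C * (r powr a * (c / (2 * C)))"
    using assms by (intro mult_left_mono) auto
  also have "\<dots> = c * r powr a / 2" using assms by simp
  finally have "C * r powr b \<le> c * r powr a / 2" by (simp add: powr_add[symmetric])
  moreover have "0 < c * r powr a" using assms r by simp
  ultimately show False using assms(4)[OF r] by linarith
qed

lemma W_embedded_scaling:
  fixes \<Omega> :: "(real^'n) set"
  assumes "0 < s" "s \<le> 1" "1 \<le> p" "0 \<le> s'" "s' \<le> 1" "1 \<le> q"
    and \<Omega>: "open \<Omega>" "bounded \<Omega>" "\<Omega> \<noteq> {}"
    and emb: "W_embedded \<Omega> s (ereal p) s' (ereal q)"
  shows "real CARD('n) / p - s \<le> real CARD('n) / q - s'"
proof -
  obtain C where C: "0 < C" "\<And>r c. 0 < r \<Longrightarrow> r \<le> 1 \<Longrightarrow> cball c r \<subseteq> \<Omega> \<Longrightarrow>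
      W_norm \<Omega> s (ereal p) (bump c r) \<le> ennreal (C * r powr (real CARD('n) / p - s))"
    using bump_norm_upper[of s p \<Omega>] assms by metis
  obtain D where D: "0 < D" "\<And>r c. 0 < r \<Longrightarrow> cball c (6 * r) \<subseteq> \<Omega> \<Longrightarrow>
      ennreal (D * r powr (real CARD('n) / q - s')) \<le> W_norm \<Omega> s' (ereal q) (bump c r)"
    using bump_norm_lower[of s' q \<Omega>] assms by metis
  obtain E where E: "0 < E" "\<And>u a b. u \<in> borel_measurable (lebesgue_on \<Omega>) \<Longrightarrow> W_norm \<Omega> s (ereal p) u \<le> ennreal b \<Longrightarrow> 0 \<le> b
      \<Longrightarrow> ennreal a \<le> W_norm \<Omega> s' (ereal q) u \<Longrightarrow> a \<le> E * b"
    using W_embeddedE[OF emb] by metis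
  obtain c \<delta> where c: "0 < \<delta>" "cball c \<delta> \<subseteq> \<Omega>"
    using \<Omega> by (meson all_not_in_conv open_contains_cball)
  show ?thesis
  \<comment> \<open>The upper norm bound needs \<open>r \<le> 1\<close>; the lower one needs the
    ball of radius \<open>6 * r\<close> inside \<Omega>.\<close>
  proof (rule powr_le_near_0_imp_le[of "E * C" D "min 1 (\<delta> / 6)"])
    fix r assume r: "0 < r" "r \<le> min 1 (\<delta> / 6)"
    then have sub: "cball c (6 * r) \<subseteq> \<Omega>" "cball c r \<subseteq> \<Omega>"
      using c(2) subset_cball[of "6 * r" \<delta> c] subset_cball[of r \<delta> c] by auto
    have "D * r powr (real CARD('n) / q - s') \<le> E * (C * r powr (real CARD('n) / p - s))"
      using r sub C D by (intro E(2)[OF borel_measurable_lebesgue_on[OF bump_borel]]) auto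
    then show "D * r powr (real CARD('n) / q - s') \<le> E * C * r powr (real CARD('n) / p - s)"
      by (simp add: mult.assoc)
  qed (use C D E c in auto)
qed

subsection \<open>Lacunary sine sums\<close>

text \<open>If the largest term is at least twice the next one, then twice that next one, which
  bounds all the rest by induction, is at most the largest. Arbitrary finite index sets are allowed
  because the set of frequencies gets split by the size of \<open>freq k * h\<close>.\<close>

lemma sum_le_twice_Max:
  fixes b :: "nat \<Rightarrow> real"
  assumes "finite A" "A \<noteq> {}" "\<And>i j. i \<in> A \<Longrightarrow> j \<in> A \<Longrightarrow> i < j \<Longrightarrow> 2 * b i \<le> b j"
    and "\<And>i. i \<in> A \<Longrightarrow> 0 \<le> b i"
  shows "sum b A \<le> 2 * b (Max A)"
  using assms
proof (induction A rule: finite_linorder_max_induct)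
  case (insert n A)
  have M: "Max (insert n A) = n"
    using insert.hyps by (intro Max_eqI) auto
  show ?case
  proof (cases "A = {}")
    case False
    have "sum b A \<le> 2 * b (Max A)" using insert.prems False by (intro insert.IH) auto
    also have "\<dots> \<le> b n" using insert.prems(2)[of "Max A" n] insert.hyps False by auto
    finally show ?thesis using insert.hyps M by auto
  qed (use M insert.prems in simp)
qed simp

lemma sum_le_twice_Min:
  fixes b :: "nat \<Rightarrow> real"
  assumes "finite A" "A \<noteq> {}" "\<And>i j. i \<in> A \<Longrightarrow> j \<in> A \<Longrightarrow> i < j \<Longrightarrow> 2 * b j \<le> b i"
    and "\<And>i. i \<in> A \<Longrightarrow> 0 \<le> b i"
  shows "sum b A \<le> 2 * b (Min A)"
  using assms
proof (induction A rule: finite_linorder_min_induct)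
  case (insert n A)
  have M: "Min (insert n A) = n"
    using insert.hyps by (intro Min_eqI) auto
  show ?case
  proof (cases "A = {}")
    case False
    have "sum b A \<le> 2 * b (Min A)" using insert.prems False by (intro insert.IH) auto
    also have "\<dots> \<le> b n" using insert.prems(2)[of n "Min A"] insert.hyps False by auto
    finally show ?thesis using insert.hyps M by auto
  qed (use M insert.prems in simp)
qed simp

lemma abs_sin_diff_le: "\<bar>sin a - sin b\<bar> \<le> \<bar>a - b\<bar>" for a b :: real
proof -
  have "\<bar>sin a - sin b\<bar> = 2 * \<bar>sin ((a - b) / 2)\<bar> * \<bar>cos ((a + b) / 2)\<bar>"
    by (simp add: sin_diff_sin abs_mult)
  also have "\<dots> \<le> 2 * \<bar>(a - b) / 2\<bar> * 1"
    by (intro mult_mono abs_sin_x_le_abs_x abs_cos_le_one) auto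
  finally show ?thesis by simp
qed

text \<open>Each condition serves one purpose: \<open>2 \<le> M powr s\<close> makes the amplitudes
  decay geometrically, \<open>20 \<le> M powr (1 - s)\<close> keeps the lower frequencies from
  disturbing a given one, \<open>6 \<le> M\<close> separates annuli whose radii have ratio 5, and
  evenness turns a half period of one term into full periods of all higher terms. A large base
  frequency \<open>\<omega>\<close> fits even the coarsest oscillation into a small ball.\<close>

locale lacunary =
  fixes s \<omega> :: real and M :: nat and i0 :: "'n::finite"
  assumes s: "0 < s" "s < 1" and \<omega>: "1 \<le> \<omega>" and even_M: "even M" and M_ge: "6 \<le> M"
    and M_powr: "2 \<le> real M powr s" "20 \<le> real M powr (1 - s)"
begin

definition freq :: "nat \<Rightarrow> real" where "freq k = \<omega> * real M ^ k"

text \<open>The weight makes every frequency contribute equally to the seminorm of order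
  \<open>s\<close>. The phase supplies cosines through \<open>\<beta> = pi / 2\<close>, needed in
  \<open>not_W_embedded_first_order\<close>.\<close>

definition osc :: "nat set \<Rightarrow> real \<Rightarrow> real^'n \<Rightarrow> real" where
  "osc I \<beta> x = (\<Sum>k\<in>I. freq k powr (- s) * sin (freq k * x $ i0 + \<beta>))"

lemma freq_ge_1: "1 \<le> freq k"
  using mult_mono[OF \<omega>, of 1 "real M ^ k"] M_ge \<omega> by (simp add: freq_def)

lemma freq_pos [simp]: "0 < freq k"
  using freq_ge_1[of k] by linarith

lemma freq_nonneg [simp]: "0 \<le> freq k" and freq_neq_0 [simp]: "freq k \<noteq> 0"
  using freq_pos[of k] by linarith+

lemma freq_less: "j < k \<Longrightarrow> real M * freq j \<le> freq k"
proof -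
  assume "j < k"
  then have "real M ^ Suc j \<le> real M ^ k" using M_ge by (intro power_increasing) auto
  then show ?thesis using \<omega> by (simp add: freq_def)
qed

lemma freq_powr_less:
  assumes "j < k" "0 \<le> a"
  shows "real M powr a * freq j powr a \<le> freq k powr a"
proof -
  have "real M powr a * freq j powr a = (real M * freq j) powr a"
    by (simp add: powr_mult)
  also have "\<dots> \<le> freq k powr a"
    using freq_less[OF assms(1)] assms(2) less_imp_le[OF freq_pos] by (intro powr_mono2) auto
  finally show ?thesis .
qed

lemma freq_powr_growth: "i < j \<Longrightarrow> 20 * freq i powr (1 - s) \<le> freq j powr (1 - s)"
  using s by (intro order_trans[OF mult_right_mono[OF M_powr(2)] freq_powr_less]) auto

lemma freq_powr_decay: "i < j \<Longrightarrow> 2 * freq j powr (- s) \<le> freq i powr (- s)"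
proof -
  assume "i < j"
  then have "2 * freq i powr s \<le> freq j powr s"
    using s by (intro order_trans[OF mult_right_mono[OF M_powr(1)] freq_powr_less]) auto
  moreover have "0 < freq i powr s" "0 < freq j powr s" by simp_all
  ultimately show ?thesis unfolding powr_minus by (simp add: field_simps)
qed

lemma continuous_osc: "continuous_on UNIV (osc I \<beta>)"
  unfolding osc_def[abs_def] by (intro continuous_intros)

lemma osc_borel [measurable]: "osc I \<beta> \<in> borel_measurable borel"
  by (intro borel_measurable_continuous_onI continuous_osc)

text \<open>The amplitudes start below 1 and at least halve from each frequency to the next, so the
  bound is independent of \<open>I\<close>.\<close>

lemma abs_osc_le:
  assumes "finite I"
  shows "\<bar>osc I \<beta> x\<bar> \<le> 2"
proof (cases "I = {}")
  case False
  have "\<bar>osc I \<beta> x\<bar> \<le> (\<Sum>k\<in>I. \<bar>freq k powr (- s) * sin (freq k * x $ i0 + \<beta>)\<bar>)"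
    unfolding osc_def by (rule sum_abs)
  also have "\<dots> \<le> (\<Sum>k\<in>I. freq k powr (- s))"
    by (intro sum_mono) (simp add: abs_mult mult_left_le)
  also have "\<dots> \<le> 2 * freq (Min I) powr (- s)"
    using assms False freq_powr_decay by (intro sum_le_twice_Min) auto
  also have "freq (Min I) powr (- s) \<le> freq (Min I) powr 0"
    using freq_ge_1 s by (intro powr_mono) auto
  finally show ?thesis using freq_pos[of "Min I"] by simp
qed (simp add: osc_def)

lemma osc_diff_le: "\<bar>osc I \<beta> x - osc I \<beta> y\<bar> \<le> (\<Sum>k\<in>I. freq k powr (- s) * min 2 (freq k * norm (x - y)))"
proof -
  have "osc I \<beta> x - osc I \<beta> y = (\<Sum>k\<in>I. freq k powr (- s) * (sin (freq k * x $ i0 + \<beta>) - sin (freq k * y $ i0 + \<beta>)))"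
    by (simp add: osc_def sum_subtractf right_diff_distrib)
  also have "\<bar>\<dots>\<bar> \<le> (\<Sum>k\<in>I. freq k powr (- s) * min 2 (freq k * norm (x - y)))"
  proof (rule order_trans[OF sum_abs sum_mono])
    fix k
    let ?d = "\<bar>sin (freq k * x $ i0 + \<beta>) - sin (freq k * y $ i0 + \<beta>)\<bar>"
    have "?d \<le> 2"
      using sin_le_one[of "freq k * x $ i0 + \<beta>"] sin_ge_minus_one[of "freq k * x $ i0 + \<beta>"]
        sin_le_one[of "freq k * y $ i0 + \<beta>"] sin_ge_minus_one[of "freq k * y $ i0 + \<beta>"] by linarith
    moreover have "?d \<le> freq k * norm (x - y)"
    proof -
      have "?d \<le> \<bar>freq k * (x - y) $ i0\<bar>"
        using abs_sin_diff_le[of "freq k * x $ i0 + \<beta>" "freq k * y $ i0 + \<beta>"] by (simp add: right_diff_distrib)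
      also have "\<dots> \<le> freq k * norm (x - y)"
        using component_le_norm_cart[of "x - y" i0] less_imp_le[OF freq_pos[of k]]
        unfolding abs_mult by (intro mult_mono) auto
      finally show ?thesis .
    qed
    ultimately show "\<bar>freq k powr (- s) * (sin (freq k * x $ i0 + \<beta>) - sin (freq k * y $ i0 + \<beta>))\<bar>
        \<le> freq k powr (- s) * min 2 (freq k * norm (x - y))"
      by (simp add: abs_mult)
  qed
  finally show ?thesis .
qed

text \<open>The terms increase geometrically in \<open>k\<close> up to \<open>freq k * h \<approx> 2\<close> and decrease geometrically
  afterwards, so that the sum is comparable to its largest term.\<close>

lemma lacunary_sum_powr_le:
  assumes "finite I" "0 \<le> h" "1 \<le> p"
  shows "(\<Sum>k\<in>I. freq k powr (- s) * min 2 (freq k * h)) powr p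
    \<le> 4 powr p * (\<Sum>k\<in>I. (freq k powr (- s) * min 2 (freq k * h)) powr p)"
proof -
  define b where "b k = freq k powr (- s) * min 2 (freq k * h)" for k
  have b0: "0 \<le> b k" for k using assms less_imp_le[OF freq_pos[of k]] by (auto simp: b_def)
  \<comment> \<open>The l^p norm of the terms dominates the largest one; the increasing and the
    decreasing half are then each at most \<open>2 * X\<close>, whose p-th power is again additive
    over the frequencies.\<close>
  define X where "X = (\<Sum>k\<in>I. b k powr p) powr (1 / p)"
  have X0: "0 \<le> X" by (simp add: X_def)
  have bX: "b k \<le> X" if "k \<in> I" for k
  proof -
    have "b k = (b k powr p) powr (1 / p)" using b0 assms by (simp add: powr_powr)
    also have "\<dots> \<le> X" unfolding X_def
      using that assms by (intro powr_mono2 member_le_sum) auto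
    finally show ?thesis .
  qed
  let ?L = "{k\<in>I. freq k * h \<le> 2}" and ?H = "{k\<in>I. \<not> freq k * h \<le> 2}"
  have L: "sum b ?L \<le> 2 * X"
  proof (cases "?L = {}")
    case False
    have bL: "b k = freq k powr (1 - s) * h" if "k \<in> ?L" for k
    proof -
      have "min 2 (freq k * h) = freq k * h" using that by simp
      then show ?thesis by (simp add: b_def powr_diff powr_minus divide_inverse)
    qed
    have "sum b ?L \<le> 2 * b (Max ?L)"
    proof (rule sum_le_twice_Max)
      fix i j assume ij: "i \<in> ?L" "j \<in> ?L" "i < j"
      have "2 * freq i powr (1 - s) \<le> freq j powr (1 - s)"
        using freq_powr_growth[OF ij(3)] powr_ge_zero[of "freq i" "1 - s"] by linarith
      then show "2 * b i \<le> b j" using ij assms mult_right_mono by (fastforce simp: bL mult.assoc[symmetric])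
    qed (use assms False b0 in auto)
    also have "\<dots> \<le> 2 * X" using bX[of "Max ?L"] Max_in[OF _ False] assms by simp
    finally show ?thesis .
  next
    case True
    then show ?thesis using X0 by (simp only: True) simp
  qed
  have H: "sum b ?H \<le> 2 * X"
  proof (cases "?H = {}")
    case False
    have bH: "b k = freq k powr (- s) * 2" if "k \<in> ?H" for k
      using that by (simp add: b_def min_def)
    have "sum b ?H \<le> 2 * b (Min ?H)"
    proof (rule sum_le_twice_Min)
      fix i j assume ij: "i \<in> ?H" "j \<in> ?H" "i < j"
      then show "2 * b j \<le> b i" using freq_powr_decay[OF ij(3)] by (simp add: bH)
    qed (use assms False b0 in auto)
    also have "\<dots> \<le> 2 * X" using bX[of "Min ?H"] Min_in[OF _ False] assms by simp
    finally show ?thesis .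
  next
    case True
    then show ?thesis using X0 by (simp only: True) simp
  qed
  have "sum b I = sum b ?L + sum b ?H"
    using assms by (subst sum.union_disjoint[symmetric]) (auto intro!: arg_cong[where f="sum b"])
  with L H have "sum b I \<le> 4 * X" by simp
  then have "sum b I powr p \<le> (4 * X) powr p"
    using assms b0 by (intro powr_mono2 sum_nonneg) auto
  also have "\<dots> = 4 powr p * (\<Sum>k\<in>I. b k powr p)"
    using assms by (simp add: powr_mult X_def powr_powr sum_nonneg)
  finally show ?thesis unfolding b_def .
qed

text \<open>The 8 is 4 from \<open>lacunary_sum_powr_le\<close> times 2 from min 2 t \<le> 2 min 1
  t; the term of frequency \<open>freq k\<close> lives at the scale
  \<open>1 / freq k\<close>.\<close>

lemma gagliardo_density_osc_le:
  assumes "finite I" "1 \<le> p"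
  shows "gagliardo_density s p (osc I \<beta>) x y \<le>
    (\<Sum>k\<in>I. 8 powr p * freq k powr (- (s * p)) * kernel p (s * p) (1 / freq k) (x - y))"
proof -
  let ?h = "norm (x - y)"
  have "\<bar>osc I \<beta> x - osc I \<beta> y\<bar> powr p \<le> (\<Sum>k\<in>I. freq k powr (- s) * min 2 (freq k * ?h)) powr p"
    using assms osc_diff_le by (intro powr_mono2) auto
  also have "\<dots> \<le> 4 powr p * (\<Sum>k\<in>I. (freq k powr (- s) * min 2 (freq k * ?h)) powr p)"
    using assms by (intro lacunary_sum_powr_le) auto
  also have "\<dots> \<le> 4 powr p * (\<Sum>k\<in>I. 2 powr p * (freq k powr (- (s * p)) * min 1 ((?h / (1 / freq k)) powr p)))"
  proof (intro mult_left_mono sum_mono)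
    fix k
    have nn: "0 \<le> freq k * ?h" using less_imp_le[OF freq_pos[of k]] by simp
    have "(freq k powr (- s) * min 2 (freq k * ?h)) powr p \<le> (freq k powr (- s) * (2 * min 1 (freq k * ?h))) powr p"
      using nn assms by (intro powr_mono2 mult_left_mono) (auto simp: min_def)
    also have "\<dots> = freq k powr (- (s * p)) * (2 powr p * (min 1 (freq k * ?h)) powr p)"
      by (simp add: powr_mult powr_powr)
    also have "(min 1 (freq k * ?h)) powr p \<le> min 1 ((freq k * ?h) powr p)"
      using nn assms by (auto simp: min_def powr_le1 ge_one_powr_ge_zero)
    finally show "(freq k powr (- s) * min 2 (freq k * ?h)) powr p \<le>
      2 powr p * (freq k powr (- (s * p)) * min 1 ((?h / (1 / freq k)) powr p))"
      by (simp add: mult_ac)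
  qed auto
  also have "\<dots> = (\<Sum>k\<in>I. 8 powr p * (freq k powr (- (s * p)) * min 1 ((?h / (1 / freq k)) powr p)))"
    by (simp add: sum_distrib_left mult.assoc[symmetric] powr_mult[symmetric])
  finally have "gagliardo_density s p (osc I \<beta>) x y \<le>
    (\<Sum>k\<in>I. 8 powr p * (freq k powr (- (s * p)) * min 1 ((?h / (1 / freq k)) powr p))) / ?h powr (real CARD('n) + s * p)"
    unfolding gagliardo_density_def by (intro divide_right_mono) auto
  then show ?thesis by (simp add: kernel_def sum_divide_distrib mult.assoc)
qed

lemma osc_norm_upper:
  fixes \<Omega> :: "(real^'n) set"
  assumes p: "1 \<le> p" and \<Omega>: "open \<Omega>" "bounded \<Omega>"
  obtains C where "0 < C"
    "\<And>I \<beta>. finite I \<Longrightarrow> I \<noteq> {} \<Longrightarrow> W_norm \<Omega> s (ereal p) (osc I \<beta>) \<le> ennreal (C * real (card I) powr (1 / p))"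
proof -
  have sets: "\<Omega> \<in> sets borel" using \<Omega> by simp
  define V where "V = measure lborel \<Omega> + 1"
  have V: "0 < V" unfolding V_def by (intro add_nonneg_pos) auto
  have em: "emeasure lborel \<Omega> \<le> ennreal V"
    using emeasure_bounded_finite[OF \<Omega>(2)] by (subst emeasure_eq_ennreal_measure) (auto simp: V_def intro: ennreal_leI)
  have sp: "0 < s * p" "s * p < p" using s p by auto
  obtain J where J: "0 < J" "\<And>l. 0 < l \<Longrightarrow> (\<integral>\<^sup>+h. ennreal (kernel p (s * p) l (h::real^'n)) \<partial>lborel) \<le> ennreal (J * l powr (- (s * p)))"
    using nn_integral_kernel_le[OF sp] by metis
  define k where "k = sobolev_const CARD('n) s p"
  have k: "0 < k" unfolding k_def using s p by (intro sobolev_const_pos) auto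
  define C where "C = (k * (2 * V * (8 powr p * J)) + 2 powr p * V) powr (1 / p)"
  show ?thesis
  proof (rule that)
    have "0 < k * (2 * V * (8 powr p * J)) + 2 powr p * V" using k V J by (intro add_pos_pos) auto
    then show "0 < C" by (simp add: C_def)
    fix I :: "nat set" and \<beta> assume I: "finite I" "I \<noteq> {}"
    define m where "m = real (card I)"
    have m: "1 \<le> m" using I by (simp add: m_def Suc_le_eq card_gt_0_iff)
    let ?K = "\<lambda>h::real^'n. \<Sum>k\<in>I. ennreal (8 powr p * freq k powr (- (s * p))) * ennreal (kernel p (s * p) (1 / freq k) h)"
    have "gagliardo \<Omega> s p (osc I \<beta>) \<le> 2 * emeasure lborel \<Omega> * (\<integral>\<^sup>+h. ?K h \<partial>lborel)"
    proof (rule gagliardo_le_convolution[OF sets \<Omega>(2) osc_borel _ sets])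
      fix x y :: "real^'n" assume xy: "x \<in> \<Omega>" "y \<in> \<Omega>"
      have "ennreal (gagliardo_density s p (osc I \<beta>) x y) \<le>
          ennreal (\<Sum>k\<in>I. 8 powr p * freq k powr (- (s * p)) * kernel p (s * p) (1 / freq k) (x - y))"
        using gagliardo_density_osc_le[OF I(1) p] by (rule ennreal_leI)
      also have "\<dots> = ?K (x - y)"
        by (subst sum_ennreal[symmetric]) (auto simp: ennreal_mult)
      also have "\<dots> \<le> ?K (x - y) * (indicator \<Omega> x + indicator \<Omega> y)"
        using mult_left_mono[of 1 "indicator \<Omega> x + indicator \<Omega> y" "?K (x - y)"] xy by simp
      finally show "ennreal (gagliardo_density s p (osc I \<beta>) x y) \<le> ?K (x - y) * (indicator \<Omega> x + indicator \<Omega> y)" .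
    qed simp
    also have "(\<integral>\<^sup>+h. ?K h \<partial>lborel) =
        (\<Sum>k\<in>I. ennreal (8 powr p * freq k powr (- (s * p))) * (\<integral>\<^sup>+h. ennreal (kernel p (s * p) (1 / freq k) (h::real^'n)) \<partial>lborel))"
      by (simp add: nn_integral_sum nn_integral_cmult)
    also have "\<dots> \<le> (\<Sum>k\<in>I. ennreal (8 powr p * freq k powr (- (s * p))) * ennreal (J * (1 / freq k) powr (- (s * p))))"
      by (intro sum_mono mult_left_mono J(2)) auto
    also have "\<dots> = (\<Sum>k\<in>I. ennreal (8 powr p * J))"
    proof (rule sum.cong)
      fix k
      \<comment> \<open>The amplitude cancels the scale of the kernel exactly, so each frequency
        costs the same and the total is proportional to \<open>card I\<close>.\<close>
      have "freq k powr (- (s * p)) * (1 / freq k) powr (- (s * p)) = 1"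
        by (simp add: powr_mult[symmetric])
      then show "ennreal (8 powr p * freq k powr (- (s * p))) * ennreal (J * (1 / freq k) powr (- (s * p))) = ennreal (8 powr p * J)"
        using J by (subst ennreal_mult[symmetric]) (auto simp: mult_ac)
    qed simp
    also have "\<dots> = ennreal (m * (8 powr p * J))"
      using J by (simp add: m_def ennreal_of_nat_eq_real_of_nat ennreal_mult)
    also have "2 * emeasure lborel \<Omega> * \<dots> \<le> 2 * ennreal V * \<dots>"
      using em by (intro mult_mono) auto
    also have "\<dots> = ennreal (2 * V * (m * (8 powr p * J)))"
      using V J m by (simp add: ennreal_mult)
    finally have G: "gagliardo \<Omega> s p (osc I \<beta>) \<le> ennreal (2 * V * (m * (8 powr p * J)))"
      by (simp add: mult_left_mono)
    have "Lp_integral (lebesgue_on \<Omega>) p (osc I \<beta>) \<le> ennreal (2 powr p) * emeasure lborel \<Omega>"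
      using abs_osc_le[OF I(1)] p by (intro Lp_integral_le_indicator[OF sets sets]) auto
    also have "\<dots> \<le> ennreal (2 powr p) * ennreal V" by (intro mult_left_mono em) auto
    also have "\<dots> = ennreal (2 powr p * V)" using V by (simp add: ennreal_mult)
    \<comment> \<open>The L^p part stays bounded in \<open>I\<close> and is inflated by
      \<open>m \<ge> 1\<close> to match the seminorm.\<close>
    also have "\<dots> \<le> ennreal (m * (2 powr p * V))"
      using V m mult_right_mono[OF m, of "2 powr p * V"] by (intro ennreal_leI) auto
    finally have "W_norm \<Omega> s (ereal p) (osc I \<beta>) \<le>
        ennreal ((k * (2 * V * (m * (8 powr p * J))) + m * (2 powr p * V)) powr (1 / p))"
      using V J m s p G unfolding k_def by (intro W_norm_le_fractional) auto
    also have "k * (2 * V * (m * (8 powr p * J))) + m * (2 powr p * V) = (k * (2 * V * (8 powr p * J)) + 2 powr p * V) * m"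
      by (simp add: algebra_simps)
    also have "\<dots> powr (1 / p) = C * m powr (1 / p)"
      using V k J m by (simp add: C_def powr_mult)
    finally show "W_norm \<Omega> s (ereal p) (osc I \<beta>) \<le> ennreal (C * real (card I) powr (1 / p))"
      unfolding m_def .
  qed
qed

end

section \<open>Lower bounds for lacunary sums at a single scale\<close>

lemma sin_add_even_mult_pi: "sin (t + 2 * real n * pi) = sin t"
  using sin_periodic_pi[of t] by (induction n) (auto simp: algebra_simps sin_add cos_add)

lemma abs_sin_or_cos_ge: "1 / 2 \<le> \<bar>sin t\<bar> \<or> 1 / 2 \<le> \<bar>cos t\<bar>" for t :: real
proof (rule ccontr)
  assume "\<not> ?thesis"
  then have "\<bar>sin t\<bar> < 1 / 2" "\<bar>cos t\<bar> < 1 / 2" by simp_all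
  then have "\<bar>sin t\<bar>\<^sup>2 < (1 / 2)\<^sup>2" "\<bar>cos t\<bar>\<^sup>2 < (1 / 2)\<^sup>2"
    by (meson abs_ge_zero power_strict_mono pos2)+
  then show False using sin_cos_squared_add[of t] by (simp add: power2_eq_square)
qed

context lacunary
begin

text \<open>A quarter of the period: two steps reverse the sign of the \<open>k\<close>-th term, one
  step turns its sine into a cosine.\<close>

definition half_step :: "nat \<Rightarrow> real^'n" where
  "half_step k = (pi / (2 * freq k)) *\<^sub>R axis i0 1"

lemma norm_half_step: "norm (half_step k) = pi / (2 * freq k)"
  by (simp add: half_step_def)

text \<open>A translation by half a period of the \<open>k\<close>-th term flips the sign of that term, leaves all
  higher terms invariant because \<open>M\<close> is even, and hardly changes the lower terms.\<close>

lemma osc_half_period: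
  assumes I: "finite I" "k \<in> I"
  shows "freq k powr (- s) * (2 * \<bar>sin (freq k * x $ i0 + \<beta>)\<bar> - 1 / 3) \<le> \<bar>osc I \<beta> (x + 2 *\<^sub>R half_step k) - osc I \<beta> x\<bar>"
proof -
  define \<theta> where "\<theta> j = freq j * x $ i0 + \<beta>" for j
  define \<tau> where "\<tau> = pi / freq k"
  define d where "d j = freq j powr (- s) * (sin (\<theta> j + freq j * \<tau>) - sin (\<theta> j))" for j
  have x': "(x + 2 *\<^sub>R half_step k) $ i0 = x $ i0 + \<tau>" by (simp add: half_step_def \<tau>_def)
  have D: "osc I \<beta> (x + 2 *\<^sub>R half_step k) - osc I \<beta> x = sum d I"
    unfolding osc_def x' d_def \<theta>_def by (simp add: sum_subtractf algebra_simps)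
  have hi: "d j = 0" if kj: "k < j" for j
  proof -
    obtain n where n: "real M ^ (j - k) = 2 * real n"
    proof -
      have "even (M ^ (j - k))" using even_M kj by simp
      then obtain n where "M ^ (j - k) = 2 * n" by (elim evenE)
      then have "real (M ^ (j - k)) = real (2 * n)" by (simp only:)
      then show ?thesis using that[of n] by simp
    qed
    have "freq j = freq k * real M ^ (j - k)" using kj by (simp add: freq_def power_add[symmetric])
    then have "freq j * \<tau> = 2 * real n * pi" by (simp add: \<tau>_def n)
    then show ?thesis by (simp add: d_def sin_add_even_mult_pi)
  qed
  have mid: "d k = - 2 * (freq k powr (- s) * sin (\<theta> k))"
    by (simp add: d_def \<tau>_def)
  let ?L = "{j\<in>I. j < k}"
  have lo: "\<bar>sum d ?L\<bar> \<le> freq k powr (- s) * (1 / 3)"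
  proof (cases "?L = {}")
    case True
    show ?thesis by (simp only: True) simp
  next
    case False
    define b where "b j = freq j powr (1 - s) * \<tau>" for j
    have \<tau>: "0 < \<tau>" by (simp add: \<tau>_def)
    have "\<bar>sum d ?L\<bar> \<le> sum b ?L"
    proof (rule order_trans[OF sum_abs sum_mono])
      fix j
      have "\<bar>sin (\<theta> j + freq j * \<tau>) - sin (\<theta> j)\<bar> \<le> \<bar>freq j * \<tau>\<bar>"
        using abs_sin_diff_le[of "\<theta> j + freq j * \<tau>" "\<theta> j"] by simp
      then have "\<bar>d j\<bar> \<le> freq j powr (- s) * (freq j * \<tau>)"
        using \<tau> unfolding d_def abs_mult by (intro mult_mono) auto
      also have "\<dots> = b j" by (simp add: b_def powr_diff powr_minus divide_inverse mult_ac)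
      finally show "\<bar>d j\<bar> \<le> b j" .
    qed
    also have "\<dots> \<le> 2 * b (Max ?L)"
    proof (rule sum_le_twice_Max)
      fix i j :: nat assume "i < j"
      then have "2 * freq i powr (1 - s) \<le> freq j powr (1 - s)"
        using freq_powr_growth[of i j] powr_ge_zero[of "freq i" "1 - s"] by linarith
      then show "2 * b i \<le> b j" using \<tau> unfolding b_def mult.assoc[symmetric] by (intro mult_right_mono) auto
    qed (use I False \<tau> in \<open>auto simp: b_def\<close>)
    also have "\<dots> \<le> 2 * (freq k powr (1 - s) / 20 * \<tau>)"
    proof -
      have "Max ?L < k" using Max_in[OF _ False] I by simp
      from freq_powr_growth[OF this] show ?thesis
        using \<tau> unfolding b_def by (intro mult_left_mono mult_right_mono) auto
    qed
    \<comment> \<open>The factors 2 and 1/20 give pi/10, which is below 1/3; this is where the 20 in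
      \<open>M_powr\<close> comes from.\<close>
    also have "\<dots> = freq k powr (- s) * (pi / 10)"
      by (simp add: \<tau>_def powr_diff powr_minus field_simps)
    also have "\<dots> \<le> freq k powr (- s) * (1 / 3)"
      using pi_less_4 pi_approx by (intro mult_left_mono) auto
    finally show ?thesis .
  qed
  have "sum d I = sum d (?L \<union> {k})"
    using I hi by (intro sum.mono_neutral_right) (auto, metis linorder_neqE_nat)
  also have "\<dots> = sum d ?L + d k" using I by (subst sum.union_disjoint) auto
  finally have "sum d I = sum d ?L + d k" .
  moreover have "\<bar>d k\<bar> = freq k powr (- s) * (2 * \<bar>sin (\<theta> k)\<bar>)"
    unfolding mid by (simp add: abs_mult)
  ultimately show ?thesis using lo unfolding D \<theta>_def right_diff_distrib by linarith
qed

text \<open>The pairs of points 0, 2 and 1, 3 are half a period apart, and their phases differ by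
  \<open>pi / 2\<close>. Since sine or cosine is at least 1/2 in absolute value, one pair has values
  at least \<open>freq k powr (- s) / 2\<close> apart, so one of its two values is half of that away
  from any \<open>t\<close>. The arbitrary \<open>t\<close> will be the value at a second, unrelated
  point.\<close>

lemma osc_four_points:
  assumes I: "finite I" "k \<in> I"
  shows "\<exists>i<4::nat. freq k powr (- s) / 4 \<le> \<bar>osc I \<beta> (real i *\<^sub>R half_step k + x) - t\<bar>"
proof -
  define f where "f i = osc I \<beta> (real i *\<^sub>R half_step k + x)" for i :: nat
  let ?c = "freq k powr (- s)"
  let ?\<theta> = "freq k * x $ i0 + \<beta>"
  have shift: "freq k * (half_step k + x) $ i0 + \<beta> = ?\<theta> + pi / 2"
    by (simp add: half_step_def field_simps)
  have 0: "?c * (2 * \<bar>sin ?\<theta>\<bar> - 1 / 3) \<le> \<bar>f 2 - f 0\<bar>"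
    using osc_half_period[OF I, of x \<beta>] by (simp add: f_def add.commute)
  have 1: "?c * (2 * \<bar>cos ?\<theta>\<bar> - 1 / 3) \<le> \<bar>f 3 - f 1\<bar>"
  proof -
    have e: "half_step k + x + 2 *\<^sub>R half_step k = real 3 *\<^sub>R half_step k + x"
      by (simp add: scaleR_left_distrib[of 1 2, simplified, symmetric] algebra_simps)
    show ?thesis
      using osc_half_period[OF I, of "half_step k + x" \<beta>] unfolding shift e by (simp add: f_def sin_add)
  qed
  have "?c / 2 \<le> \<bar>f 2 - f 0\<bar> \<or> ?c / 2 \<le> \<bar>f 3 - f 1\<bar>"
  proof -
    have *: "?c / 2 \<le> ?c * (2 * z - 1 / 3)" if "1 / 2 \<le> z" for z
    proof -
      have "?c * (1 / 2) \<le> ?c * (2 * z - 1 / 3)" using that by (intro mult_left_mono) auto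
      then show ?thesis by simp
    qed
    show ?thesis using abs_sin_or_cos_ge[of ?\<theta>] *[of "\<bar>sin ?\<theta>\<bar>"] *[of "\<bar>cos ?\<theta>\<bar>"] 0 1 by linarith
  qed
  then have "?c / 4 \<le> \<bar>f 0 - t\<bar> \<or> ?c / 4 \<le> \<bar>f 2 - t\<bar> \<or> ?c / 4 \<le> \<bar>f 1 - t\<bar> \<or> ?c / 4 \<le> \<bar>f 3 - t\<bar>"
    by linarith
  then show ?thesis unfolding f_def[symmetric]
    by (elim disjE) (rule exI[of _ 0], simp, rule exI[of _ 2], simp, rule exI[of _ 1], simp, rule exI[of _ 3], simp)
qed

text \<open>With \<tau> = pi / freq k, the pairs constructed in \<open>annulus_integral_ge\<close>
  have distances strictly between \<tau> and 9 \<tau> / 2. The outer factor 5 covers these and stays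
  below \<open>M\<close>.\<close>

definition annulus :: "nat \<Rightarrow> ((real^'n) \<times> (real^'n)) set" where
  "annulus k = {(x, y). pi / freq k < norm (x - y) \<and> norm (x - y) < 5 * (pi / freq k)}"

lemma annulus_borel [measurable]: "annulus k \<in> sets (borel \<Otimes>\<^sub>M borel)"
proof -
  have "annulus k = {z \<in> space (borel \<Otimes>\<^sub>M borel). pi / freq k < norm (fst z - snd z) \<and> norm (fst z - snd z) < 5 * (pi / freq k)}"
    by (auto simp: annulus_def space_pair_measure)
  also have "\<dots> \<in> sets (borel \<Otimes>\<^sub>M borel)" by measurable
  finally show ?thesis .
qed

lemma annulus_disjoint:
  assumes "j < k"
  shows "annulus j \<inter> annulus k = {}"
proof -
  have "5 * freq j \<le> real M * freq j" using M_ge by (intro mult_right_mono) auto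
  then have "5 * freq j \<le> freq k" using freq_less[OF assms] by linarith
  then have "5 * (pi / freq k) \<le> pi / freq j" by (simp add: field_simps)
  then show ?thesis by (auto simp: annulus_def)
qed

lemma sum_indicator_annulus_le_1: "finite I \<Longrightarrow> (\<Sum>k\<in>I. indicator (annulus k) z) \<le> (1::ennreal)"
proof -
  assume I: "finite I"
  show ?thesis
  proof (cases "\<exists>k\<in>I. z \<in> annulus k")
    case True
    then obtain k where k: "k \<in> I" "z \<in> annulus k" by blast
    then have "z \<notin> annulus j" if "j \<noteq> k" for j
      using that annulus_disjoint by (metis IntI empty_iff linorder_neqE_nat)
    with k have "indicator (annulus j) z = (if j = k then 1 else 0 :: ennreal)" for j
      by (simp add: indicator_def)
    then show ?thesis using I k by simp
  qed (auto intro!: order_trans[OF eq_refl[OF sum.neutral]])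
qed

text \<open>Instead of locating the points where the sine is large, one sums over four translates of
  \<open>x\<close>: for each \<open>x\<close> in the ball and each \<open>y\<close> within \<tau> of
  \<open>x - v 4\<close>, at least one translate differs from \<open>y\<close> by the required
  amount. Integrating the sum over \<open>x\<close> removes the dependence on which translate
  works.\<close>

lemma annulus_integral_ge:
  fixes \<Omega> :: "(real^'n) set"
  assumes \<Omega>: "open \<Omega>" "bounded \<Omega>" and c: "ball c (2 * r) \<subseteq> \<Omega>" and r: "5 * pi / \<omega> \<le> r"
    and q: "1 \<le> q" and \<sigma>: "0 < \<sigma>" and I: "finite I" "k \<in> I"
  defines "V \<equiv> unit_ball_vol (real CARD('n))"
  shows "ennreal (V * r powr real CARD('n) * V * (1 / 4) powr q / (4 * 5 powr (real CARD('n) + \<sigma> * q) * pi powr (\<sigma> * q))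
      * freq k powr ((\<sigma> - s) * q))
    \<le> (\<integral>\<^sup>+x. (\<integral>\<^sup>+y. ennreal (gagliardo_density \<sigma> q (osc I \<beta>) x y) * indicator (annulus k) (x, y) * indicator \<Omega> y \<partial>lborel) * indicator \<Omega> x \<partial>lborel)"
proof -
  let ?N = "real CARD('n)"
  \<comment> \<open>All restrictions are built in as indicators, so that \<open>D\<close> lives on
    the whole space and may be translated in \<open>x\<close>.\<close>
  define D where "D x y = ennreal (gagliardo_density \<sigma> q (osc I \<beta>) x y) * indicator (annulus k) (x, y) * indicator \<Omega> y * indicator \<Omega> x" for x y
  define \<tau> where "\<tau> = pi / freq k"
  have \<tau>: "0 < \<tau>" by (simp add: \<tau>_def)
  have V: "0 < V" by (simp add: V_def)
  have r0: "0 < r" using r \<omega> by (intro less_le_trans[OF _ r]) auto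
  have "\<tau> \<le> pi / \<omega>"
    unfolding \<tau>_def freq_def using \<omega> M_ge mult_left_mono[of 1 "real M ^ k" \<omega>] by (intro divide_left_mono) auto
  \<comment> \<open>The points \<open>v i + x\<close> and \<open>y\<close> lie at distance less than
    3 \<tau> from the ball of radius \<open>r\<close>, so this keeps them inside the ball of radius
    \<open>2 * r\<close>.\<close>
  then have \<tau>r: "5 * \<tau> \<le> r" using r by simp
  have [measurable]: "\<Omega> \<in> sets borel" using \<Omega> by simp
  have [measurable]: "(\<lambda>(x, y). D x y) \<in> borel_measurable (borel \<Otimes>\<^sub>M borel)"
    using gagliardo_density_measurable[OF osc_borel, of \<sigma> q I \<beta>] unfolding D_def by measurable
  define g where "g x = (\<integral>\<^sup>+y. D x y \<partial>lborel)" for x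
  have [measurable]: "g \<in> borel_measurable borel" unfolding g_def by measurable
  have g_eq: "g x = (\<integral>\<^sup>+y. ennreal (gagliardo_density \<sigma> q (osc I \<beta>) x y) * indicator (annulus k) (x, y) * indicator \<Omega> y \<partial>lborel) * indicator \<Omega> x" for x
    unfolding g_def D_def by (cases "x \<in> \<Omega>") auto
  define v where "v i = real i *\<^sub>R half_step k" for i :: nat
  define w where "w = (freq k powr (- s) / 4) powr q / (5 * \<tau>) powr (?N + \<sigma> * q)"
  have w: "0 \<le> w" by (simp add: w_def)
  have nv: "norm (v i + v 4) = (real i + 4) * \<tau> / 2" for i
  proof -
    have "v i + v 4 = (real i + 4) *\<^sub>R half_step k" by (simp add: v_def scaleR_left_distrib)
    then show ?thesis by (simp add: norm_half_step \<tau>_def)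
  qed
  have nvi: "norm (v i) = real i * \<tau> / 2" for i
    by (simp add: v_def norm_half_step \<tau>_def)
  have pt: "ennreal w \<le> (\<Sum>i<4. D (v i + x) y)" if x: "x \<in> ball c r" and y: "y \<in> ball (x - v 4) \<tau>" for x y
  proof -
    obtain i where i: "i < 4" "freq k powr (- s) / 4 \<le> \<bar>osc I \<beta> (v i + x) - osc I \<beta> y\<bar>"
      using osc_four_points[OF I, of \<beta> x "osc I \<beta> y"] unfolding v_def by blast
    have i3: "real i \<le> 3" using i(1) by simp
    have y': "norm (x - v 4 - y) < \<tau>" using y by (simp add: dist_norm)
    have e: "v i + x - y = (v i + v 4) + (x - v 4 - y)" by simp
    have "norm (v i + x - y) \<le> norm (v i + v 4) + norm (x - v 4 - y)"
      unfolding e by (rule norm_triangle_ineq)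
    also have "\<dots> < (real i + 4) * \<tau> / 2 + \<tau>" using y' unfolding nv by simp
    also have "\<dots> \<le> (3 + 4) * \<tau> / 2 + \<tau>" using i3 \<tau> by (intro add_mono divide_right_mono mult_right_mono) auto
    also have "\<dots> < 5 * \<tau>" using \<tau> by simp
    finally have up: "norm (v i + x - y) < 5 * \<tau>" .
    have "norm (v i + v 4) - norm (x - v 4 - y) \<le> norm (v i + x - y)"
      unfolding e by (rule norm_diff_ineq)
    moreover have "2 * \<tau> \<le> (real i + 4) * \<tau> / 2" using \<tau> by (simp add: algebra_simps)
    ultimately have low: "\<tau> < norm (v i + x - y)" using y' unfolding nv by linarith
    have xc: "norm (x - c) < r" using x by (simp add: dist_norm norm_minus_commute)
    have x\<Omega>: "v i + x \<in> \<Omega>"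
    proof (rule subsetD[OF c])
      have "norm (v i + x - c) \<le> norm (v i) + norm (x - c)"
        using norm_triangle_ineq[of "v i" "x - c"] by (simp add: algebra_simps)
      also have "norm (v i) \<le> 3 * \<tau> / 2" unfolding nvi using i3 \<tau> by simp
      finally show "v i + x \<in> ball c (2 * r)" using xc \<tau>r \<tau> by (simp add: dist_norm norm_minus_commute)
    qed
    have y\<Omega>: "y \<in> \<Omega>"
    proof (rule subsetD[OF c])
      have "norm (y - c) \<le> norm (x - c) + norm (v 4) + norm (x - v 4 - y)"
        using norm_triangle_ineq4[of "x - c - v 4" "x - v 4 - y"] norm_triangle_ineq4[of "x - c" "v 4"]
        by (simp add: algebra_simps)
      also have "norm (v 4) = 2 * \<tau>" unfolding nvi by simp
      finally show "y \<in> ball c (2 * r)" using xc y' \<tau>r \<tau> by (simp add: dist_norm norm_minus_commute)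
    qed
    have "(freq k powr (- s) / 4) powr q \<le> \<bar>osc I \<beta> (v i + x) - osc I \<beta> y\<bar> powr q"
      using i(2) q by (intro powr_mono2) auto
    moreover have "norm (v i + x - y) powr (?N + \<sigma> * q) \<le> (5 * \<tau>) powr (?N + \<sigma> * q)"
      using up q \<sigma> by (intro powr_mono2) auto
    moreover have "0 < norm (v i + x - y) powr (?N + \<sigma> * q)" using low \<tau> by auto
    ultimately have "w \<le> gagliardo_density \<sigma> q (osc I \<beta>) (v i + x) y"
      unfolding w_def gagliardo_density_def by (intro frac_le) auto
    then have "ennreal w \<le> D (v i + x) y"
      using x\<Omega> y\<Omega> up low unfolding D_def by (simp add: annulus_def \<tau>_def[symmetric] ennreal_leI)
    also have "\<dots> \<le> (\<Sum>i<4. D (v i + x) y)"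
      using i(1) by (intro member_le_sum) auto
    finally show ?thesis .
  qed
  have gx: "ennreal (w * (V * \<tau> powr ?N)) * indicator (ball c r) x \<le> (\<Sum>i<4. g (v i + x))" for x
  proof (cases "x \<in> ball c r")
    case True
    have "ennreal (w * (V * \<tau> powr ?N)) = ennreal w * emeasure lborel (ball (x - v 4) \<tau>)"
      using w V \<tau> by (simp add: emeasure_lborel_ball ennreal_mult V_def)
    also have "\<dots> = (\<integral>\<^sup>+y. ennreal w * indicator (ball (x - v 4) \<tau>) y \<partial>lborel)"
      by (intro nn_integral_cmult_indicator[symmetric]) simp
    also have "\<dots> \<le> (\<integral>\<^sup>+y. (\<Sum>i<4. D (v i + x) y) \<partial>lborel)"
      using pt[OF True] by (intro nn_integral_mono) (auto simp: indicator_def)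
    also have "\<dots> = (\<Sum>i<4. g (v i + x))"
      unfolding g_def by (intro nn_integral_sum) measurable
    finally show ?thesis using True by simp
  qed simp
  have "ennreal (w * (V * \<tau> powr ?N)) * ennreal (V * r powr ?N) = (\<integral>\<^sup>+x. ennreal (w * (V * \<tau> powr ?N)) * indicator (ball c r) x \<partial>lborel)"
    using r0 by (simp add: nn_integral_cmult_indicator emeasure_lborel_ball V_def)
  also have "\<dots> \<le> (\<integral>\<^sup>+x. (\<Sum>i<4. g (v i + x)) \<partial>lborel)"
    by (intro nn_integral_mono gx)
  also have "\<dots> = (\<Sum>i<4. \<integral>\<^sup>+x. g (v i + x) \<partial>lborel)"
    by (intro nn_integral_sum) measurable
  \<comment> \<open>Translation invariance makes the four integrals equal, whence the factor 1/4 in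
    the constant.\<close>
  also have "\<dots> = 4 * (\<integral>\<^sup>+x. g x \<partial>lborel)"
    by (simp add: nn_integral_shift)
  finally have "ennreal (1 / 4) * (ennreal (w * (V * \<tau> powr ?N)) * ennreal (V * r powr ?N)) \<le> ennreal (1 / 4) * (4 * (\<integral>\<^sup>+x. g x \<partial>lborel))"
    by (rule mult_left_mono) simp
  also have "\<dots> = (\<integral>\<^sup>+x. g x \<partial>lborel)"
  proof -
    have "ennreal (1 / 4) * 4 = 1"
      using ennreal_mult[of "1 / 4" 4] by simp
    then show ?thesis by (simp add: mult.assoc[symmetric])
  qed
  also have "ennreal (1 / 4) * (ennreal (w * (V * \<tau> powr ?N)) * ennreal (V * r powr ?N)) = ennreal (1 / 4 * (w * (V * \<tau> powr ?N) * (V * r powr ?N)))"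
    using w V ennreal_mult3[of "w * (V * \<tau> powr ?N)" "V * r powr ?N" "1 / 4"] by (simp add: mult.assoc)
  also have "1 / 4 * (w * (V * \<tau> powr ?N) * (V * r powr ?N)) =
      V * r powr ?N * V * (1 / 4) powr q / (4 * 5 powr (?N + \<sigma> * q) * pi powr (\<sigma> * q)) * freq k powr ((\<sigma> - s) * q)"
  proof -
    have 1: "(freq k powr (- s) / 4) powr q = freq k powr (- s * q) * (1 / 4) powr q"
      by (simp add: powr_divide powr_powr)
    have 2: "(5 * \<tau>) powr (?N + \<sigma> * q) = 5 powr (?N + \<sigma> * q) * (\<tau> powr ?N * \<tau> powr (\<sigma> * q))"
      using \<tau> by (simp add: powr_mult powr_add)
    have 3: "\<tau> powr (\<sigma> * q) = pi powr (\<sigma> * q) / freq k powr (\<sigma> * q)"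
      unfolding \<tau>_def by (simp add: powr_divide)
    have 4: "freq k powr ((\<sigma> - s) * q) = freq k powr (\<sigma> * q) * freq k powr (- s * q)"
      by (simp add: powr_add[symmetric] algebra_simps)
    show ?thesis unfolding w_def 1 2 3 4 using \<tau> by (simp add: field_simps)
  qed
  finally show ?thesis unfolding g_eq .
qed

text \<open>The annuli of different frequencies are disjoint, so the lower bounds for single
  frequencies add up inside one Gagliardo integral.\<close>

lemma osc_norm_lower:
  fixes \<Omega> :: "(real^'n) set"
  assumes \<Omega>: "open \<Omega>" "bounded \<Omega>" and c: "ball c (2 * r) \<subseteq> \<Omega>" and r: "5 * pi / \<omega> \<le> r"
    and q: "1 \<le> q" and \<sigma>: "0 < \<sigma>" "\<sigma> < 1"
  obtains C where "0 < C"
    "\<And>I \<beta>. finite I \<Longrightarrow> ennreal ((C * (\<Sum>k\<in>I. freq k powr ((\<sigma> - s) * q))) powr (1 / q)) \<le> W_norm \<Omega> \<sigma> (ereal q) (osc I \<beta>)"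
proof -
  define V where "V = unit_ball_vol (real CARD('n))"
  define e where "e = V * r powr real CARD('n) * V * (1 / 4) powr q / (4 * 5 powr (real CARD('n) + \<sigma> * q) * pi powr (\<sigma> * q))"
  have r0: "0 < r" using r \<omega> by (intro less_le_trans[OF _ r]) auto
  have e: "0 < e" using r0 by (simp add: e_def V_def)
  have K: "0 < sobolev_const CARD('n) \<sigma> q" using \<sigma> q by (intro sobolev_const_pos) auto
  have [measurable]: "\<Omega> \<in> sets borel" using \<Omega> by simp
  show ?thesis
  proof (rule that[of "sobolev_const CARD('n) \<sigma> q * e"])
    show "0 < sobolev_const CARD('n) \<sigma> q * e" using e K by simp
    fix I :: "nat set" and \<beta> assume I: "finite I"
    define D where "D x y = ennreal (gagliardo_density \<sigma> q (osc I \<beta>) x y)" for x y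
    have [measurable]: "(\<lambda>(x, y). D x y) \<in> borel_measurable (borel \<Otimes>\<^sub>M borel)"
      unfolding D_def by (rule gagliardo_density_measurable[OF osc_borel])
    have "ennreal (e * (\<Sum>k\<in>I. freq k powr ((\<sigma> - s) * q))) = (\<Sum>k\<in>I. ennreal (e * freq k powr ((\<sigma> - s) * q)))"
      using e by (subst sum_ennreal) (auto simp: sum_distrib_left)
    also have "\<dots> \<le> (\<Sum>k\<in>I. \<integral>\<^sup>+x. (\<integral>\<^sup>+y. D x y * indicator (annulus k) (x, y) * indicator \<Omega> y \<partial>lborel) * indicator \<Omega> x \<partial>lborel)"
      unfolding e_def V_def D_def using I
      by (intro sum_mono annulus_integral_ge[OF \<Omega> c r q \<sigma>(1)]) auto
    also have "\<dots> = (\<integral>\<^sup>+x. (\<integral>\<^sup>+y. D x y * (\<Sum>k\<in>I. indicator (annulus k) (x, y)) * indicator \<Omega> y \<partial>lborel) * indicator \<Omega> x \<partial>lborel)"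
    proof -
      have "(\<integral>\<^sup>+y. D x y * (\<Sum>k\<in>I. indicator (annulus k) (x, y)) * indicator \<Omega> y \<partial>lborel) =
          (\<Sum>k\<in>I. \<integral>\<^sup>+y. D x y * indicator (annulus k) (x, y) * indicator \<Omega> y \<partial>lborel)" for x
        by (subst nn_integral_sum[symmetric]) (auto simp: sum_distrib_left sum_distrib_right)
      then show ?thesis
        by (subst nn_integral_sum[symmetric]) (auto simp: sum_distrib_right)
    qed
    also have "\<dots> \<le> (\<integral>\<^sup>+x. (\<integral>\<^sup>+y. D x y * 1 * indicator \<Omega> y \<partial>lborel) * indicator \<Omega> x \<partial>lborel)"
      by (intro nn_integral_mono mult_mono sum_indicator_annulus_le_1[OF I]) auto
    also have "\<dots> = gagliardo \<Omega> \<sigma> q (osc I \<beta>)"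
      using \<Omega> by (subst gagliardo_eq_lborel[OF _ _ osc_borel]) (auto simp: D_def)
    finally have "ennreal ((sobolev_const CARD('n) \<sigma> q * (e * (\<Sum>k\<in>I. freq k powr ((\<sigma> - s) * q)))) powr (1 / q)) \<le> W_norm \<Omega> \<sigma> (ereal q) (osc I \<beta>)"
      using \<sigma> q e by (intro W_norm_ge_fractional mult_nonneg_nonneg sum_nonneg) auto
    then show "ennreal ((sobolev_const CARD('n) \<sigma> q * e * (\<Sum>k\<in>I. freq k powr ((\<sigma> - s) * q))) powr (1 / q)) \<le> W_norm \<Omega> \<sigma> (ereal q) (osc I \<beta>)"
      by (simp add: mult.assoc)
  qed
qed

end

subsection \<open>Consequences of an embedding\<close>

lemma ex_lacunary:
  assumes "0 < s" "s < 1" "1 \<le> \<omega>"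
  shows "\<exists>M. lacunary s \<omega> M"
proof -
  \<comment> \<open>\<open>M = 2 * m\<close> is even; the three lower bounds for \<open>m\<close>
    yield \<open>6 \<le> M\<close> and the two power conditions of the locale.\<close>
  obtain m where m: "max 3 (max (2 powr (1 / s)) (20 powr (1 / (1 - s)))) \<le> real m"
    using real_arch_simple by blast
  have le: "c \<le> real (2 * m) powr a" if "0 < a" "0 < c" "c powr (1 / a) \<le> real m" for a c
  proof -
    have "c = (c powr (1 / a)) powr a" using that by (simp add: powr_powr)
    also have "\<dots> \<le> real (2 * m) powr a" using that by (intro powr_mono2) auto
    finally show ?thesis .
  qed
  have "lacunary s \<omega> (2 * m)"
    using assms m le[of s 2] le[of "1 - s" 20] by unfold_locales auto
  then show ?thesis by blast
qed

lemma powr_le_imp_le: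
  fixes a b x :: real
  assumes "0 < c" "0 < C" "0 < x" "b < a" "c * x powr a \<le> C * x powr b"
  shows "x \<le> (C / c) powr (1 / (a - b))"
proof -
  have "c * x powr a = c * (x powr (a - b) * x powr b)" by (simp add: powr_add[symmetric])
  then have "c * x powr (a - b) * x powr b \<le> C * x powr b" using assms(5) unfolding mult.assoc by linarith
  then have "c * x powr (a - b) \<le> C" using assms by (simp add: mult_le_cancel_right)
  then have "x powr (a - b) \<le> C / c" using assms by (simp add: field_simps)
  then have "(x powr (a - b)) powr (1 / (a - b)) \<le> (C / c) powr (1 / (a - b))"
    using assms by (intro powr_mono2) auto
  then show ?thesis using assms by (simp add: powr_powr)
qed

section \<open>Hoelder seminorms and almost everywhere equality\<close>

lemma AE_lebesgue_on_open_closure: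
  fixes \<Omega> :: "'a::euclidean_space set"
  assumes "open \<Omega>" "AE x in lebesgue_on \<Omega>. P x" "x \<in> \<Omega>"
  shows "x \<in> closure {x \<in> \<Omega>. P x}"
proof (rule ccontr)
  assume x: "x \<notin> closure {x \<in> \<Omega>. P x}"
  let ?S = "\<Omega> - closure {x \<in> \<Omega>. P x}"
  have "AE x in lebesgue. x \<in> \<Omega> \<longrightarrow> P x"
    using assms by (simp add: AE_restrict_space_iff)
  then obtain N where N: "{x. \<not> (x \<in> \<Omega> \<longrightarrow> P x)} \<subseteq> N" "N \<in> null_sets lebesgue"
    unfolding eventually_ae_filter by auto
  \<comment> \<open>A point of \<Omega> off the closure would give a nonempty open set inside a null
    set.\<close>
  have "?S \<subseteq> N" using N(1) closure_subset[of "{x \<in> \<Omega>. P x}"] by blast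
  then have "negligible ?S" using N(2) negligible_iff_null_sets negligible_subset by blast
  moreover have "open ?S" using assms by (intro open_Diff) auto
  ultimately show False using open_not_negligible[of ?S] x assms by blast
qed

text \<open>The set where \<open>v\<close> agrees with \<open>u\<close> is dense in \<Omega>, so the
  inequality for \<open>v\<close> passes to the limit along points of that set by continuity of
  \<open>u\<close>.\<close>

lemma Hoelder_continuous_representative:
  fixes u v :: "real^'n \<Rightarrow> real"
  assumes \<Omega>: "open \<Omega>" and u: "continuous_on UNIV u" and v: "AE x in lebesgue_on \<Omega>. v x = u x"
    and le: "\<And>x y. x \<in> \<Omega> \<Longrightarrow> y \<in> \<Omega> \<Longrightarrow> x \<noteq> y \<Longrightarrow> \<bar>v x - v y\<bar> \<le> h * norm (x - y) powr \<sigma>"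
    and xy: "x \<in> \<Omega>" "y \<in> \<Omega>" "x \<noteq> y"
  shows "\<bar>u x - u y\<bar> \<le> h * norm (x - y) powr \<sigma>"
proof -
  obtain X where X: "\<And>n. X n \<in> \<Omega> \<and> v (X n) = u (X n)" "X \<longlonglongrightarrow> x"
    using AE_lebesgue_on_open_closure[OF \<Omega> v xy(1)] unfolding closure_sequential by auto
  obtain Y where Y: "\<And>n. Y n \<in> \<Omega> \<and> v (Y n) = u (Y n)" "Y \<longlonglongrightarrow> y"
    using AE_lebesgue_on_open_closure[OF \<Omega> v xy(2)] unfolding closure_sequential by auto
  have iso: "isCont u z" for z using u by (simp add: continuous_on_eq_continuous_at)
  have "(\<lambda>n. \<bar>u (X n) - u (Y n)\<bar>) \<longlonglongrightarrow> \<bar>u x - u y\<bar>"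
    by (intro tendsto_intros isCont_tendsto_compose[OF iso] X(2) Y(2))
  moreover have "(\<lambda>n. h * norm (X n - Y n) powr \<sigma>) \<longlonglongrightarrow> h * norm (x - y) powr \<sigma>"
    using xy by (intro tendsto_intros X(2) Y(2)) simp
  moreover have "\<forall>\<^sub>F n in sequentially. \<bar>u (X n) - u (Y n)\<bar> \<le> h * norm (X n - Y n) powr \<sigma>"
  proof -
    have "(\<lambda>n. norm (X n - Y n)) \<longlonglongrightarrow> norm (x - y)" by (intro tendsto_intros X(2) Y(2))
    moreover have "0 < norm (x - y)" using xy by simp
    ultimately have "\<forall>\<^sub>F n in sequentially. 0 < norm (X n - Y n)" by (rule order_tendstoD)
    then show ?thesis
    proof (rule eventually_mono)
      fix n assume "0 < norm (X n - Y n)"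
      then show "\<bar>u (X n) - u (Y n)\<bar> \<le> h * norm (X n - Y n) powr \<sigma>"
        using le[of "X n" "Y n"] X(1)[of n] Y(1)[of n] by auto
    qed
  qed
  ultimately show ?thesis by (intro tendsto_le[OF sequentially_bot]) auto
qed

text \<open>The seminorm is an infimum over representatives. None can beat the continuous one, so
  any single difference quotient of \<open>u\<close> is a lower bound.\<close>

lemma W_seminorm_Hoelder_ge:
  fixes u :: "real^'n \<Rightarrow> real"
  assumes \<Omega>: "open \<Omega>" and u: "continuous_on UNIV u" and \<sigma>: "0 < \<sigma>"
    and xy: "x \<in> \<Omega>" "y \<in> \<Omega>" "x \<noteq> y"
  shows "ennreal (\<bar>u x - u y\<bar> / norm (x - y) powr \<sigma>) \<le> W_seminorm \<Omega> \<sigma> \<infinity> u"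
proof -
  have "ennreal (\<bar>u x - u y\<bar> / norm (x - y) powr \<sigma>) \<le>
      (SUP (x, y) \<in> {(x, y). x \<in> \<Omega> \<and> y \<in> \<Omega> \<and> x \<noteq> y}. ennreal (\<bar>v x - v y\<bar> / norm (x - y) powr \<sigma>))"
    (is "_ \<le> ?H") if v: "AE x in lebesgue_on \<Omega>. v x = u x" for v
  proof (cases ?H)
    case (real h)
    have "\<bar>v x - v y\<bar> \<le> h * norm (x - y) powr \<sigma>" if that: "x \<in> \<Omega>" "y \<in> \<Omega>" "x \<noteq> y" for x y
    proof -
      have "ennreal (\<bar>v x - v y\<bar> / norm (x - y) powr \<sigma>) \<le> ?H"
        using that by (intro SUP_upper2[of "(x, y)"]) auto
      then have "\<bar>v x - v y\<bar> / norm (x - y) powr \<sigma> \<le> h"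
        using real by (simp add: ennreal_le_iff)
      then show ?thesis using that by (simp add: pos_divide_le_eq)
    qed
    from Hoelder_continuous_representative[OF \<Omega> u v this xy] have "\<bar>u x - u y\<bar> / norm (x - y) powr \<sigma> \<le> h"
      using xy by (simp add: pos_divide_le_eq)
    then show ?thesis using real by (simp add: ennreal_leI)
  next
    case top
    show ?thesis unfolding top by simp
  qed
  then show ?thesis using \<sigma> unfolding W_seminorm_def by (simp add: le_INF_iff)
qed

section \<open>Embeddings refuted by growing frequencies or growing numbers of frequencies\<close>

context lacunary
begin

lemma freq_ge: "real k \<le> freq k"
proof -
  have "k < 2 ^ k" by (rule less_exp)
  also have "2 ^ k \<le> M ^ k" using M_ge by (intro power_mono) auto
  finally have "real k \<le> real M ^ k" by (simp flip: of_nat_power)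
  then show ?thesis using mult_mono[OF \<omega>, of "real k" "real M ^ k"] \<omega> by (simp add: freq_def)
qed

lemma W_embedded_oscillation:
  fixes \<Omega> :: "(real^'n) set"
  assumes \<Omega>: "open \<Omega>" "bounded \<Omega>" and c: "ball c (2 * r) \<subseteq> \<Omega>" and r: "5 * pi / \<omega> \<le> r"
    and p: "1 \<le> p" and q: "1 \<le> q" and \<sigma>: "s \<le> \<sigma>" "\<sigma> < 1"
    and emb: "W_embedded \<Omega> s (ereal p) \<sigma> (ereal q)"
  shows "\<sigma> = s \<and> p \<le> q"
proof -
  have \<sigma>0: "0 < \<sigma>" using s \<sigma> by simp
  obtain C where C: "0 < C"
    "\<And>I \<beta>. finite I \<Longrightarrow> I \<noteq> {} \<Longrightarrow> W_norm \<Omega> s (ereal p) (osc I \<beta>) \<le> ennreal (C * real (card I) powr (1 / p))"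
    by (rule osc_norm_upper[OF p \<Omega>]) blast
  obtain D where D: "0 < D"
    "\<And>I \<beta>. finite I \<Longrightarrow> ennreal ((D * (\<Sum>k\<in>I. freq k powr ((\<sigma> - s) * q))) powr (1 / q)) \<le> W_norm \<Omega> \<sigma> (ereal q) (osc I \<beta>)"
    by (rule osc_norm_lower[OF \<Omega> c r q \<sigma>0 \<sigma>(2)]) blast
  obtain E where E: "0 < E" "\<And>u a b. u \<in> borel_measurable (lebesgue_on \<Omega>) \<Longrightarrow> W_norm \<Omega> s (ereal p) u \<le> ennreal b \<Longrightarrow> 0 \<le> b
      \<Longrightarrow> ennreal a \<le> W_norm \<Omega> \<sigma> (ereal q) u \<Longrightarrow> a \<le> E * b"
    by (rule W_embeddedE[OF emb]) blast
  have main: "D powr (1 / q) * (\<Sum>k\<in>I. freq k powr ((\<sigma> - s) * q)) powr (1 / q) \<le> E * C * real (card I) powr (1 / p)"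
    if I: "finite I" "I \<noteq> {}" for I
  proof -
    have "(D * (\<Sum>k\<in>I. freq k powr ((\<sigma> - s) * q))) powr (1 / q) \<le> E * (C * real (card I) powr (1 / p))"
      using C D I by (intro E(2)[OF borel_measurable_lebesgue_on[OF osc_borel]]) auto
    then show ?thesis using D by (simp add: powr_mult mult.assoc)
  qed
  have "\<sigma> = s"
  proof (rule ccontr)
    assume "\<sigma> \<noteq> s"
    with \<sigma> have ls: "0 < \<sigma> - s" by simp
    \<comment> \<open>The \<open>- 0\<close> is the exponent \<open>b = 0\<close> of
      \<open>powr_le_imp_le\<close>: the bound \<open>E * C\<close> is read as a multiple of
      \<open>freq k powr 0\<close>.\<close>
    have "real k \<le> (E * C / D powr (1 / q)) powr (1 / (\<sigma> - s - 0))" for k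
    proof -
      have "D powr (1 / q) * freq k powr (\<sigma> - s) \<le> E * C * freq k powr 0"
        using main[of "{k}"] q by (simp add: powr_powr)
      then have "freq k \<le> (E * C / D powr (1 / q)) powr (1 / (\<sigma> - s - 0))"
        using C D E ls by (intro powr_le_imp_le) auto
      then show ?thesis using freq_ge[of k] by linarith
    qed
    moreover obtain K where "(E * C / D powr (1 / q)) powr (1 / (\<sigma> - s - 0)) < real K"
      using reals_Archimedean2 by blast
    ultimately have "real K < real K" by (rule le_less_trans)
    then show False by simp
  qed
  moreover have "p \<le> q"
  proof (rule ccontr)
    assume "\<not> p \<le> q"
    then have pq: "1 / p < 1 / q" using p q by (simp add: field_simps)
    \<comment> \<open>For \<open>\<sigma> = s\<close> every summand equals 1, and
      \<open>{..K}\<close> has \<open>Suc K\<close> elements; only the exponents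
      \<open>1 / q\<close> and \<open>1 / p\<close> are left to compare.\<close>
    have "real (Suc K) \<le> (E * C / D powr (1 / q)) powr (1 / (1 / q - 1 / p))" for K
    proof (rule powr_le_imp_le)
      show "D powr (1 / q) * real (Suc K) powr (1 / q) \<le> E * C * real (Suc K) powr (1 / p)"
        using main[of "{..K}"] \<open>\<sigma> = s\<close> by simp
    qed (use C D E pq in auto)
    moreover obtain K where "(E * C / D powr (1 / q)) powr (1 / (1 / q - 1 / p)) < real K"
      using reals_Archimedean2 by blast
    ultimately have "real (Suc K) < real K" by (rule le_less_trans)
    then show False by simp
  qed
  ultimately show ?thesis by simp
qed

text \<open>For \<open>u = a\<^sup>-\<^sup>s sin (a x)\<close>, \<open>v = a\<^sup>-\<^sup>s cos (a x)\<close> and a bump \<open>\<eta>\<close>, testing \<open>u\<close> with \<open>\<eta> cos (a x)\<close> and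
  \<open>v\<close> with \<open>\<eta> sin (a x)\<close> produces terms with derivatives of \<open>\<eta>\<close> that cancel; what remains is
  \<open>a\<^sup>1\<^sup>-\<^sup>s \<integral> \<eta>\<close>.\<close>

lemma not_W_embedded_first_order:
  fixes \<Omega> :: "(real^'n) set"
  assumes \<Omega>: "open \<Omega>" "bounded \<Omega>" "\<Omega> \<noteq> {}" and p: "1 \<le> p" and q: "1 \<le> q"
  shows "\<not> W_embedded \<Omega> s (ereal p) 1 (ereal q)"
proof
  assume emb: "W_embedded \<Omega> s (ereal p) 1 (ereal q)"
  obtain c r where r: "0 < r" "cball c r \<subseteq> \<Omega>"
    using \<Omega> by (meson all_not_in_conv open_contains_cball)
  have sets: "\<Omega> \<in> sets borel" using \<Omega> by simp
  obtain C where C: "0 < C"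
    "\<And>I \<beta>. finite I \<Longrightarrow> I \<noteq> {} \<Longrightarrow> W_norm \<Omega> s (ereal p) (osc I \<beta>) \<le> ennreal (C * real (card I) powr (1 / p))"
    by (rule osc_norm_upper[OF p \<Omega>(1,2)]) blast
  obtain E where E: "0 < E" "\<And>u a b. u \<in> borel_measurable (lebesgue_on \<Omega>) \<Longrightarrow> W_norm \<Omega> s (ereal p) u \<le> ennreal b \<Longrightarrow> 0 \<le> b
      \<Longrightarrow> ennreal a \<le> W_norm \<Omega> 1 (ereal q) u \<Longrightarrow> a \<le> E * b"
    by (rule W_embeddedE[OF emb]) blast
  let ?\<eta> = "bump c r"
  have t\<eta>: "test_function \<Omega> ?\<eta>" using r by (rule test_function_bump)
  define H where "H = (\<integral>x. ?\<eta> x \<partial>lborel)"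
  have int\<eta>: "integrable lborel ?\<eta>" using integrable_test_function(1)[OF t\<eta>, of "\<lambda>_. 1"] by simp
  have H: "0 < H"
  proof -
    have "0 < exp (- (4 / 3)) * measure lborel (ball c (r / 2))"
      using r by (intro mult_pos_pos) (auto simp: measure_def emeasure_lborel_ball)
    also have "\<dots> = (\<integral>x. exp (- (4 / 3)) * indicator (ball c (r / 2)) x \<partial>lborel)" by simp
    also have "\<dots> \<le> H" unfolding H_def
    proof (rule integral_mono[OF _ int\<eta>])
      show "integrable lborel (\<lambda>x. exp (- (4 / 3)) * indicator (ball c (r / 2)) x :: real)"
        using emeasure_bounded_finite[of "ball c (r / 2)"]
        by (intro integrable_mult_right integrable_real_indicator) auto
      show "exp (- (4 / 3)) * indicator (ball c (r / 2)) x \<le> ?\<eta> x" for x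
        using bump_ge[OF r(1), of x c] bump_nonneg[of c r x] by (cases "x \<in> ball c (r / 2)") auto
    qed
    finally show ?thesis .
  qed
  define \<mu> where "\<mu> = measure lborel (ball c r)"
  have \<mu>: "emeasure lborel (ball c r) = ennreal \<mu>" "0 \<le> \<mu>"
    using emeasure_bounded_finite[of "ball c r"] by (auto simp: \<mu>_def emeasure_eq_ennreal_measure)
  have bound: "freq k powr (1 - s) * H / 2 - \<mu> \<le> (E * C) powr q" for k
  proof -
    define a where "a = freq k"
    have a: "0 < a" by (simp add: a_def)
    define \<phi> where "\<phi> b x = ?\<eta> x * sin (a * x $ i0 + b)" for b x
    have t\<phi>: "test_function \<Omega> (\<phi> b)" for b
      unfolding \<phi>_def using r by (intro test_function_bump_mult Ck_sin_nth)
    have \<phi>1: "\<bar>\<phi> b x\<bar> \<le> indicator (ball c r) x" for b x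
    proof (cases "x \<in> ball c r")
      case True
      have "\<bar>\<phi> b x\<bar> \<le> 1 * 1" unfolding \<phi>_def abs_mult
        using bump_le_1[of c r x] bump_nonneg[of c r x] by (intro mult_mono abs_sin_le_one) auto
      then show ?thesis using True by simp
    next
      case False
      then show ?thesis using bump_eq_0[OF r(1) False] by (simp add: \<phi>_def)
    qed
    have d\<phi>: "partial_deriv i0 (\<phi> b) x = ?\<eta> x * (a * cos (a * x $ i0 + b)) + bump_deriv c r x $ i0 * sin (a * x $ i0 + b)" for b x
      unfolding \<phi>_def[abs_def]
      using partial_deriv_eq[OF has_derivative_mult[OF bump_has_derivative[of c r x] has_derivative_sin_nth[of a i0 b x]], of i0]
      by (simp add: inner_axis mult_ac)
    define T where "T b b' = (LINT x|lebesgue_on \<Omega>. osc {k} b x * partial_deriv i0 (\<phi> b') x)" for b b'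
    have T: "T b b' = (\<integral>x. osc {k} b x * partial_deriv i0 (\<phi> b') x \<partial>lborel)" for b b'
      unfolding T_def
    proof (rule integral_lebesgue_on_eq_lborel[OF sets])
      show "(\<lambda>x. osc {k} b x * partial_deriv i0 (\<phi> b') x) \<in> borel_measurable borel"
        using test_function_borel(2)[OF t\<phi>] by measurable
      show "osc {k} b x * partial_deriv i0 (\<phi> b') x = 0" if "x \<notin> \<Omega>" for x
        using test_function_support[OF t\<phi>[of b']] that by (metis mult_zero_right subsetD)
    qed
    have "T (pi / 2) 0 - T 0 (pi / 2) =
        (\<integral>x. osc {k} (pi / 2) x * partial_deriv i0 (\<phi> 0) x - osc {k} 0 x * partial_deriv i0 (\<phi> (pi / 2)) x \<partial>lborel)"
      unfolding T by (intro Bochner_Integration.integral_diff[symmetric] integrable_test_function(2)[OF t\<phi> continuous_osc])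
    also have "\<dots> = (\<integral>x. a powr (1 - s) * ?\<eta> x \<partial>lborel)"
    proof (intro Bochner_Integration.integral_cong refl)
      fix x
      let ?S = "sin (a * x $ i0)" and ?C = "cos (a * x $ i0)" and ?b = "bump_deriv c r x $ i0"
      have sc: "sin (a * x $ i0 + pi / 2) = ?C" "cos (a * x $ i0 + pi / 2) = - ?S"
        by (simp_all add: sin_add cos_add)
      have "osc {k} (pi / 2) x * partial_deriv i0 (\<phi> 0) x - osc {k} 0 x * partial_deriv i0 (\<phi> (pi / 2)) x
        = a powr (- s) * ?C * (?\<eta> x * (a * ?C) + ?b * ?S) - a powr (- s) * ?S * (?\<eta> x * (a * (- ?S)) + ?b * ?C)"
        unfolding d\<phi> sc osc_def by (simp add: a_def[symmetric] sc)
      also have "\<dots> = a powr (- s) * a * ?\<eta> x * (?S\<^sup>2 + ?C\<^sup>2)"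
        by algebra
      also have "a powr (- s) * a = a powr (1 - s)"
        using a by (simp add: powr_diff powr_minus divide_inverse)
      finally show "osc {k} (pi / 2) x * partial_deriv i0 (\<phi> 0) x - osc {k} 0 x * partial_deriv i0 (\<phi> (pi / 2)) x
        = a powr (1 - s) * ?\<eta> x" by simp
    qed
    also have "\<dots> = a powr (1 - s) * H" by (simp add: H_def)
    \<comment> \<open>Which of the two pairings is large may depend on \<open>k\<close>. This is
      harmless, as the upper norm bound is uniform in the phase.\<close>
    finally have "a powr (1 - s) * H / 2 \<le> \<bar>T (pi / 2) 0\<bar> \<or> a powr (1 - s) * H / 2 \<le> \<bar>T 0 (pi / 2)\<bar>" by linarith
    then obtain b b' where b: "a powr (1 - s) * H / 2 \<le> \<bar>T b b'\<bar>" by blast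
    \<comment> \<open>Truncation at 0 because \<open>W_norm_one_ge\<close> asks for a nonnegative
      bound, while the difference may be negative for small frequencies.\<close>
    define G where "G = max 0 (a powr (1 - s) * H / 2 - \<mu>)"
    have "ennreal (G powr (1 / q)) \<le> W_norm \<Omega> 1 (ereal q) (osc {k} b)"
    proof (rule W_norm_one_ge[OF q])
      show "0 \<le> G" by (simp add: G_def)
      fix g assume g: "weak_gradient \<Omega> (osc {k} b) g"
      \<comment> \<open>The threshold \<open>m = 1\<close> is enough: its cost \<open>\<mu>\<close>
        is fixed, whereas the main term grows with the frequency.\<close>
      have "ennreal (1 powr (q - 1) * (a powr (1 - s) * H / 2 - 1 * \<mu>)) \<le> Lp_integral (lebesgue_on \<Omega>) q g"
        by (rule weak_gradient_lower_bound[OF g t\<phi> _ \<mu> sets \<phi>1 q _ b[unfolded T_def]]) auto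
      then show "ennreal G \<le> Lp_integral (lebesgue_on \<Omega>) q g"
        by (auto simp: G_def max_def ennreal_neg)
    qed
    then have "G powr (1 / q) \<le> E * (C * real (card {k}) powr (1 / p))"
      using C(1) by (intro E(2)[OF borel_measurable_lebesgue_on[OF osc_borel] C(2)]) auto
    then have "(G powr (1 / q)) powr q \<le> (E * C) powr q"
      using q by (intro powr_mono2) auto
    then have "G \<le> (E * C) powr q" using q by (simp add: powr_powr G_def)
    then show ?thesis by (simp add: G_def a_def)
  qed
  define B where "B = ((E * C) powr q + \<mu>) * 2 / H"
  have B: "0 < B" unfolding B_def using H C E \<mu> by (intro divide_pos_pos mult_pos_pos add_pos_nonneg) auto
  have "real k \<le> B powr (1 / (1 - s))" for k
  proof -
    have "freq k powr (1 - s) \<le> B" using bound[of k] H by (simp add: B_def field_simps)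
    then have "freq k \<le> (B / 1) powr (1 / (1 - s - 0))"
      using B s by (intro powr_le_imp_le) auto
    then show ?thesis using freq_ge[of k] by simp
  qed
  moreover obtain K where "B powr (1 / (1 - s)) < real K"
    using reals_Archimedean2 by blast
  ultimately have "real K < real K" by (rule le_less_trans)
  then show False by simp
qed

text \<open>One frequency suffices: among five points inside \<Omega>, two at distance at most 5 pi
  / freq k have values differing by \<open>freq k powr (- s) / 4\<close>, so the Hoelder quotient of
  order \<open>\<sigma>\<close> grows like \<open>freq k powr (\<sigma> - s)\<close>.\<close>

lemma not_W_embedded_Hoelder:
  fixes \<Omega> :: "(real^'n) set"
  assumes \<Omega>: "open \<Omega>" "bounded \<Omega>" and c: "ball c (2 * r) \<subseteq> \<Omega>" and r: "5 * pi / \<omega> \<le> r"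
    and p: "1 \<le> p" and \<sigma>: "s < \<sigma>"
  shows "\<not> W_embedded \<Omega> s (ereal p) \<sigma> \<infinity>"
proof
  assume emb: "W_embedded \<Omega> s (ereal p) \<sigma> \<infinity>"
  have \<sigma>0: "0 < \<sigma>" using s \<sigma> by simp
  have r0: "0 < r" using r \<omega> by (intro less_le_trans[OF _ r]) auto
  obtain C where C: "0 < C"
    "\<And>I \<beta>. finite I \<Longrightarrow> I \<noteq> {} \<Longrightarrow> W_norm \<Omega> s (ereal p) (osc I \<beta>) \<le> ennreal (C * real (card I) powr (1 / p))"
    by (rule osc_norm_upper[OF p \<Omega>]) blast
  obtain E where E: "0 < E" "\<And>u a b. u \<in> borel_measurable (lebesgue_on \<Omega>) \<Longrightarrow> W_norm \<Omega> s (ereal p) u \<le> ennreal b \<Longrightarrow> 0 \<le> b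
      \<Longrightarrow> ennreal a \<le> W_norm \<Omega> \<sigma> \<infinity> u \<Longrightarrow> a \<le> E * b"
    by (rule W_embeddedE[OF emb]) blast
  define D where "D = 1 / (4 * (5 * pi) powr \<sigma>)"
  have D: "0 < D" by (simp add: D_def)
  have "real k \<le> (E * C / D) powr (1 / (\<sigma> - s - 0))" for k
  proof -
    define \<tau> where "\<tau> = pi / freq k"
    have \<tau>: "0 < \<tau>" by (simp add: \<tau>_def)
    have "\<tau> \<le> pi / \<omega>"
      unfolding \<tau>_def freq_def using \<omega> M_ge mult_left_mono[of 1 "real M ^ k" \<omega>] by (intro divide_left_mono) auto
    then have \<tau>r: "5 * \<tau> \<le> r" using r by simp
    \<comment> \<open>Placed four steps behind \<open>c\<close> so that it differs from each of the
      four candidates for \<open>x\<close>.\<close>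
    define y where "y = c - 4 *\<^sub>R half_step k"
    obtain i where i: "i < 4" "freq k powr (- s) / 4 \<le> \<bar>osc {k} 0 (real i *\<^sub>R half_step k + c) - osc {k} 0 y\<bar>"
      using osc_four_points[of "{k}" k 0 c "osc {k} 0 y"] by auto
    define x where "x = real i *\<^sub>R half_step k + c"
    have i3: "real i \<le> 3" using i(1) by simp
    have "x - y = (real i + 4) *\<^sub>R half_step k" by (simp add: x_def y_def scaleR_left_distrib)
    then have xy: "norm (x - y) = (real i + 4) * \<tau> / 2" by (simp add: norm_half_step \<tau>_def)
    have xy5: "norm (x - y) \<le> 5 * \<tau>"
      unfolding xy using i3 \<tau> mult_right_mono[of "real i + 4" 7 \<tau>] by simp
    have ne: "x \<noteq> y" using xy \<tau> by auto
    have "norm (x - c) = real i * \<tau> / 2" by (simp add: x_def norm_half_step \<tau>_def)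
    then have "norm (x - c) < 2 * r" using i3 \<tau> \<tau>r mult_right_mono[of "real i" 3 \<tau>] by linarith
    moreover have "norm (y - c) < 2 * r"
    proof -
      have "norm (y - c) = 2 * \<tau>" by (simp add: y_def norm_half_step \<tau>_def)
      then show ?thesis using \<tau> \<tau>r by linarith
    qed
    ultimately have mem: "x \<in> \<Omega>" "y \<in> \<Omega>"
      using c by (auto simp: subset_iff dist_norm norm_minus_commute)
    have "ennreal (D * freq k powr (\<sigma> - s)) \<le> W_seminorm \<Omega> \<sigma> \<infinity> (osc {k} 0)"
    proof -
      have "D * freq k powr (\<sigma> - s) = freq k powr (- s) / 4 / (5 * \<tau>) powr \<sigma>"
        using freq_pos[of k] by (simp add: D_def \<tau>_def powr_mult powr_divide powr_diff powr_minus field_simps)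
      also have "\<dots> \<le> \<bar>osc {k} 0 x - osc {k} 0 y\<bar> / norm (x - y) powr \<sigma>"
        using i(2) xy5 ne \<sigma>0 unfolding x_def[symmetric] by (intro frac_le powr_mono2) auto
      finally have "ennreal (D * freq k powr (\<sigma> - s)) \<le> ennreal (\<bar>osc {k} 0 x - osc {k} 0 y\<bar> / norm (x - y) powr \<sigma>)"
        by (rule ennreal_leI)
      also have "\<dots> \<le> W_seminorm \<Omega> \<sigma> \<infinity> (osc {k} 0)"
        by (rule W_seminorm_Hoelder_ge[OF \<Omega>(1) continuous_osc \<sigma>0 mem ne])
      finally show ?thesis .
    qed
    also have "\<dots> \<le> W_norm \<Omega> \<sigma> \<infinity> (osc {k} 0)"
      using \<sigma>0 by (simp add: W_norm_def)
    finally have "D * freq k powr (\<sigma> - s) \<le> E * (C * real (card {k}) powr (1 / p))"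
      using C(1) by (intro E(2)[OF borel_measurable_lebesgue_on[OF osc_borel] C(2)]) auto
    then have "freq k \<le> (E * C / D) powr (1 / (\<sigma> - s - 0))"
      using C D E \<sigma> by (intro powr_le_imp_le) auto
    then show ?thesis using freq_ge[of k] by linarith
  qed
  moreover obtain K where "(E * C / D) powr (1 / (\<sigma> - s - 0)) < real K"
    using reals_Archimedean2 by blast
  ultimately have "real K < real K" by (rule le_less_trans)
  then show False by simp
qed

end

text \<open>Every target norm with exponent \<infinity> dominates the L^infinity norm, which on a
  set of finite measure dominates each L^q norm. This makes \<open>W_embedded_scaling\<close>,
  stated for finite exponents, applicable to \<open>p' = \<infinity>\<close>.\<close>

lemma W_embedded_bounded_imp_Lp:
  fixes \<Omega> :: "(real^'n) set"
  assumes \<Omega>: "open \<Omega>" "bounded \<Omega>" and q: "1 \<le> q" and emb: "W_embedded \<Omega> s (ereal p) s' \<infinity>"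
  shows "W_embedded \<Omega> s (ereal p) 0 (ereal q)"
proof -
  have sets: "\<Omega> \<in> sets borel" using \<Omega> by simp
  define V where "V = measure lborel \<Omega> + 1"
  have V: "0 < V" unfolding V_def by (intro add_nonneg_pos) auto
  have em: "emeasure lborel \<Omega> \<le> ennreal V"
    using emeasure_bounded_finite[OF \<Omega>(2)] by (subst emeasure_eq_ennreal_measure) (auto simp: V_def intro: ennreal_leI)
  have le: "W_norm \<Omega> 0 (ereal q) u \<le> ennreal (V powr (1 / q)) * W_norm \<Omega> s' \<infinity> u" for u
  proof -
    let ?M = "lebesgue_on \<Omega>"
    let ?L = "Lp_norm ?M \<infinity> u"
    have L: "?L \<le> W_norm \<Omega> s' \<infinity> u" by (simp add: W_norm_def)
    have "W_norm \<Omega> 0 (ereal q) u \<le> ennreal (V powr (1 / q)) * ?L"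
    proof (cases ?L)
      case top
      then show ?thesis using V by (simp add: ennreal_mult_eq_top_iff)
    next
      case (real b)
      have "AE x in ?M. ennreal (norm (u x)) \<le> ?L"
        unfolding Lp_norm_def by (simp add: esssup_AE)
      then have "AE x in ?M. ennreal (norm (u x) powr q) \<le> ennreal (b powr q)"
        unfolding real(2)
      proof eventually_elim
        case (elim x)
        then show ?case using real(1) q by (intro ennreal_leI powr_mono2) auto
      qed
      then have "Lp_integral ?M q u \<le> (\<integral>\<^sup>+x. ennreal (b powr q) \<partial>?M)"
        unfolding Lp_integral_def by (rule nn_integral_mono_AE)
      also have "\<dots> = ennreal (b powr q) * emeasure lborel \<Omega>"
        using sets by (subst nn_integral_lebesgue_on) (simp_all add: nn_integral_cmult_indicator)
      also have "\<dots> \<le> ennreal (b powr q) * ennreal V" by (intro mult_left_mono em) simp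
      also have "\<dots> = ennreal ((V powr (1 / q) * b) powr q)"
        using V real q by (simp add: powr_mult powr_powr ennreal_mult mult.commute)
      finally have "W_norm \<Omega> 0 (ereal q) u \<le> ennreal (V powr (1 / q) * b)"
        using q real by (simp add: W_norm_zero epowr_le_ennreal_iff)
      then show ?thesis using real by (simp add: ennreal_mult)
    qed
    also have "\<dots> \<le> ennreal (V powr (1 / q)) * W_norm \<Omega> s' \<infinity> u" by (intro mult_left_mono L) simp
    finally show ?thesis .
  qed
  obtain C where C: "0 < C" "\<And>u. u \<in> W \<Omega> s (ereal p) \<Longrightarrow> W_norm \<Omega> s' \<infinity> u \<le> ennreal C * W_norm \<Omega> s (ereal p) u"
    using emb unfolding W_embedded_def by blast
  show ?thesis
    unfolding W_embedded_def
  proof (intro exI conjI ballI)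
    show "0 < V powr (1 / q) * C" using V C by simp
    fix u assume "u \<in> W \<Omega> s (ereal p)"
    then have "W_norm \<Omega> 0 (ereal q) u \<le> ennreal (V powr (1 / q)) * (ennreal C * W_norm \<Omega> s (ereal p) u)"
      by (intro order_trans[OF le mult_left_mono] C) auto
    then show "W_norm \<Omega> 0 (ereal q) u \<le> ennreal (V powr (1 / q) * C) * W_norm \<Omega> s (ereal p) u"
      using V C by (simp add: ennreal_mult mult.assoc)
  qed
qed

text \<open>Collects what oscillation excludes for \<open>s < 1\<close>; the surviving range
  \<open>s' = s\<close>, \<open>p \<le> p'\<close> is left to scaling.\<close>

lemma W_embedded_order_le:
  fixes \<Omega> :: "(real^'n) set"
  assumes s: "0 < s" "s < 1" and p: "1 \<le> p" and \<Omega>: "open \<Omega>" "bounded \<Omega>" "\<Omega> \<noteq> {}"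
    and s': "s \<le> s'" "s' \<le> 1" and p': "1 \<le> p'" and emb: "W_embedded \<Omega> s (ereal p) s' p'"
  shows "s' = s \<and> ereal p \<le> p'"
proof -
  obtain c \<delta> where c: "0 < \<delta>" "ball c \<delta> \<subseteq> \<Omega>"
    using \<Omega> by (meson all_not_in_conv open_contains_ball)
  \<comment> \<open>Chosen so that five half periods of the lowest frequency fit into half the
    radius of a ball in \<Omega>.\<close>
  define \<omega> where "\<omega> = max 1 (5 * pi / (\<delta> / 2))"
  obtain M where "lacunary s \<omega> M"
    using ex_lacunary[OF s, of \<omega>] by (auto simp: \<omega>_def)
  then interpret lacunary s \<omega> M "undefined :: 'n" .
  have c2: "ball c (2 * (\<delta> / 2)) \<subseteq> \<Omega>" using c by simp
  have r: "5 * pi / \<omega> \<le> \<delta> / 2"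
  proof -
    have "5 * pi / (\<delta> / 2) \<le> \<omega>" by (simp add: \<omega>_def)
    then show ?thesis using \<omega> c by (simp add: field_simps)
  qed
  show ?thesis
  proof (cases p')
    case (real q)
    then have q: "1 \<le> q" using p' by simp
    have "s' < 1"
      using not_W_embedded_first_order[OF \<Omega> p q] emb s' real by (cases "s' = 1") auto
    with W_embedded_oscillation[OF \<Omega>(1,2) c2 r p q s'(1)] emb real show ?thesis by simp
  next
    case PInf
    then show ?thesis using not_W_embedded_Hoelder[OF \<Omega>(1,2) c2 r p, of s'] emb s' by fastforce
  next
    case MInf
    then show ?thesis using p' by simp
  qed
qed

theorem proposition2p9:
  fixes \<Omega> :: "(real^'n) set" and s p s' :: real and p' :: ereal
  assumes "0 < s" "s \<le> 1" "1 \<le> p"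
    and "s * p < real CARD('n)" and "s \<noteq> p"
    and "open \<Omega>" "bounded \<Omega>" "connected \<Omega>" "\<Omega> \<noteq> {}" "lipschitz_boundary \<Omega>"
    and "0 \<le> s'" "s' \<le> 1" "1 \<le> p'"
    and "\<not> ((0 \<le> s' \<and> s' < s) \<and>
             (1 \<le> p' \<and> p' \<le> ereal (real CARD('n) * p / (real CARD('n) - (s - s') * p))))"
    (* In these cases the embedding does hold, by the identity (W_embedded_refl) or, for
       s = 1, by Hoelder's inequality on the bounded set. *)
    and "\<not> (s' = s \<and> (p' = ereal p \<or> (s = 1 \<and> p' \<le> ereal p)))"
  shows "\<not> W_embedded \<Omega> s (ereal p) s' p'"
proof
  assume emb: "W_embedded \<Omega> s (ereal p) s' p'"
  let ?N = "real CARD('n)"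
  \<comment> \<open>For \<open>s = 1\<close> the order \<open>s'\<close> must be 1 and the excluded
    cases leave only \<open>p < p'\<close>; for \<open>s < 1\<close> excluding the identity makes
    the inequality of \<open>W_embedded_order_le\<close> strict.\<close>
  have ord: "s \<le> s' \<Longrightarrow> s' = s \<and> ereal p < p'"
    using W_embedded_order_le[of s p \<Omega> s' p'] assms emb
    by (cases "s < 1") (auto simp: less_le)
  then have s': "s' \<le> s" by linarith
  show False
  proof (cases p')
    case (real q)
    then have q: "1 \<le> q" using assms(13) by simp
    have scal: "?N / p - s \<le> ?N / q - s'"
      using W_embedded_scaling[of s p s' q \<Omega>] assms emb real q by simp
    show False
    proof (cases "s' < s")
      case True
      have "(s - s') * p \<le> s * p" using assms by (intro mult_right_mono) auto
      \<comment> \<open>A positive denominator allows the negated condition on \<open>p'\<close> to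
        be cleared of fractions and compared with \<open>scal\<close>.\<close>
      then have d: "0 < ?N - (s - s') * p" using assms(4) by simp
      have "?N * p / (?N - (s - s') * p) < q" using assms(11,13,14) True real by auto
      then have "?N * p < q * (?N - (s - s') * p)" using d by (simp add: pos_divide_less_eq)
      then show False using scal assms(3) q by (simp add: field_simps)
    next
      case False
      \<comment> \<open>At equal orders scaling would require N/p \<le> N/q, that is
        \<open>q \<le> p\<close>.\<close>
      then have "s' = s" "p < q" using ord real by auto
      then show False using scal assms(3) by (simp add: field_simps)
    qed
  next
    case PInf
    have pos: "0 < ?N / p - s" using assms(3,4) by (simp add: field_simps)
    \<comment> \<open>Large enough that N/q is at most half of the positive number
      \<open>N / p - s\<close>, whereas scaling with \<open>s' = 0\<close> asks for
      \<open>N / p - s \<le> N / q\<close>.\<close>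
    define q where "q = max 1 (2 * ?N / (?N / p - s))"
    have q: "1 \<le> q" by (simp add: q_def)
    have "2 * ?N / (?N / p - s) \<le> q" by (simp add: q_def)
    then have "2 * ?N \<le> q * (?N / p - s)" using pos by (simp add: pos_divide_le_eq)
    then have "2 * ?N / q \<le> ?N / p - s" using q by (simp add: pos_divide_le_eq mult.commute)
    moreover have "?N / p - s \<le> ?N / q - 0"
      using W_embedded_scaling[of s p 0 q \<Omega>] W_embedded_bounded_imp_Lp[of \<Omega> q s p s'] assms emb PInf q by simp
    moreover have "0 < ?N / q" using q by simp
    ultimately show False by simp
  next
    case MInf
    then show False using assms(13) by simp
  qed
qed

end
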